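(* Let $Y$ be an affine algebraic variety defined over $\mathbb{R}$ and let $f\in\mathbb{R}[Y]$. Assume that for each connected component $Y^i$ of the smooth locus $Y_{\mathrm{reg}}$ one has $\dim Y^i\ge 2$ and $f$ is non-constant on $Y^i$. If $Y$ is flexible and the action of $\mathrm{SAut}(Y)$ on $Y_{\mathrm{reg}}$ is infinitely transitive on each connected component, then the suspension $X=\mathrm{Susp}(Y,f)$ is flexible and $\mathrm{SAut}(X)$ acts on $X_{\mathrm{reg}}$ infinitely transitively on each connected component.
   Context: Varieties are affine algebraic varieties over $\mathbb{R}$, considered through their real points; $\mathbb{R}[Y]$ is the algebra of regular (polynomial) functions, $Y_{\mathrm{reg}}$ is the set of smooth points of $Y$, and connected components are taken in the Euclidean topology. Suspension: for a non-constant $f\in\mathbb{R}[Y]$, the suspension $\mathrm{Susp}(Y,f)$ is the hypersurface $X=\{(y,u,v): uv-f(y)=0\}\subseteq Y\times\mathbb{A}^2$. Special automorphism group: $\mathrm{SAut}(X)$ is the subgroup of $\mathrm{Aut}(X)$ (algebraic automorphisms over $\mathbb{R}$) generated by all one-parameter subgroups isomorphic to the additive group $(\mathbb{R},+)$ (acting algebraically, i.e. of the form $t\mapsto\exp(t\partial)$ for a locally nilpotent derivation $\partial$ of $\mathbb{R}[X]$). Flexibility: a point $y\in Y$ is flexible if the tangent space $T_yY$ is spanned by the tangent vectors at $y$ to the orbits $H\cdot y$ of one-parameter subgroups $H\subseteq\mathrm{SAut}(Y)$, $H\cong(\mathbb{R},+)$. The variety $Y$ is flexible if every point of $Y_{\mathrm{reg}}$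 is flexible. Infinite transitivity on each connected component: the action of a group $G$ on $Z=Z^1\sqcup\dots\sqcup Z^s$ (decomposition into connected components) is infinitely transitive on each connected component if for every $s$-tuple $(m_1,\dots,m_s)$ of non-negative integers, $G$ is transitive on the $(m_1+\dots+m_s)$-tuples $(P^1_1,\dots,P^1_{m_1},\dots,P^s_1,\dots,P^s_{m_s})$ of pairwise distinct points with $P^i_j\in Z^i$. *)

theory Defs
  imports "HOL-Analysis.Analysis" "HOL-Algebra.Bij" "HOL-Algebra.Generated_Groups"
begin

text \<open>
  An affine variety is given by its set of real points, a real algebraic subset of a Euclidean
  space, not necessarily irreducible or equidimensional.
\<close>

definition algebraic_set :: "'a::euclidean_space set \<Rightarrow> bool" where
  "algebraic_set Y \<longleftrightarrow>
     (\<exists>S. (\<forall>p\<in>S. real_polynomial_function p) \<and> Y = {x. \<forall>p\<in>S. p x = 0})"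

definition vanishing_ideal :: "'a::euclidean_space set \<Rightarrow> ('a \<Rightarrow> real) set" where
  "vanishing_ideal Y = {p. real_polynomial_function p \<and> (\<forall>x\<in>Y. p x = 0)}"

text \<open>Elements of \<open>\<real>[Y]\<close> are extensional: they have the value \<open>undefined\<close> off \<open>Y\<close>.\<close>

definition regular_functions :: "'a::euclidean_space set \<Rightarrow> ('a \<Rightarrow> real) set" where
  "regular_functions Y = {restrict p Y | p. real_polynomial_function p}"

text \<open>The Zariski tangent space, as a linear subspace of the ambient space.\<close>

definition tangent_space :: "'a::euclidean_space set \<Rightarrow> 'a \<Rightarrow> 'a set" where
  "tangent_space Y y = {v. \<forall>p\<in>vanishing_ideal Y. frechet_derivative p (at y) v = 0}"

text \<open>
  Smoothness of relative dimension \<open>d\<close> over \<open>\<real>\<close>, as in Bosch--Luetkebohmert--Raynaud,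
  Neron Models, 2.2: near \<open>y\<close> (in the local ring of the ambient space at \<open>y\<close>) the ideal of \<open>Y\<close>
  is generated by \<open>k = n - d\<close> elements whose differentials at \<open>y\<close> are linearly independent.
  Denominators \<open>h\<close> with \<open>h y \<noteq> 0\<close> express the localization.
\<close>

definition smooth_at :: "'a::euclidean_space set \<Rightarrow> nat \<Rightarrow> 'a \<Rightarrow> bool" where
  "smooth_at Y d y \<longleftrightarrow> y \<in> Y \<and>
     (\<exists>(k::nat) F. k + d = DIM('a) \<and>
        (\<forall>i<k. F i \<in> vanishing_ideal Y) \<and>
        (\<forall>p\<in>vanishing_ideal Y. \<exists>h a.
            real_polynomial_function h \<and> h y \<noteq> 0 \<and>
            (\<forall>i<k. real_polynomial_function (a i)) \<and>
            (\<forall>x. h x * p x = (\<Sum>i<k. a i x * F i x))) \<and>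
        (\<forall>c. (\<forall>v. (\<Sum>i<k. c i * frechet_derivative (F i) (at y) v) = 0)
              \<longrightarrow> (\<forall>i<k. c i = 0)))"

definition smooth_locus :: "'a::euclidean_space set \<Rightarrow> 'a set" where
  "smooth_locus Y = {y. \<exists>d. smooth_at Y d y}"

definition suspension :: "'a::euclidean_space set \<Rightarrow> ('a \<Rightarrow> real) \<Rightarrow> ('a \<times> real \<times> real) set" where
  "suspension Y f = {(y, u, v). y \<in> Y \<and> u * v - f y = 0}"

definition regular_selfmap :: "'a::euclidean_space set \<Rightarrow> ('a \<Rightarrow> 'a) \<Rightarrow> bool" where
  "regular_selfmap Y \<phi> \<longleftrightarrow> (\<exists>P. polynomial_function P \<and> (\<forall>x\<in>Y. \<phi> x = P x))"

definition Aut :: "'a::euclidean_space set \<Rightarrow> ('a \<Rightarrow> 'a) monoid" where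
  "Aut Y = BijGroup Y
     \<lparr>carrier := {\<phi> \<in> Bij Y. regular_selfmap Y \<phi> \<and> regular_selfmap Y (inv_into Y \<phi>)}\<rparr>"

definition derivation_on :: "'a::euclidean_space set \<Rightarrow> (('a \<Rightarrow> real) \<Rightarrow> ('a \<Rightarrow> real)) \<Rightarrow> bool" where
  "derivation_on Y D \<longleftrightarrow>
     (\<forall>g\<in>regular_functions Y. D g \<in> regular_functions Y) \<and>
     (\<forall>g\<in>regular_functions Y. \<forall>c. D (\<lambda>x\<in>Y. c * g x) = (\<lambda>x\<in>Y. c * D g x)) \<and>
     (\<forall>g\<in>regular_functions Y. \<forall>h\<in>regular_functions Y.
        D (\<lambda>x\<in>Y. g x + h x) = (\<lambda>x\<in>Y. D g x + D h x) \<and>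
        D (\<lambda>x\<in>Y. g x * h x) = (\<lambda>x\<in>Y. D g x * h x + g x * D h x))"

definition locally_nilpotent_derivation ::
    "'a::euclidean_space set \<Rightarrow> (('a \<Rightarrow> real) \<Rightarrow> ('a \<Rightarrow> real)) \<Rightarrow> bool" where
  "locally_nilpotent_derivation Y D \<longleftrightarrow> derivation_on Y D \<and>
     (\<forall>g\<in>regular_functions Y. \<exists>n. (D ^^ n) g = (\<lambda>x\<in>Y. 0))"

text \<open>
  A parametrized one-parameter subgroup \<open>t \<mapsto> \<phi> t\<close> of \<open>Aut Y\<close>: an embedding of \<open>(\<real>,+)\<close> for which
  the action \<open>g \<mapsto> g \<circ> \<phi> t\<close> on \<open>\<real>[Y]\<close> is \<open>exp (t D)\<close>. By local nilpotency the series has only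
  finitely many nonzero terms.
\<close>

definition one_parameter_subgroup :: "'a::euclidean_space set \<Rightarrow> (real \<Rightarrow> 'a \<Rightarrow> 'a) \<Rightarrow> bool" where
  "one_parameter_subgroup Y \<phi> \<longleftrightarrow>
     (\<forall>t. \<phi> t \<in> carrier (Aut Y)) \<and>
     (\<forall>s t. \<phi> (s + t) = \<phi> s \<otimes>\<^bsub>Aut Y\<^esub> \<phi> t) \<and>
     inj \<phi> \<and>
     (\<exists>D. locally_nilpotent_derivation Y D \<and>
        (\<forall>t. \<forall>g\<in>regular_functions Y. \<forall>x\<in>Y.
           (\<lambda>k. t ^ k / fact k * (D ^^ k) g x) sums g (\<phi> t x)))"

definition SAut :: "'a::euclidean_space set \<Rightarrow> ('a \<Rightarrow> 'a) set" where
  "SAut Y = generate (Aut Y) (\<Union>{range \<phi> | \<phi>. one_parameter_subgroup Y \<phi>})"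

definition flexible_point :: "'a::euclidean_space set \<Rightarrow> 'a \<Rightarrow> bool" where
  "flexible_point Y y \<longleftrightarrow>
     span {vector_derivative (\<lambda>t. \<phi> t y) (at 0) | \<phi>. one_parameter_subgroup Y \<phi>}
       = tangent_space Y y"

definition flexible :: "'a::euclidean_space set \<Rightarrow> bool" where
  "flexible Y \<longleftrightarrow> (\<forall>y\<in>smooth_locus Y. flexible_point Y y)"

text \<open>
  A tuple with \<open>m C\<close> pairwise distinct entries in each connected component \<open>C\<close> of \<open>Z\<close>; entries in
  different components are automatically distinct.
\<close>

definition component_tuple ::
    "'a::topological_space set \<Rightarrow> ('a set \<Rightarrow> nat) \<Rightarrow> ('a set \<Rightarrow> nat \<Rightarrow> 'a) \<Rightarrow> bool" where
  "component_tuple Z m P \<longleftrightarrow>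
     (\<forall>C\<in>components Z. (\<forall>j<m C. P C j \<in> C) \<and> inj_on (P C) {..<m C})"

text \<open>
  The finiteness condition on \<open>m\<close> says that tuples are finite. It holds for every \<open>m\<close> when \<open>Z\<close> has
  finitely many components, as the smooth locus of an algebraic set does.
\<close>

definition infinitely_transitive_on_components ::
    "('a::topological_space \<Rightarrow> 'a) set \<Rightarrow> 'a set \<Rightarrow> bool" where
  "infinitely_transitive_on_components G Z \<longleftrightarrow>
     (\<forall>m P Q. finite {C \<in> components Z. m C \<noteq> 0} \<longrightarrow>
        component_tuple Z m P \<longrightarrow> component_tuple Z m Q \<longrightarrow>
        (\<exists>g\<in>G. \<forall>C\<in>components Z. \<forall>j<m C. g (P C j) = Q C j))"

end

theory Submission
  imports Defs
begin

text \<open>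
  One-parameter subgroups are the nontrivial polynomial flows \<open>M (t, y)\<close>. A flow on \<open>Y\<close> lifts to the
  suspension \<open>u v = p y\<close> with time rescaled to \<open>t u r(u)\<close>, preserving every level of \<open>u\<close>. Choosing the
  polynomial \<open>r\<close> to vanish on other levels, one moves points within a single level \<open>u = a\<close>, which is a
  copy of \<open>Y\<close> if \<open>a\<close> is nonzero, while fixing finitely many others; the same holds for \<open>v\<close>.
  Alternating the two, and using that \<open>p\<close> takes an interval of values on each component of
  \<open>Y\<^sub>r\<^sub>e\<^sub>g\<close>, one links any two points of a component. Conjugating flows that change \<open>u\<close> by flows that
  preserve \<open>u\<close> yields flexibility. Away from \<open>u = v = 0\<close> the suspension is smooth exactly over
  \<open>Y\<^sub>r\<^sub>e\<^sub>g\<close>. If it is smooth at \<open>(y, 0, 0)\<close>, then \<open>y\<close> is smooth and \<open>p\<close> is not critical there, so that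
  a lifted flow leaves the locus \<open>u = v = 0\<close>.
\<close>

section \<open>Polynomial functions\<close>

text \<open>The obstacle throughout is the locus u = v = 0. On the level u = 0 a lifted flow fixes y
  and moves only v, with speed r(0) times the derivative of \<open>p\<close> along the flow of Y.
  With r(0) = 0 the whole level stays fixed; with r(0) = 1 a point leaves the locus, provided
  \<open>p\<close> is not critical there, and this has to be extracted from smoothness of X.
  Smoothness refers to the full vanishing ideal of X, which is computed here where u is invertible:
  after multiplication by a power of u, every function reduces modulo the equation to a polynomial
  in u with coefficients on Y. Hence a smooth point (y, 0, 0) is first traded for smooth points (y,
  u, 0) with small nonzero u, and this in turn needs finitely many local generators of the ideal of
  Y. Transitivity on tuples is reduced to moving one point while a finite set S stays fixed.
  Auxiliary points avoid S because their value of \<open>p\<close> is chosen outside the finitely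
  many values taken under S; a nonconstant \<open>p\<close> on a connected set leaves infinitely
  many values to choose from.\<close>

lemmas real_polynomial_function_add = real_polynomial_function.intros(3)
lemmas real_polynomial_function_mult = real_polynomial_function.intros(4)

lemma real_polynomial_function_comp:
  "real_polynomial_function p \<Longrightarrow> polynomial_function P \<Longrightarrow> real_polynomial_function (\<lambda>x. p (P x))"
  using real_polynomial_function_compose[of P p] by (simp add: o_def)

lemma polynomial_function_comp:
  "polynomial_function Q \<Longrightarrow> polynomial_function P \<Longrightarrow> polynomial_function (\<lambda>x. Q (P x))"
  using polynomial_function_compose[of P Q] by (simp add: o_def)

lemma polynomial_function_imp_real:
  "polynomial_function (p :: 'a::real_normed_vector \<Rightarrow> real) \<Longrightarrow> real_polynomial_function p"
  by (simp add: real_polynomial_function_eq)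

lemma real_polynomial_function_imp:
  "real_polynomial_function p \<Longrightarrow> polynomial_function p"
  by (simp add: real_polynomial_function_eq)

lemma polynomial_function_Pair:
  assumes "polynomial_function P" "polynomial_function Q"
  shows "polynomial_function (\<lambda>x. (P x, Q x))"
  unfolding polynomial_function_def
proof (intro allI impI)
  fix h :: "'b \<times> 'c \<Rightarrow> real" assume h: "bounded_linear h"
  have 1: "bounded_linear (\<lambda>a. h (a, 0))" "bounded_linear (\<lambda>b. h (0, b))"
    using h by (auto intro!: bounded_linear_compose[OF h] bounded_linear_Pair bounded_linear_ident bounded_linear_zero)
  have "h (P x, Q x) = h (P x, 0) + h (0, Q x)" for x
    using linear_add[OF bounded_linear.linear[OF h], of "(P x, 0)" "(0, Q x)"] by simp
  then show "real_polynomial_function (h \<circ> (\<lambda>x. (P x, Q x)))"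
    using assms 1 unfolding polynomial_function_def o_def
    by (auto intro!: real_polynomial_function_add)
qed

lemma polynomial_function_fst: "polynomial_function P \<Longrightarrow> polynomial_function (\<lambda>x. fst (P x))"
  by (rule polynomial_function_comp[of fst]) (auto intro: polynomial_function_bounded_linear bounded_linear_fst)

lemma polynomial_function_snd: "polynomial_function P \<Longrightarrow> polynomial_function (\<lambda>x. snd (P x))"
  by (rule polynomial_function_comp[of snd]) (auto intro: polynomial_function_bounded_linear bounded_linear_snd)

lemma polynomial_function_times:
  "polynomial_function P \<Longrightarrow> polynomial_function Q \<Longrightarrow> polynomial_function (\<lambda>x. P x * Q x :: real)"
  by (metis real_polynomial_function_eq real_polynomial_function_mult)

lemma polynomial_function_rpoly:
  "polynomial_function P \<Longrightarrow> polynomial_function (\<lambda>x. poly r (P x) :: real)"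
  by (induction r) (auto intro!: polynomial_function_times polynomial_function_add)

named_theorems polyfun

lemmas [polyfun] = polynomial_function_const polynomial_function_id polynomial_function_Pair
  polynomial_function_fst polynomial_function_snd polynomial_function_times polynomial_function_rpoly
  polynomial_function_add polynomial_function_mult polynomial_function_diff polynomial_function_minus

lemma has_derivative_real_polynomial_function:
  assumes "real_polynomial_function p"
  shows "(p has_derivative frechet_derivative p (at x)) (at x)"
proof -
  have "p differentiable at x"
    using assms
  proof induction
    case (linear f)
    then show ?case by (simp add: bounded_linear_imp_differentiable)
  qed auto
  then show ?thesis by (simp add: frechet_derivative_works)
qed

lemma has_derivative_polynomial_function:
  fixes P :: "'a::real_normed_vector \<Rightarrow> 'b::euclidean_space"
  assumes "polynomial_function P"
  shows "(P has_derivative frechet_derivative P (at x)) (at x)"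
proof -
  have "P differentiable at x"
  proof -
    have "\<exists>D. ((\<lambda>x. P x \<bullet> b) has_derivative D) (at x)" if "b \<in> Basis" for b
      using has_derivative_real_polynomial_function[of "\<lambda>x. P x \<bullet> b" x] assms that
      unfolding polynomial_function_iff_Basis_inner by blast
    then show ?thesis
      using differentiable_componentwise_within[of P x UNIV] by (auto simp: differentiable_def)
  qed
  then show ?thesis by (simp add: frechet_derivative_works)
qed

lemma linear_frechet_derivative_polynomial:
  "real_polynomial_function p \<Longrightarrow> linear (frechet_derivative p (at x))"
  using has_derivative_real_polynomial_function bounded_linear.linear has_derivative_bounded_linear
  by blast

text \<open>A polynomial in one variable t whose coefficients are polynomial functions of x. The
  degree bound is uniform in x, so that expanding into coefficients gives a finite sum that is
  polynomial in (t, x) jointly. This form allows division by t and comparison of coefficients for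
  each x.\<close>

definition poly_family :: "('a::real_normed_vector \<Rightarrow> real poly) \<Rightarrow> bool" where
  "poly_family c \<longleftrightarrow> (\<forall>j. real_polynomial_function (\<lambda>x. coeff (c x) j)) \<and> (\<exists>m. \<forall>x. degree (c x) \<le> m)"

lemma poly_family_const: "poly_family (\<lambda>x. r)"
  unfolding poly_family_def by auto

lemma poly_family_coeff:
  assumes "real_polynomial_function p" shows "poly_family (\<lambda>x. [:p x:])"
  unfolding poly_family_def
proof (intro conjI allI exI)
  fix j show "real_polynomial_function (\<lambda>x. coeff [:p x:] j)"
    using assms by (cases j) auto
qed (simp)

lemma poly_family_add:
  assumes "poly_family c" "poly_family d" shows "poly_family (\<lambda>x. c x + d x)"
proof -
  obtain m n where "\<And>x. degree (c x) \<le> m" "\<And>x. degree (d x) \<le> n"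
    using assms unfolding poly_family_def by blast
  then have "degree (c x + d x) \<le> max m n" for x
    by (meson degree_add_le_max max.mono order_trans)
  then show ?thesis using assms unfolding poly_family_def by auto
qed

lemma poly_family_mult:
  assumes "poly_family c" "poly_family d" shows "poly_family (\<lambda>x. c x * d x)"
proof -
  obtain m n where "\<And>x. degree (c x) \<le> m" "\<And>x. degree (d x) \<le> n"
    using assms unfolding poly_family_def by blast
  then have "degree (c x * d x) \<le> m + n" for x
    by (meson degree_mult_le add_mono order_trans)
  then show ?thesis using assms unfolding poly_family_def
    by (auto simp: coeff_mult intro!: real_polynomial_function_sum real_polynomial_function_mult exI[of _ "m + n"])
qed

lemma poly_family_coeff_polynomial:
  "poly_family c \<Longrightarrow> real_polynomial_function (\<lambda>x. coeff (c x) j)"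
  unfolding poly_family_def by blast

lemma poly_eq_sum_atMost:
  fixes q :: "'a::comm_semiring_1 poly"
  assumes "degree q \<le> m" shows "poly q u = (\<Sum>j\<le>m. coeff q j * u ^ j)"
proof -
  have "(\<Sum>j\<le>m. coeff q j * u ^ j) = (\<Sum>j\<le>degree q. coeff q j * u ^ j)"
    using assms by (intro sum.mono_neutral_right) (auto simp: coeff_eq_0)
  then show ?thesis by (simp add: poly_altdef)
qed

lemma poly_eqI_infinite:
  fixes p q :: "'a::{comm_ring_1,ring_no_zero_divisors} poly"
  assumes "infinite A" "\<And>x. x \<in> A \<Longrightarrow> poly p x = poly q x"
  shows "p = q"
proof (rule ccontr)
  assume "p \<noteq> q"
  then have "finite {x. poly (p - q) x = 0}" by (intro poly_roots_finite) simp
  moreover have "A \<subseteq> {x. poly (p - q) x = 0}" using assms(2) by auto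
  ultimately show False using assms(1) finite_subset by blast
qed

lemma polynomial_function_poly_family:
  fixes q :: "real \<times> 'a::real_normed_vector \<Rightarrow> real"
  assumes "real_polynomial_function q"
  obtains c where "poly_family c" "\<And>t x. q (t, x) = poly (c x) t"
proof -
  have "\<exists>c. poly_family c \<and> (\<forall>t x. q (t, x) = poly (c x) t)"
    using assms
  proof induction
    case (linear h)
    have "bounded_linear (\<lambda>x. h (0, x))"
      by (rule bounded_linear_compose[OF linear bounded_linear_Pair[OF bounded_linear_zero bounded_linear_ident]])
    then have 1: "real_polynomial_function (\<lambda>x. h (0, x))"
      by (rule real_polynomial_function.intros)
    have 2: "h (t, x) = h (0, x) + t * h (1, 0)" for t x
      using linear_add[OF bounded_linear.linear[OF linear], of "(t, 0)" "(0, x)"]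
        linear_scale[OF bounded_linear.linear[OF linear], of t "(1, 0)"] by simp
    have "poly_family (\<lambda>x. [:h (0, x):] + [:0, h (1, 0):])"
      by (rule poly_family_add[OF poly_family_coeff[OF 1] poly_family_const])
    moreover have "\<forall>t x. h (t, x) = poly ([:h (0, x):] + [:0, h (1, 0):]) t"
      by (intro allI, subst 2) simp
    ultimately show ?case by (intro exI[of _ "\<lambda>x. [:h (0, x):] + [:0, h (1, 0):]"] conjI)
  next
    case (const k)
    then show ?case by (intro exI[of _ "\<lambda>x. [:k:]"]) (simp add: poly_family_const)
  next
    case (add f g)
    obtain c where c: "poly_family c" "\<And>t x. f (t, x) = poly (c x) t"
      using add.IH(1) by auto
    moreover obtain d where "poly_family d" "\<And>t x. g (t, x) = poly (d x) t"
      using add.IH(2) by auto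
    ultimately show ?case
      by (intro exI[of _ "\<lambda>x. c x + d x"]) (simp add: poly_family_add)
  next
    case (mult f g)
    obtain c where c: "poly_family c" "\<And>t x. f (t, x) = poly (c x) t"
      using mult.IH(1) by auto
    moreover obtain d where "poly_family d" "\<And>t x. g (t, x) = poly (d x) t"
      using mult.IH(2) by auto
    ultimately show ?case
      by (intro exI[of _ "\<lambda>x. c x * d x"]) (simp add: poly_family_mult)
  qed
  then obtain c where "poly_family c" "\<forall>t x. q (t, x) = poly (c x) t" by (elim exE conjE)
  then show thesis by (intro that) simp_all
qed

lemma poly_family_polynomial_function:
  assumes "poly_family c"
  shows "polynomial_function (\<lambda>(t, x). poly (c x) t)"
proof -
  obtain m where m: "\<And>x. degree (c x) \<le> m" using assms unfolding poly_family_def by blast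
  have t: "real_polynomial_function (\<lambda>z :: real \<times> 'a. fst z)"
    by (intro polynomial_function_imp_real polyfun)
  have x: "polynomial_function (\<lambda>z :: real \<times> 'a. snd z)"
    by (intro polyfun)
  have "real_polynomial_function (\<lambda>z. \<Sum>j\<le>m. coeff (c (snd z)) j * (fst z) ^ j)"
    by (intro real_polynomial_function_sum real_polynomial_function_mult real_polynomial_function_power t
       real_polynomial_function_comp[OF poly_family_coeff_polynomial[OF assms] x] finite_atMost)
  then show ?thesis
    by (simp add: poly_eq_sum_atMost[OF m] case_prod_beta' real_polynomial_function_eq)
qed

section \<open>Polynomial flows and one-parameter subgroups\<close>

definition poly_flow :: "'a::euclidean_space set \<Rightarrow> (real \<times> 'a \<Rightarrow> 'a) \<Rightarrow> bool" where
  "poly_flow Y M \<longleftrightarrow> polynomial_function M \<and> (\<forall>t. \<forall>x\<in>Y. M (t, x) \<in> Y) \<and>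
     (\<forall>x\<in>Y. M (0, x) = x) \<and> (\<forall>s t. \<forall>x\<in>Y. M (s + t, x) = M (s, M (t, x)))"

lemma poly_flowD:
  assumes "poly_flow Y M"
  shows "polynomial_function M"
    and "x \<in> Y \<Longrightarrow> M (t, x) \<in> Y"
    and "x \<in> Y \<Longrightarrow> M (0, x) = x"
    and "x \<in> Y \<Longrightarrow> M (s, M (t, x)) = M (s + t, x)"
    and "x \<in> Y \<Longrightarrow> M (-t, M (t, x)) = x"
    and "x \<in> Y \<Longrightarrow> M (t, M (-t, x)) = x"
proof -
  show "polynomial_function M" "x \<in> Y \<Longrightarrow> M (t, x) \<in> Y" "x \<in> Y \<Longrightarrow> M (0, x) = x"
    using assms unfolding poly_flow_def by auto
  show 1: "x \<in> Y \<Longrightarrow> M (s, M (t, x)) = M (s + t, x)" for s t x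
    using assms unfolding poly_flow_def by simp
  show "x \<in> Y \<Longrightarrow> M (-t, M (t, x)) = x" "x \<in> Y \<Longrightarrow> M (t, M (-t, x)) = x"
    using assms 1[of x "-t" t] 1[of x "t" "-t"] unfolding poly_flow_def by simp_all
qed

section \<open>Computing in the automorphism group\<close>

lemma carrier_Aut:
  "carrier (Aut Y) = {\<phi> \<in> Bij Y. regular_selfmap Y \<phi> \<and> regular_selfmap Y (inv_into Y \<phi>)}"
  by (simp add: Aut_def)

lemma one_Aut: "\<one>\<^bsub>Aut Y\<^esub> = (\<lambda>x\<in>Y. x)"
  by (simp add: Aut_def BijGroup_def)

lemma mult_Aut:
  assumes "\<phi> \<in> carrier (Aut Y)" "\<psi> \<in> carrier (Aut Y)"
  shows "\<phi> \<otimes>\<^bsub>Aut Y\<^esub> \<psi> = (\<lambda>x\<in>Y. \<phi> (\<psi> x))"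
  using assms unfolding carrier_Aut by (simp add: Aut_def BijGroup_def compose_def)

lemma carrier_AutI:
  assumes "polynomial_function P" "polynomial_function Q"
    and "\<And>x. x \<in> Y \<Longrightarrow> P x \<in> Y" "\<And>x. x \<in> Y \<Longrightarrow> Q x \<in> Y"
    and "\<And>x. x \<in> Y \<Longrightarrow> Q (P x) = x" "\<And>x. x \<in> Y \<Longrightarrow> P (Q x) = x"
  shows "(\<lambda>x\<in>Y. P x) \<in> carrier (Aut Y)"
proof -
  have bij: "bij_betw (\<lambda>x\<in>Y. P x) Y Y"
    by (rule bij_betw_byWitness[where f' = Q]) (use assms in auto)
  have "inv_into Y (\<lambda>x\<in>Y. P x) x = Q x" if "x \<in> Y" for x
    using that bij assms by (intro inv_into_f_eq) (auto simp: bij_betw_def)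
  then show ?thesis
    using bij assms(1,2) unfolding carrier_Aut Bij_def regular_selfmap_def by auto
qed

text \<open>Injectivity of \<phi> on Y turns the right inverse into a two-sided one and determines
  its values on Y; extensionality determines the rest. The inverse is thus read off from its
  defining equations.\<close>

lemma inv_Aut:
  assumes "\<phi> \<in> carrier (Aut Y)" "\<psi> \<in> carrier (Aut Y)" "\<And>x. x \<in> Y \<Longrightarrow> \<phi> (\<psi> x) = x"
  shows "inv\<^bsub>Aut Y\<^esub> \<phi> = \<psi>"
  unfolding m_inv_def
proof (rule the_equality)
  have inj: "inj_on \<phi> Y" and ext: "\<phi> \<in> extensional Y" "\<psi> \<in> extensional Y" and
    Y: "\<And>x. x \<in> Y \<Longrightarrow> \<phi> x \<in> Y" "\<And>x. x \<in> Y \<Longrightarrow> \<psi> x \<in> Y"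
    using assms(1,2) unfolding carrier_Aut Bij_def bij_betw_def by auto
  have "\<psi> (\<phi> x) = x" if "x \<in> Y" for x
    using that inj_onD[OF inj, of "\<psi> (\<phi> x)" x] Y assms(3) by blast
  then show "\<psi> \<in> carrier (Aut Y) \<and> \<phi> \<otimes>\<^bsub>Aut Y\<^esub> \<psi> = \<one>\<^bsub>Aut Y\<^esub> \<and> \<psi> \<otimes>\<^bsub>Aut Y\<^esub> \<phi> = \<one>\<^bsub>Aut Y\<^esub>"
    using assms by (auto simp: mult_Aut one_Aut intro!: restrict_ext)
  fix \<psi>' assume \<psi>': "\<psi>' \<in> carrier (Aut Y) \<and> \<phi> \<otimes>\<^bsub>Aut Y\<^esub> \<psi>' = \<one>\<^bsub>Aut Y\<^esub> \<and> \<psi>' \<otimes>\<^bsub>Aut Y\<^esub> \<phi> = \<one>\<^bsub>Aut Y\<^esub>"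
  then have ext': "\<psi>' \<in> extensional Y" and Y': "\<And>x. x \<in> Y \<Longrightarrow> \<psi>' x \<in> Y"
    unfolding carrier_Aut Bij_def bij_betw_def by auto
  have "\<phi> (\<psi>' x) = x" if "x \<in> Y" for x
    using \<psi>' assms(1) that by (auto simp: mult_Aut one_Aut dest!: fun_cong[of _ _ x])
  then have "\<psi>' x = \<psi> x" if "x \<in> Y" for x
    using that inj_onD[OF inj, of "\<psi>' x" "\<psi> x"] assms(3) Y Y' by simp
  then show "\<psi>' = \<psi>" using extensionalityI[OF ext' ext(2)] by blast
qed

lemma flow_in_Aut: "poly_flow Y M \<Longrightarrow> (\<lambda>x\<in>Y. M (t, x)) \<in> carrier (Aut Y)"
  by (rule carrier_AutI[where Q = "\<lambda>x. M (-t, x)"])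
    (auto simp: poly_flowD intro!: polynomial_function_comp[OF poly_flowD(1)] polyfun)

section \<open>Polynomial flows and exponentials of locally nilpotent derivations\<close>

lemma regular_along_flow:
  assumes "poly_flow Y M" "g \<in> regular_functions Y"
  obtains c where "poly_family c" "\<And>t x. x \<in> Y \<Longrightarrow> g (M (t, x)) = poly (c x) t"
proof -
  obtain p where p: "real_polynomial_function p" "g = restrict p Y"
    using assms(2) unfolding regular_functions_def by blast
  obtain c where "poly_family c" "\<And>t x. p (M (t, x)) = poly (c x) t"
    using polynomial_function_poly_family[OF real_polynomial_function_comp[OF p(1) poly_flowD(1)[OF assms(1)]]]
    by auto
  then show thesis using that p(2) poly_flowD(2)[OF assms(1)] by simp
qed

lemma DERIV_poly_shift: "((\<lambda>s. poly r (s + t :: real)) has_field_derivative poly (pderiv r) t) (at 0)"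
  using poly_DERIV[of r t] DERIV_shift[of "poly r" "poly (pderiv r) t" 0 t] by simp

text \<open>By the group law, starting at \<open>M (t, x)\<close> only shifts time by t.
  Differentiation at time 0 therefore acts along a whole orbit as \<open>pderiv\<close>, and can be
  iterated.\<close>

lemma deriv_along_flow:
  assumes "poly_flow Y M" "x \<in> Y" "\<And>t. g (M (t, x)) = poly r t"
  shows "deriv (\<lambda>s. g (M (s, M (t, x)))) 0 = poly (pderiv r) t"
proof -
  have "(\<lambda>s. g (M (s, M (t, x)))) = (\<lambda>s. poly r (s + t))"
    using assms(2,3) poly_flowD(4)[OF assms(1)] by simp
  then show ?thesis using DERIV_imp_deriv[OF DERIV_poly_shift] by metis
qed

lemma higher_pderiv_eq_0:
  fixes r :: "real poly"
  assumes "degree r \<le> m" "m < k" shows "(pderiv ^^ k) r = 0"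
  by (rule poly_eqI) (use assms in \<open>simp add: coeff_higher_pderiv coeff_eq_0\<close>)

lemma poly_higher_pderiv_0: "poly ((pderiv ^^ k) r) 0 = fact k * coeff r k"
  for r :: "real poly"
  by (simp add: poly_0_coeff_0 coeff_higher_pderiv pochhammer_fact[symmetric])

text \<open>Along an orbit, \<open>(D ^^ k) g\<close> is the k-th formal derivative of the
  polynomial \<open>g (M (t, x))\<close> in t. Its degree is bounded uniformly in x, which gives
  nilpotency on g, and the exponential series is its finite Taylor expansion at 0.\<close>

lemma flow_derivation:
  fixes M :: "real \<times> 'a::euclidean_space \<Rightarrow> 'a"
  assumes M: "poly_flow Y M"
  defines "D \<equiv> \<lambda>g. \<lambda>x\<in>Y. deriv (\<lambda>t. g (M (t, x))) 0"
  shows "locally_nilpotent_derivation Y D"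
    and "g \<in> regular_functions Y \<Longrightarrow> x \<in> Y \<Longrightarrow>
      (\<lambda>k. t ^ k / fact k * (D ^^ k) g x) sums g (M (t, x))"
proof -
  have D_app: "D g z = deriv (\<lambda>t. g (M (t, z))) 0" if "z \<in> Y" for g z
    using that by (simp add: D_def)
  have D_reg: "D g \<in> regular_functions Y" if "g \<in> regular_functions Y" for g
  proof -
    obtain c where c: "poly_family c" "\<And>t x. x \<in> Y \<Longrightarrow> g (M (t, x)) = poly (c x) t"
      by (rule regular_along_flow[OF M \<open>g \<in> _\<close>], rule that)
    have "D g = restrict (\<lambda>x. coeff (pderiv (c x)) 0) Y"
      unfolding D_def using deriv_along_flow[OF M, of _ g _ 0] c(2)
      by (auto simp: poly_flowD(3)[OF M] poly_0_coeff_0 intro!: restrict_ext)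
    moreover have "real_polynomial_function (\<lambda>x. coeff (pderiv (c x)) 0)"
      using poly_family_coeff_polynomial[OF c(1)]
      by (simp add: coeff_pderiv)
    ultimately show ?thesis unfolding regular_functions_def by blast
  qed
  have D_iter: "(D ^^ k) g \<in> regular_functions Y \<and>
      (\<forall>x\<in>Y. \<forall>t. (D ^^ k) g (M (t, x)) = poly ((pderiv ^^ k) (c x)) t)"
    if g: "g \<in> regular_functions Y" and c: "\<And>t x. x \<in> Y \<Longrightarrow> g (M (t, x)) = poly (c x) t" for g c k
  proof (induction k)
    case 0
    then show ?case using g c by simp
  next
    case (Suc k)
    have "(D ^^ Suc k) g (M (t, x)) = poly ((pderiv ^^ Suc k) (c x)) t" if "x \<in> Y" for x t
      using deriv_along_flow[OF M that, of "(D ^^ k) g" "(pderiv ^^ k) (c x)" t] Suc that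
      by (simp add: D_app poly_flowD(2)[OF M that])
    then show ?case using Suc D_reg by simp
  qed
  have diff: "(\<lambda>t. g (M (t, x))) field_differentiable (at 0)"
    if g: "g \<in> regular_functions Y" and x: "x \<in> Y" for g x
  proof -
    obtain c where c: "poly_family c" "\<And>t x. x \<in> Y \<Longrightarrow> g (M (t, x)) = poly (c x) t"
      by (rule regular_along_flow[OF M g], rule that)
    show ?thesis unfolding c(2)[OF x] field_differentiable_def using poly_DERIV by blast
  qed
  have Mx: "x \<in> Y \<Longrightarrow> M (t, x) \<in> Y" for t x using poly_flowD(2)[OF M] .
  have "derivation_on Y D"
    unfolding derivation_on_def
  proof (intro conjI ballI allI)
    fix g c assume g: "g \<in> regular_functions Y"
    show "D g \<in> regular_functions Y" using D_reg g .
    show "D (\<lambda>x\<in>Y. c * g x) = (\<lambda>x\<in>Y. c * D g x)"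
      unfolding D_def using Mx diff[OF g] by (intro restrict_ext) (auto simp: deriv_cmult)
  next
    fix g h assume g: "g \<in> regular_functions Y" and h: "h \<in> regular_functions Y"
    show "D (\<lambda>x\<in>Y. g x + h x) = (\<lambda>x\<in>Y. D g x + D h x)"
      unfolding D_def using Mx diff[OF g] diff[OF h] by (intro restrict_ext) (auto simp: deriv_add)
    show "D (\<lambda>x\<in>Y. g x * h x) = (\<lambda>x\<in>Y. D g x * h x + g x * D h x)"
      unfolding D_def using Mx diff[OF g] diff[OF h]
      by (intro restrict_ext) (auto simp: deriv_mult poly_flowD(3)[OF M])
  qed
  moreover have "\<exists>n. (D ^^ n) g = (\<lambda>x\<in>Y. 0)" if g: "g \<in> regular_functions Y" for g
  proof -
    obtain c where c: "poly_family c" "\<And>t x. x \<in> Y \<Longrightarrow> g (M (t, x)) = poly (c x) t"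
      by (rule regular_along_flow[OF M g], rule that)
    obtain m where m: "\<And>x. degree (c x) \<le> m" using c(1) unfolding poly_family_def by blast
    have "(D ^^ Suc m) g x = 0" if "x \<in> Y" for x
      using D_iter[OF g c(2), of "Suc m"] higher_pderiv_eq_0[OF m, of "Suc m"] that
        poly_flowD(3)[OF M that] by (metis lessI poly_0)
    moreover have "(D ^^ Suc m) g \<in> extensional Y" by (simp add: D_def)
    ultimately have "(D ^^ Suc m) g = (\<lambda>x\<in>Y. 0)"
      by (intro extensionalityI[of _ Y]) auto
    then show ?thesis by blast
  qed
  ultimately show "locally_nilpotent_derivation Y D"
    unfolding locally_nilpotent_derivation_def by blast
  assume g: "g \<in> regular_functions Y" and x: "x \<in> Y"
  obtain c where c: "poly_family c" "\<And>t x. x \<in> Y \<Longrightarrow> g (M (t, x)) = poly (c x) t"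
    by (rule regular_along_flow[OF M g], rule that)
  have *: "(D ^^ k) g x = fact k * coeff (c x) k" for k
    using D_iter[OF g c(2), of k] x poly_flowD(3)[OF M x] poly_higher_pderiv_0[of k "c x"] by metis
  have "(\<lambda>k. t ^ k * coeff (c x) k) sums (\<Sum>k\<le>degree (c x). t ^ k * coeff (c x) k)"
    by (rule sums_finite) (auto simp: coeff_eq_0)
  then show "(\<lambda>k. t ^ k / fact k * (D ^^ k) g x) sums g (M (t, x))"
    unfolding c(2)[OF x] * by (simp add: poly_altdef mult.commute)
qed

text \<open>Injectivity in the time is the point. If two times r and s gave the same map, then x
  would be fixed at all multiples of r - s; a coordinate of \<open>M (t, x)\<close> that moves is a
  polynomial in t and cannot take one value infinitely often.\<close>

lemma one_parameter_subgroup_flow: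
  assumes M: "poly_flow Y M" and nontrivial: "x \<in> Y" "M (t, x) \<noteq> x"
  shows "one_parameter_subgroup Y (\<lambda>t. \<lambda>x\<in>Y. M (t, x))"
  unfolding one_parameter_subgroup_def
proof (intro conjI allI)
  show "(\<lambda>x\<in>Y. M (t, x)) \<in> carrier (Aut Y)" for t using flow_in_Aut[OF M] .
  show "(\<lambda>x\<in>Y. M (s + t, x)) = (\<lambda>x\<in>Y. M (s, x)) \<otimes>\<^bsub>Aut Y\<^esub> (\<lambda>x\<in>Y. M (t, x))" for s t
    unfolding mult_Aut[OF flow_in_Aut[OF M] flow_in_Aut[OF M]]
    by (rule restrict_ext) (simp add: poly_flowD[OF M])
  show "inj (\<lambda>t. \<lambda>x\<in>Y. M (t, x))"
  proof (rule injI, rule ccontr)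
    fix r s assume eq: "(\<lambda>x\<in>Y. M (r, x)) = (\<lambda>x\<in>Y. M (s, x))" and "r \<noteq> s"
    define h where "h = r - s"
    have h: "M (h, z) = z" if z: "z \<in> Y" for z
    proof -
      have "M (r, M (-s, z)) = M (s, M (-s, z))"
        using fun_cong[OF eq, of "M (-s, z)"] poly_flowD(2)[OF M z] by simp
      then show ?thesis using z by (simp add: poly_flowD[OF M] h_def)
    qed
    have nh: "M (real n * h, x) = x" for n
    proof (induction n)
      case (Suc n)
      have "M (real (Suc n) * h, x) = M (h, M (real n * h, x))"
        using nontrivial(1) by (simp add: poly_flowD(4)[OF M] algebra_simps)
      then show ?case using Suc h nontrivial(1) by simp
    qed (simp add: poly_flowD(3)[OF M] nontrivial(1))
    obtain b where b: "b \<in> Basis" "M (t, x) \<bullet> b \<noteq> x \<bullet> b"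
      using nontrivial(2) euclidean_eq_iff by blast
    have "real_polynomial_function (\<lambda>z. M z \<bullet> b)"
      using poly_flowD(1)[OF M] b(1) unfolding polynomial_function_iff_Basis_inner by simp
    then obtain c where c: "\<And>t x. M (t, x) \<bullet> b = poly (c x) t"
      using that by (auto elim: polynomial_function_poly_family)
    have "c x = [:x \<bullet> b:]"
    proof (rule poly_eqI_infinite)
      have "inj (\<lambda>n::nat. real n * h)" using \<open>r \<noteq> s\<close> by (auto simp: inj_def h_def)
      then show "infinite (range (\<lambda>n::nat. real n * h))" using finite_imageD by blast
      show "poly (c x) u = poly [:x \<bullet> b:] u" if "u \<in> range (\<lambda>n::nat. real n * h)" for u
        using that nh c[symmetric] by auto
    qed
    then show False using b(2) c by simp
  qed
  show "\<exists>D. locally_nilpotent_derivation Y D \<and>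
      (\<forall>t. \<forall>g\<in>regular_functions Y. \<forall>x\<in>Y.
         (\<lambda>k. t ^ k / fact k * (D ^^ k) g x) sums g ((\<lambda>x\<in>Y. M (t, x)) x))"
    using flow_derivation[OF M] by (intro exI[of _ "\<lambda>g. \<lambda>x\<in>Y. deriv (\<lambda>t. g (M (t, x))) 0"]) simp
qed

text \<open>On each coordinate function the exponential series stops by local nilpotency, and its
  terms are regular functions times powers of t. The finitely many coordinates then assemble to one
  map that is polynomial in (t, x).\<close>

lemma flow_of_one_parameter_subgroup:
  assumes "one_parameter_subgroup Y \<phi>"
  obtains M where "poly_flow Y M" "\<And>t x. x \<in> Y \<Longrightarrow> \<phi> t x = M (t, x)"
proof -
  obtain D where D: "locally_nilpotent_derivation Y D"
    "\<And>t g x. g \<in> regular_functions Y \<Longrightarrow> x \<in> Y \<Longrightarrow>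
           (\<lambda>k. t ^ k / fact k * (D ^^ k) g x) sums g (\<phi> t x)"
    and car: "\<And>t. \<phi> t \<in> carrier (Aut Y)" and add: "\<And>s t. \<phi> (s + t) = \<phi> s \<otimes>\<^bsub>Aut Y\<^esub> \<phi> t"
    using assms unfolding one_parameter_subgroup_def by blast
  have der: "derivation_on Y D" using D(1) unfolding locally_nilpotent_derivation_def by blast
  have reg: "(D ^^ k) g \<in> regular_functions Y" if "g \<in> regular_functions Y" for g k
    using der that by (induction k) (auto simp: derivation_on_def)
  have zero_reg: "(\<lambda>x\<in>Y. 0) \<in> regular_functions Y" unfolding regular_functions_def by blast
  have D0: "D (\<lambda>x\<in>Y. 0) = (\<lambda>x\<in>Y. 0)"
  proof -
    have "D (\<lambda>x\<in>Y. 0 * (\<lambda>x\<in>Y. 0) x) = (\<lambda>x\<in>Y. 0 * D (\<lambda>x\<in>Y. 0) x)"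
      using der zero_reg unfolding derivation_on_def by blast
    then show ?thesis by (simp cong: restrict_cong)
  qed
  have high: "(D ^^ (k + n)) g = (\<lambda>x\<in>Y. 0)" if "(D ^^ n) g = (\<lambda>x\<in>Y. 0)" for n k g
    using that D0 by (induction k) auto
  have coord: "\<exists>q. real_polynomial_function q \<and> (\<forall>t. \<forall>x\<in>Y. \<phi> t x \<bullet> b = q (t, x))" for b
  proof -
    define g where "g = restrict (\<lambda>x. x \<bullet> b) Y"
    have g: "g \<in> regular_functions Y"
      unfolding regular_functions_def g_def
      by (auto intro!: real_polynomial_function.intros(1) bounded_linear_inner_left)
    obtain n where n: "(D ^^ n) g = (\<lambda>x\<in>Y. 0)"
      using D(1) g unfolding locally_nilpotent_derivation_def by blast
    have "\<forall>k. \<exists>p. real_polynomial_function p \<and> (D ^^ k) g = restrict p Y"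
      using reg[OF g] unfolding regular_functions_def by blast
    then obtain p where p: "\<And>k. real_polynomial_function (p k)" "\<And>k. (D ^^ k) g = restrict (p k) Y"
      by metis
    define q where "q = (\<lambda>z :: real \<times> 'a. \<Sum>k<n. fst z ^ k / fact k * p k (snd z))"
    have t: "real_polynomial_function (\<lambda>z :: real \<times> 'a. fst z)"
      by (intro polynomial_function_imp_real polyfun)
    have "real_polynomial_function q"
      unfolding q_def
      by (intro real_polynomial_function_sum real_polynomial_function_mult real_polynomial_function_divide
          real_polynomial_function_power t real_polynomial_function_comp[OF p(1)] polyfun finite_lessThan)
    moreover have "\<phi> t x \<bullet> b = q (t, x)" if x: "x \<in> Y" for t x
    proof -
      have *: "(D ^^ k) g x = 0" if "k \<notin> {..<n}" for k
        using high[OF n, of "k - n"] that x by simp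
      have "(\<lambda>k. t ^ k / fact k * (D ^^ k) g x) sums (\<Sum>k<n. t ^ k / fact k * (D ^^ k) g x)"
        by (rule sums_finite) (simp_all add: *)
      then have "g (\<phi> t x) = (\<Sum>k<n. t ^ k / fact k * (D ^^ k) g x)"
        using D(2)[OF g x, of t] sums_unique2 by blast
      moreover have "\<phi> t x \<in> Y" using car[of t] x unfolding carrier_Aut Bij_def bij_betw_def by auto
      ultimately show ?thesis using x by (simp add: g_def q_def p(2)[unfolded g_def])
    qed
    ultimately show ?thesis by blast
  qed
  then obtain q where q: "\<And>b. real_polynomial_function (q b)" "\<And>b t x. x \<in> Y \<Longrightarrow> \<phi> t x \<bullet> b = q b (t, x)"
    by metis
  define M where "M = (\<lambda>z. \<Sum>b\<in>Basis. q b z *\<^sub>R b)"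
  have pM: "polynomial_function M"
    unfolding M_def by (intro polynomial_function_sum polynomial_function_mult polyfun
      real_polynomial_function_imp q finite_Basis)
  have eq: "\<phi> t x = M (t, x)" if "x \<in> Y" for t x
    unfolding M_def using euclidean_representation[of "\<phi> t x"] q(2)[OF that] by simp
  have in_Y: "\<phi> t x \<in> Y" if "x \<in> Y" for t x
    using car[of t] that unfolding carrier_Aut Bij_def bij_betw_def by auto
  have add': "\<phi> (s + t) x = \<phi> s (\<phi> t x)" if "x \<in> Y" for s t x
    using add mult_Aut[OF car car] that by simp
  \<comment> \<open>By additivity \<open>\<phi> 0\<close> is idempotent, and it is injective on Y,
    hence the identity there.\<close>
  have "\<phi> 0 x = x" if "x \<in> Y" for x
  proof -
    have "inj_on (\<phi> 0) Y" using car[of 0] unfolding carrier_Aut Bij_def bij_betw_def by auto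
    then show ?thesis using add'[OF that, of 0 0] in_Y that by (simp add: inj_on_eq_iff)
  qed
  then have "poly_flow Y M"
    unfolding poly_flow_def using pM eq in_Y add' by metis
  then show thesis using that eq by blast
qed

text \<open>The maps representing elements of \<open>SAut Y\<close>, with unspecified polynomial behaviour off \<open>Y\<close>.\<close>

inductive_set flow_group :: "'a::euclidean_space set \<Rightarrow> ('a \<Rightarrow> 'a) set" for Y where
  flow_group_id: "(\<lambda>x. x) \<in> flow_group Y"
| flow_group_flow: "poly_flow Y M \<Longrightarrow> g \<in> flow_group Y \<Longrightarrow> (\<lambda>x. M (t, g x)) \<in> flow_group Y"

lemma flow_group_single: "poly_flow Y M \<Longrightarrow> (\<lambda>x. M (t, x)) \<in> flow_group Y"
  using flow_group_flow[OF _ flow_group_id] by blast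

lemma flow_group_polynomial: "g \<in> flow_group Y \<Longrightarrow> polynomial_function g"
  by (induction rule: flow_group.induct)
    (auto intro!: polynomial_function_comp[OF poly_flowD(1)] polyfun)

lemma flow_group_mem: "g \<in> flow_group Y \<Longrightarrow> x \<in> Y \<Longrightarrow> g x \<in> Y"
  by (induction rule: flow_group.induct) (auto simp: poly_flowD)

lemma flow_group_comp:
  assumes "g \<in> flow_group Y" "h \<in> flow_group Y" shows "(\<lambda>x. g (h x)) \<in> flow_group Y"
  using assms(1) by (induction rule: flow_group.induct) (auto intro: flow_group_flow assms(2))

lemma flow_group_inv:
  assumes "g \<in> flow_group Y"
  obtains h where "h \<in> flow_group Y" "\<And>x. x \<in> Y \<Longrightarrow> h (g x) = x" "\<And>x. x \<in> Y \<Longrightarrow> g (h x) = x"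
proof -
  have "\<exists>h\<in>flow_group Y. \<forall>x\<in>Y. h (g x) = x \<and> g (h x) = x"
    using assms
  proof (induction rule: flow_group.induct)
    case flow_group_id
    show ?case using flow_group.flow_group_id[of Y] by (rule bexI[rotated]) simp
  next
    case (flow_group_flow M g t)
    then obtain h where h: "h \<in> flow_group Y" "\<forall>x\<in>Y. h (g x) = x \<and> g (h x) = x" by blast
    note M = poly_flowD[OF flow_group_flow(1)]
    show ?case
    proof (rule bexI[of _ "\<lambda>x. h (M (-t, x))"])
      show "(\<lambda>x. h (M (- t, x))) \<in> flow_group Y"
        using flow_group_comp[OF h(1) flow_group_single[OF flow_group_flow(1)]] .
      show "\<forall>x\<in>Y. h (M (- t, M (t, g x))) = x \<and> M (t, g (h (M (- t, x)))) = x"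
        using h(2) M flow_group_mem[OF flow_group_flow(2)] by simp
    qed
  qed
  then show thesis using that by blast
qed

lemma restrict_flow_group_in_Aut:
  assumes "g \<in> flow_group Y" shows "restrict g Y \<in> carrier (Aut Y)"
proof -
  obtain h where h: "h \<in> flow_group Y" "\<And>x. x \<in> Y \<Longrightarrow> h (g x) = x" "\<And>x. x \<in> Y \<Longrightarrow> g (h x) = x"
    by (rule flow_group_inv[OF assms], rule that)
  show ?thesis
    using flow_group_polynomial[OF assms] flow_group_polynomial[OF h(1)] h flow_group_mem assms
    by (intro carrier_AutI[of g h]) auto
qed

lemma restrict_flow_group_in_SAut:
  assumes "g \<in> flow_group Y" shows "restrict g Y \<in> SAut Y"
  using assms
proof (induction rule: flow_group.induct)
  case flow_group_id
  show ?case unfolding SAut_def one_Aut[symmetric] by (simp add: generate.one)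
next
  case (flow_group_flow M g t)
  show ?case
  \<comment> \<open>A flow that is constant on Y is not a one-parameter subgroup, as it is not
    injective in t. The map at time t is harmless when it is the identity; otherwise the flow is
    nontrivial.\<close>
  proof (cases "\<forall>x\<in>Y. M (t, x) = x")
    case True
    then have "restrict (\<lambda>x. M (t, g x)) Y = restrict g Y"
      using flow_group_mem[OF flow_group_flow(2)] by (intro restrict_ext) auto
    then show ?thesis using flow_group_flow.IH by simp
  next
    case False
    then have "one_parameter_subgroup Y (\<lambda>t. \<lambda>x\<in>Y. M (t, x))"
      using one_parameter_subgroup_flow[OF flow_group_flow(1)] by blast
    then have "(\<lambda>x\<in>Y. M (t, x)) \<in> SAut Y"
      unfolding SAut_def by (intro generate.incl) blast
    then have "(\<lambda>x\<in>Y. M (t, x)) \<otimes>\<^bsub>Aut Y\<^esub> restrict g Y \<in> SAut Y"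
      using flow_group_flow.IH generate.eng[of _ "Aut Y"] unfolding SAut_def by blast
    moreover have "(\<lambda>x\<in>Y. M (t, x)) \<otimes>\<^bsub>Aut Y\<^esub> restrict g Y = restrict (\<lambda>x. M (t, g x)) Y"
      using flow_group_mem[OF flow_group_flow(2)]
      unfolding mult_Aut[OF flow_in_Aut[OF flow_group_flow(1)] restrict_flow_group_in_Aut[OF flow_group_flow(2)]]
      by (intro restrict_ext) simp
    ultimately show ?thesis by metis
  qed
qed

lemma SAut_restrict_flow_group:
  assumes "\<gamma> \<in> SAut Y"
  obtains g where "g \<in> flow_group Y" "\<gamma> = restrict g Y"
proof -
  have "\<exists>g\<in>flow_group Y. \<gamma> = restrict g Y"
    using assms unfolding SAut_def
  proof (induction rule: generate.induct)
    case one
    show ?case unfolding one_Aut using flow_group_id[of Y] by (rule bexI[rotated]) simp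
  next
    case (incl \<gamma>)
    then obtain \<phi> t where \<phi>: "one_parameter_subgroup Y \<phi>" "\<gamma> = \<phi> t" by blast
    then obtain M where M: "poly_flow Y M" "\<And>t x. x \<in> Y \<Longrightarrow> \<phi> t x = M (t, x)"
      using flow_of_one_parameter_subgroup by blast
    have "\<phi> t \<in> extensional Y" using \<phi>(1) unfolding one_parameter_subgroup_def carrier_Aut Bij_def by blast
    then have "\<phi> t = restrict (\<lambda>x. M (t, x)) Y"
      using M(2) by (intro extensionalityI[of _ Y]) auto
    then show ?case using flow_group_single[OF M(1)] \<phi>(2) by blast
  next
    case (inv \<gamma>)
    then obtain \<phi> t where \<phi>: "one_parameter_subgroup Y \<phi>" "\<gamma> = \<phi> t" by blast
    then obtain M where M: "poly_flow Y M" "\<And>t x. x \<in> Y \<Longrightarrow> \<phi> t x = M (t, x)"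
      using flow_of_one_parameter_subgroup by blast
    have car: "\<phi> t \<in> carrier (Aut Y)" using \<phi>(1) unfolding one_parameter_subgroup_def by blast
    have "inv\<^bsub>Aut Y\<^esub> \<gamma> = (\<lambda>x\<in>Y. M (-t, x))"
      unfolding \<phi>(2) by (rule inv_Aut[OF car flow_in_Aut[OF M(1)]]) (simp add: M(2) poly_flowD[OF M(1)])
    then show ?case using flow_group_single[OF M(1)] by blast
  next
    case (eng \<gamma>1 \<gamma>2)
    then obtain g h where gh: "g \<in> flow_group Y" "\<gamma>1 = restrict g Y" "h \<in> flow_group Y" "\<gamma>2 = restrict h Y"
      by blast
    have "\<gamma>1 \<otimes>\<^bsub>Aut Y\<^esub> \<gamma>2 = restrict (\<lambda>x. g (h x)) Y"
      unfolding gh mult_Aut[OF restrict_flow_group_in_Aut[OF gh(1)] restrict_flow_group_in_Aut[OF gh(3)]]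
      using flow_group_mem[OF gh(3)] by (intro restrict_ext) simp
    then show ?case using flow_group_comp[OF gh(1,3)] by blast
  qed
  then show thesis using that by blast
qed

section \<open>Velocities of flows and tangent spaces\<close>

definition velocities :: "'a::euclidean_space set \<Rightarrow> 'a \<Rightarrow> 'a set" where
  "velocities Y y = {vector_derivative (\<lambda>t. M (t, y)) (at 0) | M. poly_flow Y M}"

text \<open>Besides one-parameter subgroups, \<open>velocities\<close> allows constant flows. They
  contribute only the zero vector, which leaves the span unchanged.\<close>

lemma flexible_point_iff_velocities:
  assumes "y \<in> Y"
  shows "flexible_point Y y \<longleftrightarrow> span (velocities Y y) = tangent_space Y y"
proof -
  let ?V = "{vector_derivative (\<lambda>t. \<phi> t y) (at 0) | \<phi>. one_parameter_subgroup Y \<phi>}"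
  have V: "?V \<subseteq> velocities Y y"
  proof
    fix w assume "w \<in> ?V"
    then obtain \<phi> where \<phi>: "one_parameter_subgroup Y \<phi>" "w = vector_derivative (\<lambda>t. \<phi> t y) (at 0)" by blast
    obtain M where "poly_flow Y M" "\<And>t x. x \<in> Y \<Longrightarrow> \<phi> t x = M (t, x)"
      by (rule flow_of_one_parameter_subgroup[OF \<phi>(1)], rule that)
    then show "w \<in> velocities Y y" unfolding velocities_def \<phi>(2) using assms by auto
  qed
  have "velocities Y y \<subseteq> insert 0 ?V"
  proof
    fix w assume "w \<in> velocities Y y"
    then obtain M where M: "poly_flow Y M" "w = vector_derivative (\<lambda>t. M (t, y)) (at 0)"
      unfolding velocities_def by blast
    show "w \<in> insert 0 ?V"
    proof (cases "\<forall>t. M (t, y) = y")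
      case True
      then show ?thesis using M(2) by simp
    next
      case False
      define \<phi> where "\<phi> = (\<lambda>t. \<lambda>x\<in>Y. M (t, x))"
      have "one_parameter_subgroup Y \<phi>"
        unfolding \<phi>_def using False one_parameter_subgroup_flow[OF M(1) assms] by blast
      moreover have "w = vector_derivative (\<lambda>t. \<phi> t y) (at 0)"
        unfolding \<phi>_def M(2) using assms by simp
      ultimately show ?thesis by blast
    qed
  qed
  then have "span (velocities Y y) \<subseteq> span ?V"
    using span_mono[of "velocities Y y" "insert 0 ?V"] unfolding span_insert_0 by blast
  then have "span ?V = span (velocities Y y)"
    using span_mono[OF V] by (intro subset_antisym)
  then show ?thesis unfolding flexible_point_def by simp
qed

lemma poly_curve_has_vector_derivative:
  fixes \<gamma> :: "real \<Rightarrow> 'a::euclidean_space"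
  assumes "polynomial_function \<gamma>"
  shows "(\<gamma> has_vector_derivative vector_derivative \<gamma> (at t)) (at t)"
  using has_vector_derivative_polynomial_function[OF assms] vector_derivative_at by metis

lemma has_vector_derivative_polynomial_comp:
  fixes \<gamma> :: "real \<Rightarrow> 'a::euclidean_space" and P :: "'a \<Rightarrow> 'b::euclidean_space"
  assumes "(\<gamma> has_vector_derivative w) (at t)" "polynomial_function P"
  shows "((\<lambda>t. P (\<gamma> t)) has_vector_derivative frechet_derivative P (at (\<gamma> t)) w) (at t)"
  using vector_derivative_diff_chain_within[of \<gamma> w t UNIV P "frechet_derivative P (at (\<gamma> t))"]
    has_derivative_polynomial_function[OF assms(2)] assms(1)
  by (simp add: o_def has_derivative_at_withinI)

lemma flow_curve: "poly_flow Y M \<Longrightarrow> polynomial_function (\<lambda>t. M (t, y))"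
  by (rule polynomial_function_comp[OF poly_flowD(1)]) (auto intro!: polyfun)

lemma vanishing_idealD:
  assumes "q \<in> vanishing_ideal Y"
  shows "real_polynomial_function q" and "x \<in> Y \<Longrightarrow> q x = 0"
  using assms unfolding vanishing_ideal_def by auto

lemma tangent_spaceD: "w \<in> tangent_space Y y \<Longrightarrow> q \<in> vanishing_ideal Y \<Longrightarrow> frechet_derivative q (at y) w = 0"
  unfolding tangent_space_def by blast

lemma subspace_tangent_space: "subspace (tangent_space Y y)"
proof -
  have "linear (frechet_derivative q (at y))" if "q \<in> vanishing_ideal Y" for q
    using linear_frechet_derivative_polynomial[OF vanishing_idealD(1)[OF that]] .
  then show ?thesis
    unfolding tangent_space_def by (intro subspaceI) (simp_all add: linear_0 linear_add linear_scale)
qed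

text \<open>A polynomial vanishing on Y is zero along the curve near t, so the chain rule kills its
  differential on the velocity. The curve need not be polynomial: the hyperbolas in the fibres of
  the suspension are used as well.\<close>

lemma tangent_curve:
  fixes \<gamma> :: "real \<Rightarrow> 'a::euclidean_space"
  assumes "(\<gamma> has_vector_derivative w) (at t)" "\<forall>\<^sub>F s in nhds t. \<gamma> s \<in> Y"
  shows "w \<in> tangent_space Y (\<gamma> t)"
  unfolding tangent_space_def
proof (intro CollectI ballI)
  fix q assume q: "q \<in> vanishing_ideal Y"
  have "((\<lambda>s. q (\<gamma> s)) has_vector_derivative frechet_derivative q (at (\<gamma> t)) w) (at t)"
    using has_vector_derivative_polynomial_comp[OF assms(1)] vanishing_idealD(1)[OF q]
    by (simp add: real_polynomial_function_eq)
  moreover have "((\<lambda>s. q (\<gamma> s)) has_vector_derivative 0) (at t)"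
  proof -
    have *: "((\<lambda>s. 0 :: real) has_vector_derivative 0) (at t)" by simp
    have "\<forall>\<^sub>F s in nhds t. q (\<gamma> s) = 0"
      using assms(2) by eventually_elim (rule vanishing_idealD(2)[OF q])
    then have "((\<lambda>s. q (\<gamma> s)) has_vector_derivative 0) (at t) =
        ((\<lambda>s. 0 :: real) has_vector_derivative 0) (at t)"
      by (intro has_vector_derivative_cong_ev) (auto elim: eventually_mono dest: eventually_nhds_x_imp_x)
    then show ?thesis using * by simp
  qed
  ultimately show "frechet_derivative q (at (\<gamma> t)) w = 0"
    using vector_derivative_unique_at by blast
qed

lemma velocities_subset_tangent_space:
  assumes "y \<in> Y" shows "velocities Y y \<subseteq> tangent_space Y y"
proof
  fix w assume "w \<in> velocities Y y"
  then obtain M where M: "poly_flow Y M" "w = vector_derivative (\<lambda>t. M (t, y)) (at 0)"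
    unfolding velocities_def by blast
  have "((\<lambda>t. M (t, y)) has_vector_derivative w) (at 0)"
    unfolding M(2) by (rule poly_curve_has_vector_derivative[OF flow_curve[OF M(1)]])
  then show "w \<in> tangent_space Y y"
    using tangent_curve[of "\<lambda>t. M (t, y)" w 0 Y] poly_flowD(2,3)[OF M(1) assms] by simp
qed

lemma frechet_derivative_polynomial_comp:
  fixes P :: "'a::euclidean_space \<Rightarrow> 'b::euclidean_space" and Q :: "'b \<Rightarrow> 'c::euclidean_space"
  assumes "polynomial_function P" "polynomial_function Q"
  shows "frechet_derivative (\<lambda>x. Q (P x)) (at x) w =
    frechet_derivative Q (at (P x)) (frechet_derivative P (at x) w)"
proof -
  have "((\<lambda>x. Q (P x)) has_derivative
      (\<lambda>w. frechet_derivative Q (at (P x)) (frechet_derivative P (at x) w))) (at x)"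
    by (rule has_derivative_compose[OF has_derivative_polynomial_function[OF assms(1)]
        has_derivative_polynomial_function[OF assms(2)]])
  then show ?thesis using frechet_derivative_at by metis
qed

lemma linear_frechet_derivative_polynomial_function:
  fixes P :: "'a::euclidean_space \<Rightarrow> 'b::euclidean_space"
  shows "polynomial_function P \<Longrightarrow> linear (frechet_derivative P (at x))"
  using has_derivative_polynomial_function bounded_linear.linear has_derivative_bounded_linear
  by blast

text \<open>Pulling back along \<open>P\<close> sends the vanishing ideal of Z into that of X; the
  chain rule does the rest.\<close>

lemma frechet_derivative_maps_tangent_space:
  assumes "polynomial_function P" "\<And>x. x \<in> X \<Longrightarrow> P x \<in> Z" "w \<in> tangent_space X x"
  shows "frechet_derivative P (at x) w \<in> tangent_space Z (P x)"
  unfolding tangent_space_def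
proof (intro CollectI ballI)
  fix q assume q: "q \<in> vanishing_ideal Z"
  have "(\<lambda>x. q (P x)) \<in> vanishing_ideal X"
    using vanishing_idealD[OF q] assms(1,2) real_polynomial_function_comp
    unfolding vanishing_ideal_def by auto
  then show "frechet_derivative q (at (P x)) (frechet_derivative P (at x) w) = 0"
    using tangent_spaceD[OF assms(3)] vanishing_idealD(1)[OF q]
    by (metis assms(1) frechet_derivative_polynomial_comp real_polynomial_function_eq)
qed

lemma poly_flow_conjugate:
  assumes "polynomial_function g" "polynomial_function h"
    and "\<And>x. x \<in> X \<Longrightarrow> g x \<in> X" "\<And>x. x \<in> X \<Longrightarrow> h x \<in> X"
    and "\<And>x. x \<in> X \<Longrightarrow> h (g x) = x" "\<And>x. x \<in> X \<Longrightarrow> g (h x) = x"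
    and "poly_flow X M"
  shows "poly_flow X (\<lambda>z. h (M (fst z, g (snd z))))"
proof -
  note M = poly_flowD[OF assms(7)]
  have "polynomial_function (\<lambda>z. h (M (fst z, g (snd z))))"
    by (intro polynomial_function_comp[OF assms(2)] polynomial_function_comp[OF M(1)]
        polynomial_function_Pair polynomial_function_comp[OF assms(1)] polyfun)
  then show ?thesis using assms M unfolding poly_flow_def by auto
qed

text \<open>Conjugation carries flows to flows and velocities to velocities. As \<open>h\<close>
  inverts \<open>g\<close> on X only, the differentials are inverse to each other only on tangent
  vectors: the coordinates of \<open>h (g z)\<close> - z lie in the vanishing ideal, so their
  differentials vanish on w.\<close>

lemma flexible_point_transfer:
  assumes g: "polynomial_function g" and h: "polynomial_function h"
    and gX: "\<And>x. x \<in> X \<Longrightarrow> g x \<in> X" and hX: "\<And>x. x \<in> X \<Longrightarrow> h x \<in> X"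
    and hg: "\<And>x. x \<in> X \<Longrightarrow> h (g x) = x" and gh: "\<And>x. x \<in> X \<Longrightarrow> g (h x) = x"
    and x: "x \<in> X" and flex: "tangent_space X (g x) \<subseteq> span (velocities X (g x))"
  shows "tangent_space X x \<subseteq> span (velocities X x)"
proof
  fix w assume w: "w \<in> tangent_space X x"
  let ?A = "frechet_derivative g (at x)" and ?B = "frechet_derivative h (at (g x))"
  have "?A w \<in> span (velocities X (g x))"
    using frechet_derivative_maps_tangent_space[OF g gX w] flex by blast
  moreover have "?B (?A w) = w"
  proof (rule euclidean_eqI)
    fix b :: 'a assume "b \<in> Basis"
    have lin: "bounded_linear (\<lambda>z. z \<bullet> b)" by (rule bounded_linear_inner_left)
    define q where "q = (\<lambda>z. h (g z) \<bullet> b - z \<bullet> b)"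
    have pb: "polynomial_function (\<lambda>z :: 'a. z \<bullet> b)"
      using lin by (rule polynomial_function_bounded_linear)
    have "real_polynomial_function q"
      unfolding q_def
      by (intro polynomial_function_imp_real polynomial_function_diff pb
          polynomial_function_comp[OF pb] polynomial_function_comp[OF h] g)
    then have "q \<in> vanishing_ideal X" unfolding vanishing_ideal_def q_def using hg by simp
    then have "frechet_derivative q (at x) w = 0" using w by (rule tangent_spaceD[rotated])
    moreover have "(q has_derivative (\<lambda>w. ?B (?A w) \<bullet> b - w \<bullet> b)) (at x)"
      unfolding q_def
      by (intro has_derivative_diff bounded_linear.has_derivative[OF lin]
          has_derivative_compose[OF has_derivative_polynomial_function[OF g]
          has_derivative_polynomial_function[OF h]] has_derivative_ident)
    then have "frechet_derivative q (at x) = (\<lambda>w. ?B (?A w) \<bullet> b - w \<bullet> b)"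
      by (rule frechet_derivative_at[symmetric])
    ultimately show "?B (?A w) \<bullet> b = w \<bullet> b" by simp
  qed
  moreover have "?B ` velocities X (g x) \<subseteq> velocities X x"
  proof (rule image_subsetI)
    fix k assume "k \<in> velocities X (g x)"
    then obtain M where M: "poly_flow X M" "k = vector_derivative (\<lambda>t. M (t, g x)) (at 0)"
      unfolding velocities_def by blast
    have "((\<lambda>t. M (t, g x)) has_vector_derivative k) (at 0)"
      unfolding M(2) by (rule poly_curve_has_vector_derivative[OF flow_curve[OF M(1)]])
    then have "((\<lambda>t. h (M (t, g x))) has_vector_derivative ?B k) (at 0)"
      using has_vector_derivative_polynomial_comp[OF _ h] poly_flowD(3)[OF M(1) gX[OF x]] by fastforce
    then have "?B k = vector_derivative (\<lambda>t. h (M (t, g x))) (at 0)"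
      by (simp add: vector_derivative_at)
    then show "?B k \<in> velocities X x"
      unfolding velocities_def
      by (intro CollectI exI[of _ "\<lambda>z. h (M (fst z, g (snd z)))"] conjI
          poly_flow_conjugate[OF g h gX hX hg gh M(1)]) simp_all
  qed
  moreover have "?B ` span (velocities X (g x)) = span (?B ` velocities X (g x))"
    by (rule linear_span_image[OF linear_frechet_derivative_polynomial_function[OF h], symmetric])
  ultimately show "w \<in> span (velocities X x)"
    using span_mono by (metis imageI in_mono)
qed

section \<open>Flows on the suspension\<close>

lemma mem_suspension: "(y, u, v) \<in> suspension Y p \<longleftrightarrow> y \<in> Y \<and> u * v = p y"
  unfolding suspension_def by auto

text \<open>\<open>poly_shift 1\<close> drops the constant coefficient and divides by the variable.
  Applied to \<open>p (M (s, y))\<close> as a polynomial in s, it yields the difference quotient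
  with respect to s.\<close>

lemma poly_family_poly_shift:
  assumes "poly_family c" shows "poly_family (\<lambda>x. poly_shift 1 (c x))"
proof -
  obtain m where m: "\<And>x. degree (c x) \<le> m" using assms unfolding poly_family_def by blast
  have "degree (poly_shift 1 (c x)) \<le> m" for x
    by (rule degree_le) (use m[of x] in \<open>auto simp: coeff_poly_shift coeff_eq_0\<close>)
  then show ?thesis using assms unfolding poly_family_def by (auto simp: coeff_poly_shift)
qed

lemma poly_eq_poly_shift: "poly q s = coeff q 0 + s * poly (poly_shift 1 q) s"
proof -
  have "q = pCons (coeff q 0) (poly_shift 1 q)"
    by (rule poly_eqI) (auto simp: coeff_pCons coeff_poly_shift split: nat.split)
  then show ?thesis by (metis poly_pCons)
qed

text \<open>
  Since \<open>p (M (s, y)) - p y\<close> is divisible by \<open>s\<close>, replacing the time \<open>t\<close> by \<open>t u r(u)\<close> makes the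
  division by \<open>u\<close> in \<open>v = p (M (t u r(u), y)) / u\<close> polynomial.
\<close>

lemma suspension_flow:
  fixes M :: "real \<times> 'a::euclidean_space \<Rightarrow> 'a" and r :: "real poly"
  assumes M: "poly_flow Y M" and p: "real_polynomial_function p"
  obtains N e where "poly_flow (suspension Y p) N"
    and "\<And>t y u v. N (t, y, u, v) =
      (M (t * u * poly r u, y), u, v + t * poly r u * e (t * u * poly r u) y)"
    and "\<And>y. y \<in> Y \<Longrightarrow> ((\<lambda>s. p (M (s, y))) has_real_derivative e 0 y) (at 0)"
    and "\<And>y. polynomial_function (\<lambda>t. e t y)"
proof -
  have "real_polynomial_function (\<lambda>z. p (M z))"
    using real_polynomial_function_comp[OF p poly_flowD(1)[OF M]] .
  then obtain c where c: "poly_family c" "\<And>t x. p (M (t, x)) = poly (c x) t"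
    using that by (auto elim: polynomial_function_poly_family)
  define e where "e = (\<lambda>t y. poly (poly_shift 1 (c y)) t)"
  have e: "p (M (t, y)) = p y + t * e t y" if "y \<in> Y" for t y
    using poly_eq_poly_shift[of "c y" t] poly_eq_poly_shift[of "c y" 0] c(2)[of t y] c(2)[of 0 y]
      poly_flowD(3)[OF M that] by (simp add: e_def)
  have e_poly: "polynomial_function (\<lambda>(t, y). e t y)"
    unfolding e_def by (rule poly_family_polynomial_function[OF poly_family_poly_shift[OF c(1)]])
  define N where "N = (\<lambda>(t, y, u, v). (M (t * u * poly r u, y), u :: real,
      v + t * poly r u * e (t * u * poly r u) y))"
  have N: "N (t, y, u, v) = (M (t * u * poly r u, y), u, v + t * poly r u * e (t * u * poly r u) y)"
    for t y u v by (simp add: N_def)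
  have "polynomial_function (\<lambda>z :: real \<times> 'a \<times> real \<times> real.
      (M (fst z * fst (snd (snd z)) * poly r (fst (snd (snd z))), fst (snd z)), fst (snd (snd z)),
       snd (snd (snd z)) + fst z * poly r (fst (snd (snd z))) *
         (\<lambda>(t, y). e t y) (fst z * fst (snd (snd z)) * poly r (fst (snd (snd z))), fst (snd z))))"
    by (intro polyfun polynomial_function_comp[OF poly_flowD(1)[OF M]] polynomial_function_comp[OF e_poly])
  then have N_poly: "polynomial_function N"
    by (simp add: N_def case_prod_beta')
  note M' = poly_flowD[OF M]
  have "poly_flow (suspension Y p) N"
    unfolding poly_flow_def
  proof (intro conjI allI ballI N_poly)
    fix t x assume "x \<in> suspension Y p"
    then obtain y u v where x: "x = (y, u, v)" "y \<in> Y" "u * v = p y"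
      by (cases x) (auto simp: mem_suspension)
    show "N (t, x) \<in> suspension Y p"
      unfolding x N mem_suspension using x M' e by (simp add: algebra_simps)
  next
    fix x assume "x \<in> suspension Y p"
    then obtain y u v where x: "x = (y, u, v)" "y \<in> Y" "u * v = p y"
      by (cases x) (auto simp: mem_suspension)
    show "N (0, x) = x" unfolding x N using x M' by simp
  next
    fix s t x assume "x \<in> suspension Y p"
    then obtain y u v where x: "x = (y, u, v)" "y \<in> Y" "u * v = p y"
      by (cases x) (auto simp: mem_suspension)
    define k where "k = u * poly r u"
    \<comment> \<open>The cocycle identity for the v coordinate. For nonzero u it may be multiplied
      by u, and both sides then express the change of \<open>p\<close> along the flow. For u = 0 the
      rescaled time k is 0, and both sides are the same multiple of \<open>e 0 y\<close>.\<close>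
    have "(s + t) * poly r u * e ((s + t) * k) y =
        t * poly r u * e (t * k) y + s * poly r u * e (s * k) (M (t * k, y))"
    proof (cases "u = 0")
      case True
      then show ?thesis using M' x(2) by (simp add: k_def algebra_simps)
    next
      case False
      have "M (s * k, M (t * k, y)) = M ((s + t) * k, y)"
        using M'(4)[OF x(2)] by (simp add: algebra_simps)
      then have "p y + (s + t) * k * e ((s + t) * k) y =
          p y + t * k * e (t * k) y + s * k * e (s * k) (M (t * k, y))"
        using e[OF x(2), of "(s + t) * k"] e[OF M'(2)[OF x(2)], of "s * k" "t * k"] e[OF x(2), of "t * k"]
        by simp
      then have "u * ((s + t) * poly r u * e ((s + t) * k) y) =
        u * (t * poly r u * e (t * k) y + s * poly r u * e (s * k) (M (t * k, y)))"
        by (simp add: k_def algebra_simps)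
      then show ?thesis using False by simp
    qed
    moreover have "M ((s + t) * k, y) = M (s * k, M (t * k, y))"
      using M'(4)[OF x(2)] by (simp add: algebra_simps)
    ultimately show "N (s + t, x) = N (s, N (t, x))"
      unfolding x N by (simp add: k_def mult.assoc)
  qed
  moreover have "((\<lambda>s. p (M (s, y))) has_real_derivative e 0 y) (at 0)" for y
  proof -
    have "poly (pderiv (c y)) 0 = e 0 y"
      by (simp add: e_def poly_0_coeff_0 coeff_pderiv coeff_poly_shift)
    then show ?thesis unfolding c(2) using poly_DERIV[of "c y" 0] by simp
  qed
  moreover have "polynomial_function (\<lambda>t. e t y)" for y
    unfolding e_def by (intro polyfun)
  ultimately show thesis using that N by blast
qed

section \<open>The symmetry exchanging u and v\<close>

definition swap_uv :: "'a \<times> 'b \<times> 'b \<Rightarrow> 'a \<times> 'b \<times> 'b" where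
  "swap_uv = (\<lambda>(y, u, v). (y, v, u))"

lemma swap_uv_simps [simp]: "swap_uv (y, u, v) = (y, v, u)" "swap_uv (swap_uv x) = x"
  by (auto simp: swap_uv_def case_prod_beta')

lemma swap_uv_mem [simp]: "swap_uv x \<in> suspension Y p \<longleftrightarrow> x \<in> suspension Y p"
  by (cases x) (auto simp: mem_suspension mult.commute)

lemma polynomial_function_swap_uv:
  "polynomial_function (swap_uv :: 'a::euclidean_space \<times> real \<times> real \<Rightarrow> _)"
proof -
  have "polynomial_function (\<lambda>x :: 'a \<times> real \<times> real. (fst x, snd (snd x), fst (snd x)))"
    by (intro polyfun)
  then show ?thesis by (simp add: swap_uv_def case_prod_beta')
qed

lemma poly_flow_swap:
  assumes "poly_flow (suspension Y p) N"
  shows "poly_flow (suspension Y p) (\<lambda>z. swap_uv (N (fst z, swap_uv (snd z))))"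
  by (rule poly_flow_conjugate[OF polynomial_function_swap_uv polynomial_function_swap_uv _ _ _ _ assms])
    simp_all

lemma flow_group_swap:
  assumes "g \<in> flow_group (suspension Y p)"
  shows "(\<lambda>x. swap_uv (g (swap_uv x))) \<in> flow_group (suspension Y p)"
  using assms
proof (induction rule: flow_group.induct)
  case flow_group_id
  then show ?case using flow_group.flow_group_id by simp
next
  case (flow_group_flow N g t)
  show ?case
    using flow_group.flow_group_flow[OF poly_flow_swap[OF flow_group_flow(1)] flow_group_flow.IH, of t] by simp
qed

lemma interpolating_poly:
  fixes A :: "real set"
  assumes "finite A" "u \<notin> A"
  obtains r :: "real poly" where "poly r u = c" "\<And>a. a \<in> A \<Longrightarrow> poly r a = 0"
proof
  define q where "q = (\<Prod>a\<in>A. [:-a, 1:])"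
  have "poly q u \<noteq> 0" unfolding q_def poly_prod using assms by simp
  then show "poly (smult (c / poly q u) q) u = c" by simp
  show "poly (smult (c / poly q u) q) a = 0" if "a \<in> A" for a
    unfolding q_def using assms that by (auto simp: poly_prod prod_zero_iff)
qed

text \<open>Since u0 r(u0) = 1, lifted flows run at the original speed on the level u0; where r
  vanishes they stand still. The root at 0 is needed to hold v fixed on the level u = 0. All lifted
  flows preserve u, so one r serves every letter of the word \<gamma>.\<close>

lemma level_move:
  fixes Y :: "'a::euclidean_space set"
  assumes "\<gamma> \<in> flow_group Y" and p: "real_polynomial_function p" and "u0 \<noteq> 0" "finite A" "u0 \<notin> A"
  obtains g where "g \<in> flow_group (suspension Y p)"
    and "\<And>x. x \<in> suspension Y p \<Longrightarrow> fst (snd (g x)) = fst (snd x)"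
    and "\<And>x. x \<in> suspension Y p \<Longrightarrow> fst (snd x) = u0 \<Longrightarrow> fst (g x) = \<gamma> (fst x)"
    and "\<And>x. x \<in> suspension Y p \<Longrightarrow> fst (snd x) \<in> insert 0 A \<Longrightarrow> g x = x"
proof -
  obtain r :: "real poly" where r: "poly r u0 = 1 / u0" "\<And>a. a \<in> insert 0 A \<Longrightarrow> poly r a = 0"
    using interpolating_poly[of "insert 0 A" u0 "1 / u0"] assms by auto
  have "\<exists>g\<in>flow_group (suspension Y p). \<forall>x\<in>suspension Y p. fst (snd (g x)) = fst (snd x) \<and>
      (fst (snd x) = u0 \<longrightarrow> fst (g x) = \<gamma> (fst x)) \<and> (fst (snd x) \<in> insert 0 A \<longrightarrow> g x = x)"
    using assms(1)
  proof (induction rule: flow_group.induct)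
    case flow_group_id
    show ?case using flow_group.flow_group_id by (rule bexI[rotated]) simp
  next
    case (flow_group_flow M \<gamma> t)
    then obtain g where g: "g \<in> flow_group (suspension Y p)"
      "\<And>x. x \<in> suspension Y p \<Longrightarrow> fst (snd (g x)) = fst (snd x)"
      "\<And>x. x \<in> suspension Y p \<Longrightarrow> fst (snd x) = u0 \<Longrightarrow> fst (g x) = \<gamma> (fst x)"
      "\<And>x. x \<in> suspension Y p \<Longrightarrow> fst (snd x) \<in> insert 0 A \<Longrightarrow> g x = x" by blast
    obtain N e where N: "poly_flow (suspension Y p) N" "\<And>t y u v. N (t, y, u, v) =
        (M (t * u * poly r u, y), u, v + t * poly r u * e (t * u * poly r u) y)"
      by (rule suspension_flow[OF flow_group_flow(1) p, of r], rule that)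
    have N': "N (t, x) = (M (t * fst (snd x) * poly r (fst (snd x)), fst x), fst (snd x), snd (snd x) +
        t * poly r (fst (snd x)) * e (t * fst (snd x) * poly r (fst (snd x))) (fst x))" for x
      using N(2) by (cases x) auto
    have "fst x \<in> Y" if "x \<in> suspension Y p" for x using that by (cases x) (auto simp: mem_suspension)
    then show ?case
      using flow_group.flow_group_flow[OF N(1) g(1), of t] r \<open>u0 \<noteq> 0\<close> g poly_flowD(3)[OF flow_group_flow(1)]
      by (intro bexI[of _ "\<lambda>x. N (t, g x)"]) (auto simp: N' prod_eq_iff)
  qed
  then show thesis using that by blast
qed

section \<open>Tangent vectors of the suspension\<close>

lemma has_vector_derivative_fst:
  "(\<gamma> has_vector_derivative w) F \<Longrightarrow> ((\<lambda>t. fst (\<gamma> t)) has_vector_derivative fst w) F"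
  using bounded_linear.has_vector_derivative[OF bounded_linear_fst] .

lemma has_vector_derivative_snd:
  "(\<gamma> has_vector_derivative w) F \<Longrightarrow> ((\<lambda>t. snd (\<gamma> t)) has_vector_derivative snd w) F"
  using bounded_linear.has_vector_derivative[OF bounded_linear_snd] .


text \<open>With the constant polynomial 1/u as time factor, the lifted flow runs at unit speed on
  the level u and preserves u, whence the entry 0. The entry \<open>b\<close> is left open, since it
  is determined later by the linearised equation.\<close>

lemma velocities_suspension_lift:
  assumes p: "real_polynomial_function p" and w: "w \<in> velocities Y y" and "u \<noteq> 0"
  obtains b where "(w, 0, b) \<in> velocities (suspension Y p) (y, u, v)"
proof -
  obtain M where M: "poly_flow Y M" "w = vector_derivative (\<lambda>t. M (t, y)) (at 0)"
    using w unfolding velocities_def by blast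
  obtain N e where N: "poly_flow (suspension Y p) N" "\<And>t y' u' v. N (t, y', u', v) =
      (M (t * u' * poly [:1/u:] u', y'), u', v + t * poly [:1/u:] u' * e (t * u' * poly [:1/u:] u') y')"
    by (rule suspension_flow[OF M(1) p, of "[:1/u:]"], rule that)
  let ?W = "vector_derivative (\<lambda>t. N (t, y, u, v)) (at 0)"
  have W: "((\<lambda>t. N (t, y, u, v)) has_vector_derivative ?W) (at 0)"
    by (rule poly_curve_has_vector_derivative[OF flow_curve[OF N(1)]])
  have "((\<lambda>t. M (t, y)) has_vector_derivative fst ?W) (at 0)"
    using has_vector_derivative_fst[OF W] \<open>u \<noteq> 0\<close> by (simp add: N(2))
  then have 1: "fst ?W = w" unfolding M(2) by (rule vector_derivative_at[symmetric])
  have "((\<lambda>t. u) has_vector_derivative fst (snd ?W)) (at 0)"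
    using has_vector_derivative_fst[OF has_vector_derivative_snd[OF W]] by (simp add: N(2))
  then have 2: "fst (snd ?W) = 0"
    using vector_derivative_unique_at has_vector_derivative_const by blast
  have "?W \<in> velocities (suspension Y p) (y, u, v)" unfolding velocities_def using N(1) by blast
  moreover have "?W = (w, 0, snd (snd ?W))" using 1 2 by (simp add: prod_eq_iff)
  ultimately show thesis using that by metis
qed

lemma span_velocities_suspension_lift:
  assumes p: "real_polynomial_function p" and w: "w \<in> span (velocities Y y)" and "u \<noteq> 0"
  shows "\<exists>b. (w, 0, b) \<in> span (velocities (suspension Y p) (y, u, v))"
  using w
proof (induction rule: span_induct_alt)
  case base
  show ?case using span_0[of "velocities (suspension Y p) (y, u, v)"] by (auto simp: zero_prod_def)
next
  case (step c w w')
  obtain b where b: "(w, 0, b) \<in> velocities (suspension Y p) (y, u, v)"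
    by (rule velocities_suspension_lift[OF p step(1) \<open>u \<noteq> 0\<close>], rule that)
  obtain b' where "(w', 0, b') \<in> span (velocities (suspension Y p) (y, u, v))" using step(2) by blast
  then have "c *\<^sub>R (w, 0, b) + (w', 0, b') \<in> span (velocities (suspension Y p) (y, u, v))"
    using b by (intro span_add span_scale) (auto intro: span_base)
  then show ?case by auto
qed

definition suspension_equation :: "('a \<Rightarrow> real) \<Rightarrow> 'a \<times> real \<times> real \<Rightarrow> real" where
  "suspension_equation p x = fst (snd x) * snd (snd x) - p (fst x)"

lemma suspension_equation_simp [simp]: "suspension_equation p (y, u, v) = u * v - p y"
  by (simp add: suspension_equation_def)

lemma suspension_equation_polynomial:
  assumes p: "real_polynomial_function p"
  shows "real_polynomial_function (suspension_equation p)"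
  unfolding suspension_equation_def [abs_def]
  by (intro polynomial_function_imp_real polyfun
      polynomial_function_comp[OF real_polynomial_function_imp[OF p]])

lemma suspension_equation_vanishing:
  "real_polynomial_function p \<Longrightarrow> suspension_equation p \<in> vanishing_ideal (suspension Y p)"
  unfolding vanishing_ideal_def by (auto simp: mem_suspension suspension_equation_polynomial)

lemma frechet_derivative_suspension_equation:
  assumes p: "real_polynomial_function p"
  shows "frechet_derivative (suspension_equation p) (at (y, u, v)) (w, a, b) =
    u * b + a * v - frechet_derivative p (at y) w"
proof -
  have "(suspension_equation p has_derivative (\<lambda>z. (u * snd (snd z) + fst (snd z) * v) -
      frechet_derivative p (at y) (fst z))) (at (y, u, v))"
    unfolding suspension_equation_def [abs_def]
    using has_derivative_real_polynomial_function[OF p, of y]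
    by (auto intro!: derivative_eq_intros has_derivative_compose[of fst _ _ _ p])
  then have "frechet_derivative (suspension_equation p) (at (y, u, v)) =
      (\<lambda>z. (u * snd (snd z) + fst (snd z) * v) - frechet_derivative p (at y) (fst z))"
    by (rule frechet_derivative_at[symmetric])
  then show ?thesis by simp
qed

lemma tangent_space_suspensionD:
  assumes p: "real_polynomial_function p" and W: "(w, a, b) \<in> tangent_space (suspension Y p) (y, u, v)"
  shows "w \<in> tangent_space Y y" and "a * v + u * b = frechet_derivative p (at y) w"
proof -
  have fst_poly: "polynomial_function (fst :: 'a \<times> real \<times> real \<Rightarrow> 'a)"
    by (rule polynomial_function_bounded_linear[OF bounded_linear_fst])
  have "((\<lambda>x :: 'a \<times> real \<times> real. fst x) has_derivative fst) (at (y, u, v))"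
    by (rule bounded_linear_imp_has_derivative[OF bounded_linear_fst])
  then have 1: "frechet_derivative fst (at (y, u, v)) = (fst :: 'a \<times> real \<times> real \<Rightarrow> 'a)"
    using frechet_derivative_at by metis
  have "fst x \<in> Y" if "x \<in> suspension Y p" for x using that by (cases x) (simp add: mem_suspension)
  from frechet_derivative_maps_tangent_space[OF fst_poly this W] show "w \<in> tangent_space Y y"
    by (simp add: 1)
  have "frechet_derivative (suspension_equation p) (at (y, u, v)) (w, a, b) = 0"
    using tangent_spaceD[OF W suspension_equation_vanishing[OF p]] .
  then show "a * v + u * b = frechet_derivative p (at y) w"
    by (simp add: frechet_derivative_suspension_equation[OF p] algebra_simps)
qed

text \<open>Lifts of flows of Y reach every tangent vector of Y with u component 0. One velocity
  with nonzero u component is still needed. It comes from the lift of \<open>M\<close> that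
  preserves v, conjugated by a motion that preserves u and takes y to \<gamma> y, where
  \<open>p\<close> changes along \<open>M\<close> to first order.\<close>

lemma flexible_point_suspension:
  fixes Y :: "'a::euclidean_space set"
  assumes p: "real_polynomial_function p" and x: "(y, u, v) \<in> suspension Y p" and u: "u \<noteq> 0"
    and flex: "tangent_space Y y \<subseteq> span (velocities Y y)"
    and \<gamma>: "\<gamma> \<in> flow_group Y" and M: "poly_flow Y M"
    and nonzero: "((\<lambda>s. p (M (s, \<gamma> y))) has_real_derivative k) (at 0)" "k \<noteq> 0"
  shows "tangent_space (suspension Y p) (y, u, v) \<subseteq> span (velocities (suspension Y p) (y, u, v))"
proof
  let ?X = "suspension Y p" and ?V = "velocities (suspension Y p) (y, u, v)"
  have y: "y \<in> Y" using x by (simp add: mem_suspension)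
  have V_T: "span ?V \<subseteq> tangent_space ?X (y, u, v)"
    by (rule span_minimal[OF velocities_subset_tangent_space[OF x] subspace_tangent_space])
  obtain W where W: "W \<in> ?V" "fst (snd W) = k"
  proof -
    have empty: "u \<notin> {}" by simp
    obtain g where g: "g \<in> flow_group ?X" "\<And>x. x \<in> ?X \<Longrightarrow> fst (snd (g x)) = fst (snd x)"
      "\<And>x. x \<in> ?X \<Longrightarrow> fst (snd x) = u \<Longrightarrow> fst (g x) = \<gamma> (fst x)"
      by (rule level_move[OF \<gamma> p u finite.emptyI empty], rule that)
    obtain h where h: "h \<in> flow_group ?X" "\<And>x. x \<in> ?X \<Longrightarrow> h (g x) = x" "\<And>x. x \<in> ?X \<Longrightarrow> g (h x) = x"
      by (rule flow_group_inv[OF g(1)], rule that)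
    obtain v' where v': "g (y, u, v) = (\<gamma> y, u, v')"
      using g(2,3)[OF x] by (cases "g (y, u, v)") auto
    obtain N e where N: "poly_flow ?X N" "\<And>t y u v. N (t, y, u, v) =
        (M (t * u * poly 1 u, y), u, v + t * poly 1 u * e (t * u * poly 1 u) y)"
      "\<And>y. y \<in> Y \<Longrightarrow> ((\<lambda>s. p (M (s, y))) has_real_derivative e 0 y) (at 0)"
      "\<And>y. polynomial_function (\<lambda>t. e t y)"
      by (rule suspension_flow[OF M p, of 1], rule that)
    have e0: "e 0 (\<gamma> y) = k"
      using N(3)[OF flow_group_mem[OF \<gamma> y]] nonzero(1) DERIV_unique by blast
    \<comment> \<open>The swapped flow changes u to u + t * e (t * v') (\<gamma> y), and
      \<open>h\<close> does not touch u. The u component of the velocity is therefore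
      \<open>e 0 (\<gamma> y)\<close> = k, also when v' = 0.\<close>
    define N' where "N' = (\<lambda>z. h ((\<lambda>z. swap_uv (N (fst z, swap_uv (snd z)))) (fst z, g (snd z))))"
    have N': "poly_flow ?X N'"
      unfolding N'_def using g h flow_group_mem flow_group_polynomial
      by (intro poly_flow_conjugate[OF flow_group_polynomial[OF g(1)] flow_group_polynomial[OF h(1)] _ _ _ _
            poly_flow_swap[OF N(1)]]) auto
    let ?W = "vector_derivative (\<lambda>t. N' (t, y, u, v)) (at 0)"
    have "((\<lambda>t. N' (t, y, u, v)) has_vector_derivative ?W) (at 0)"
      by (rule poly_curve_has_vector_derivative[OF flow_curve[OF N']])
    from has_vector_derivative_fst[OF has_vector_derivative_snd[OF this]]
    have 1: "((\<lambda>t. fst (snd (N' (t, y, u, v)))) has_vector_derivative fst (snd ?W)) (at 0)" .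
    have h_u: "fst (snd (h z)) = fst (snd z)" if "z \<in> ?X" for z
      using g(2)[OF flow_group_mem[OF h(1) that]] h(3)[OF that] by simp
    have "fst (snd (N' (t, y, u, v))) = u + t * e (t * v') (\<gamma> y)" for t
    proof -
      have "swap_uv (N (t, swap_uv (g (y, u, v)))) \<in> ?X"
        using poly_flowD(2)[OF N(1)] flow_group_mem[OF g(1) x] by simp
      from h_u[OF this] show ?thesis unfolding N'_def by (simp add: v' N(2))
    qed
    moreover have "((\<lambda>t. u + t * e (t * v') (\<gamma> y)) has_real_derivative k) (at 0)"
    proof -
      obtain e' where "\<And>x. ((\<lambda>t. e t (\<gamma> y)) has_real_derivative e' x) (at x)"
        using has_real_derivative_polynomial_function N(4) by (metis real_polynomial_function_eq)
      then have "((\<lambda>t. e (t * v') (\<gamma> y)) has_real_derivative e' (0 * v') * v') (at 0)"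
        by (intro DERIV_chain'[of "\<lambda>t. t * v'" v' 0 UNIV]) (auto intro!: derivative_eq_intros)
      then show ?thesis by (auto intro!: derivative_eq_intros simp: e0)
    qed
    ultimately have "fst (snd ?W) = k"
      using 1 vector_derivative_unique_at by (simp add: has_real_derivative_iff_has_vector_derivative) blast
    moreover have "?W \<in> ?V" unfolding velocities_def using N' by blast
    ultimately show thesis using that by blast
  qed
  fix Z assume Z: "Z \<in> tangent_space ?X (y, u, v)"
  \<comment> \<open>Subtracting a multiple of \<open>W\<close> kills the u component, after which
    lifts from Y suffice.\<close>
  define Z' where "Z' = Z - (fst (snd Z) / k) *\<^sub>R W"
  have Z': "Z' \<in> tangent_space ?X (y, u, v)"
    unfolding Z'_def using Z span_base[OF W(1)] V_T
    by (intro subspace_diff subspace_scale subspace_tangent_space) auto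
  have "fst (snd Z') = 0" unfolding Z'_def using W(2) nonzero(2) by simp
  then have Z'_eq: "Z' = (fst Z', 0, snd (snd Z'))" by (simp add: prod_eq_iff)
  have T: "(fst Z', 0, snd (snd Z')) \<in> tangent_space ?X (y, u, v)"
    using Z' unfolding Z'_eq[symmetric] .
  have "fst Z' \<in> span (velocities Y y)"
    using tangent_space_suspensionD(1)[OF p T] flex by blast
  then obtain b where b: "(fst Z', 0, b) \<in> span ?V"
    using span_velocities_suspension_lift[OF p _ u] by blast
  \<comment> \<open>Both vectors are tangent and agree in the first two components. As u is nonzero,
    the linearised equation determines the third.\<close>
  have "u * b = u * snd (snd Z')"
    using tangent_space_suspensionD(2)[OF p T] tangent_space_suspensionD(2)[OF p subsetD[OF V_T b]] by simp
  then have "Z' \<in> span ?V" using b u by (subst Z'_eq) simp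
  then have "Z' + (fst (snd Z) / k) *\<^sub>R W \<in> span ?V"
    using W(1) by (intro span_add span_scale) (auto intro: span_base)
  then show "Z \<in> span ?V" unfolding Z'_def by simp
qed

section \<open>Localized ideals and smooth points\<close>

text \<open>The ideal generated by \<open>A\<close> in the local ring at \<open>x\<close>, contracted to the polynomial functions.\<close>

inductive_set local_ideal :: "'a::euclidean_space \<Rightarrow> ('a \<Rightarrow> real) set \<Rightarrow> ('a \<Rightarrow> real) set" for x A where
  base: "q \<in> A \<Longrightarrow> q \<in> local_ideal x A"
| zero: "(\<lambda>z. 0) \<in> local_ideal x A"
| add: "q \<in> local_ideal x A \<Longrightarrow> q' \<in> local_ideal x A \<Longrightarrow> (\<lambda>z. q z + q' z) \<in> local_ideal x A"
| mult: "real_polynomial_function a \<Longrightarrow> q \<in> local_ideal x A \<Longrightarrow> (\<lambda>z. a z * q z) \<in> local_ideal x A"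
| div: "real_polynomial_function h \<Longrightarrow> h x \<noteq> 0 \<Longrightarrow> real_polynomial_function q \<Longrightarrow>
    (\<lambda>z. h z * q z) \<in> local_ideal x A \<Longrightarrow> q \<in> local_ideal x A"

lemmas local_ideal_base = local_ideal.intros(1)
lemmas local_ideal_zero = local_ideal.intros(2)
lemmas local_ideal_add = local_ideal.intros(3)
lemmas local_ideal_mult = local_ideal.intros(4)
lemmas local_ideal_div = local_ideal.intros(5)

lemma local_ideal_trans:
  assumes "q \<in> local_ideal x A" "A \<subseteq> local_ideal x B" shows "q \<in> local_ideal x B"
  using assms(1)
proof (induction rule: local_ideal.induct)
  case (div h q)
  show ?case by (rule local_ideal_div[OF div.hyps(1-3) div.IH])
qed (use assms(2) in \<open>auto intro: local_ideal_zero local_ideal_add local_ideal_mult\<close>)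

lemma local_ideal_sum:
  "finite I \<Longrightarrow> (\<And>i. i \<in> I \<Longrightarrow> q i \<in> local_ideal x A) \<Longrightarrow> (\<lambda>z. \<Sum>i\<in>I. q i z) \<in> local_ideal x A"
proof (induction I rule: finite_induct)
  case (insert i I)
  then show ?case using local_ideal_add[of "q i" x A "\<lambda>z. \<Sum>i\<in>I. q i z"] by simp
qed (simp add: local_ideal_zero)

text \<open>Denominators are collected by multiplication, so a single \<open>h\<close> that does not
  vanish at x clears all of them. This is the form in which \<open>smooth_at\<close> expresses local
  generation.\<close>

lemma local_ideal_repr:
  assumes "q \<in> local_ideal x (F ` I)" "finite I"
  obtains h a where "real_polynomial_function h" "h x \<noteq> 0"
    "\<And>i. i \<in> I \<Longrightarrow> real_polynomial_function (a i)" "\<And>z. h z * q z = (\<Sum>i\<in>I. a i z * F i z)"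
proof -
  have "\<exists>h a. real_polynomial_function h \<and> h x \<noteq> 0 \<and> (\<forall>i\<in>I. real_polynomial_function (a i)) \<and>
      (\<forall>z. h z * q z = (\<Sum>i\<in>I. a i z * F i z))"
    using assms(1)
  proof (induction rule: local_ideal.induct)
    case (base q)
    then obtain j where j: "j \<in> I" "q = F j" by blast
    have "(\<Sum>i\<in>I. (if i = j then 1 else 0) * F i z) = F j z" for z
      using assms(2) j(1) by (simp add: sum.delta if_distrib[of "\<lambda>c. c * _"] cong: if_cong)
    then show ?case using j
      by (intro exI[of _ "\<lambda>z. 1"] exI[of _ "\<lambda>i z. if i = j then 1 else 0"])
        (simp add: real_polynomial_function.intros(2))
  next
    case zero
    show ?case
      by (intro exI[of _ "\<lambda>z. 1"] exI[of _ "\<lambda>i z. 0"]) (simp add: real_polynomial_function.intros(2))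
  next
    case (add q q')
    obtain h a where h: "real_polynomial_function h" "h x \<noteq> 0" "\<forall>i\<in>I. real_polynomial_function (a i)"
      "\<forall>z. h z * q z = (\<Sum>i\<in>I. a i z * F i z)" using add.IH(1) by (elim exE conjE)
    obtain h' a' where h': "real_polynomial_function h'" "h' x \<noteq> 0" "\<forall>i\<in>I. real_polynomial_function (a' i)"
      "\<forall>z. h' z * q' z = (\<Sum>i\<in>I. a' i z * F i z)" using add.IH(2) by (elim exE conjE)
    have "h z * h' z * (q z + q' z) = h' z * (h z * q z) + h z * (h' z * q' z)" for z
      by (simp add: algebra_simps)
    also have "\<dots> z = (\<Sum>i\<in>I. (h' z * a i z + h z * a' i z) * F i z)" for z
      using h(4) h'(4) by (simp add: sum_distrib_left sum.distrib algebra_simps)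
    finally show ?case using h(1-3) h'(1-3)
      by (intro exI[of _ "\<lambda>z. h z * h' z"] exI[of _ "\<lambda>i z. h' z * a i z + h z * a' i z"])
        (auto intro!: real_polynomial_function_add real_polynomial_function_mult)
  next
    case (mult b q)
    obtain h a where h: "real_polynomial_function h" "h x \<noteq> 0" "\<forall>i\<in>I. real_polynomial_function (a i)"
      "\<forall>z. h z * q z = (\<Sum>i\<in>I. a i z * F i z)" using mult.IH by (elim exE conjE)
    have "h z * (b z * q z) = b z * (h z * q z)" for z by simp
    also have "\<dots> z = (\<Sum>i\<in>I. (b z * a i z) * F i z)" for z
      using h(4) by (simp add: sum_distrib_left algebra_simps)
    finally show ?case using h(1-3) mult.hyps(1)
      by (intro exI[of _ h] exI[of _ "\<lambda>i z. b z * a i z"])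
        (auto intro!: real_polynomial_function_mult)
  next
    case (div g q)
    obtain h a where h: "real_polynomial_function h" "h x \<noteq> 0" "\<forall>i\<in>I. real_polynomial_function (a i)"
      "\<forall>z. h z * (g z * q z) = (\<Sum>i\<in>I. a i z * F i z)" using div.IH by (elim exE conjE)
    then show ?case using div.hyps
      by (intro exI[of _ "\<lambda>z. h z * g z"] exI[of _ a])
        (auto intro!: real_polynomial_function_mult simp: mult.assoc)
  qed
  then show thesis using that by blast
qed

lemma local_ideal_pullback:
  fixes \<sigma> :: "'a::euclidean_space \<Rightarrow> 'b::euclidean_space"
  assumes "q \<in> local_ideal (\<sigma> y) A" "polynomial_function \<sigma>"
  shows "(\<lambda>z. q (\<sigma> z)) \<in> local_ideal y ((\<lambda>q z. q (\<sigma> z)) ` A)"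
  using assms(1)
proof (induction rule: local_ideal.induct)
  case (base q)
  then show ?case by (intro local_ideal_base) blast
next
  case zero
  show ?case by (rule local_ideal_zero)
next
  case (add q q')
  show ?case by (rule local_ideal_add[OF add.IH])
next
  case (mult a q)
  show ?case
    by (rule local_ideal_mult[OF real_polynomial_function_comp[OF mult.hyps(1) assms(2)] mult.IH])
next
  case (div h q)
  show ?case
  proof (rule local_ideal_div[where h = "\<lambda>z. h (\<sigma> z)"])
    show "real_polynomial_function (\<lambda>z. h (\<sigma> z))"
      by (rule real_polynomial_function_comp[OF div.hyps(1) assms(2)])
    show "real_polynomial_function (\<lambda>z. q (\<sigma> z))"
      by (rule real_polynomial_function_comp[OF div.hyps(3) assms(2)])
  qed (use div.hyps div.IH in simp_all)
qed

text \<open>Stated for an indexed family and not for a set of functions, so that a repeated function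
  counts as a dependence and the cardinality of I is the codimension.\<close>

definition independent_differentials :: "'a::euclidean_space \<Rightarrow> 'i set \<Rightarrow> ('i \<Rightarrow> 'a \<Rightarrow> real) \<Rightarrow> bool" where
  "independent_differentials x I F \<longleftrightarrow>
    (\<forall>c. (\<forall>v. (\<Sum>i\<in>I. c i * frechet_derivative (F i) (at x) v) = 0) \<longrightarrow> (\<forall>i\<in>I. c i = 0))"

text \<open>An arbitrary finite index set in place of an initial segment allows generators to be
  added or removed without renumbering.\<close>

lemma smooth_atI:
  assumes "y \<in> Y" "finite I" "card I + d = DIM('a)" "\<And>i. i \<in> I \<Longrightarrow> F i \<in> vanishing_ideal Y"
    and "vanishing_ideal Y \<subseteq> local_ideal y (F ` I)" "independent_differentials y I F"
  shows "smooth_at Y d (y :: 'a::euclidean_space)"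
proof -
  obtain e where e: "bij_betw e {..<card I} I"
    using ex_bij_betw_nat_finite[OF assms(2)] by (metis atLeast0LessThan)
  have e_mem: "e j \<in> I" if "j < card I" for j using e that by (auto simp: bij_betw_def)
  have reindex: "(\<Sum>i\<in>I. t i) = (\<Sum>j<card I. t (e j))" for t :: "'b \<Rightarrow> real"
    by (rule sum.reindex_bij_betw[OF e, symmetric])
  show ?thesis
    unfolding smooth_at_def
  proof (intro conjI assms(1) exI[of _ "card I"] exI[of _ "\<lambda>j. F (e j)"] assms(3) allI impI ballI)
    fix j assume "j < card I"
    then show "F (e j) \<in> vanishing_ideal Y" using assms(4) e_mem by simp
  next
    fix p assume "p \<in> vanishing_ideal Y"
    then have "p \<in> local_ideal y (F ` I)" using assms(5) by blast
    then obtain h a where h: "real_polynomial_function h" "h y \<noteq> 0"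
      "\<And>i. i \<in> I \<Longrightarrow> real_polynomial_function (a i)" "\<And>z. h z * p z = (\<Sum>i\<in>I. a i z * F i z)"
      by (elim local_ideal_repr[OF _ assms(2)]) (rule that)
    then show "\<exists>h a. real_polynomial_function h \<and> h y \<noteq> 0 \<and>
            (\<forall>i<card I. real_polynomial_function (a i)) \<and>
            (\<forall>x. h x * p x = (\<Sum>i<card I. a i x * F (e i) x))"
      using e_mem by (intro exI[of _ h] exI[of _ "\<lambda>j. a (e j)"]) (simp add: reindex)
  next
    fix c j assume c: "\<forall>v. (\<Sum>i<card I. c i * frechet_derivative (F (e i)) (at y) v) = 0" and j: "j < card I"
    define c' where "c' = (\<lambda>i. c (inv_into {..<card I} e i))"
    have c': "c' (e j) = c j" if "j < card I" for j
      using that e unfolding c'_def bij_betw_def by simp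
    have "(\<Sum>i\<in>I. c' i * frechet_derivative (F i) (at y) v) = 0" for v
      using c by (simp add: reindex c')
    then have "\<forall>i\<in>I. c' i = 0" using assms(6) unfolding independent_differentials_def by blast
    then show "c j = 0" using c'[OF j] e_mem[OF j] by simp
  qed
qed

lemma smooth_atE:
  assumes "smooth_at Y d (y :: 'a::euclidean_space)"
  obtains k :: nat and F where "y \<in> Y" "k + d = DIM('a)" "\<And>i. i < k \<Longrightarrow> F i \<in> vanishing_ideal Y"
    "vanishing_ideal Y \<subseteq> local_ideal y (F ` {..<k})" "independent_differentials y {..<k} F"
proof -
  obtain k :: nat and F where *: "k + d = DIM('a)" "\<forall>i<k. F i \<in> vanishing_ideal Y"
    "\<forall>p\<in>vanishing_ideal Y. \<exists>h a. real_polynomial_function h \<and> h y \<noteq> 0 \<and>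
            (\<forall>i<k. real_polynomial_function (a i)) \<and> (\<forall>x. h x * p x = (\<Sum>i<k. a i x * F i x))"
    "\<forall>c. (\<forall>v. (\<Sum>i<k. c i * frechet_derivative (F i) (at y) v) = 0) \<longrightarrow> (\<forall>i<k. c i = 0)"
    using assms unfolding smooth_at_def by (elim conjE exE)
  have "p \<in> local_ideal y (F ` {..<k})" if p: "p \<in> vanishing_ideal Y" for p
  proof -
    obtain h a where h: "real_polynomial_function h" "h y \<noteq> 0"
            "\<forall>i<k. real_polynomial_function (a i)" "\<forall>x. h x * p x = (\<Sum>i<k. a i x * F i x)"
      using bspec[OF *(3) p] by (elim conjE exE)
    have "(\<lambda>x. \<Sum>i<k. a i x * F i x) \<in> local_ideal y (F ` {..<k})"
    proof (rule local_ideal_sum)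
      fix i assume "i \<in> {..<k}"
      then show "(\<lambda>x. a i x * F i x) \<in> local_ideal y (F ` {..<k})"
        using h(3) by (intro local_ideal_mult[of "a i" "F i"] local_ideal_base) auto
    qed simp
    then have "(\<lambda>x. h x * p x) \<in> local_ideal y (F ` {..<k})" using h(4) by simp
    then show ?thesis by (rule local_ideal_div[OF h(1,2) vanishing_idealD(1)[OF p]])
  qed
  then have "vanishing_ideal Y \<subseteq> local_ideal y (F ` {..<k})" by (rule subsetI)
  moreover have "independent_differentials y {..<k} F"
    unfolding independent_differentials_def using *(4) by simp
  moreover have "y \<in> Y" using assms unfolding smooth_at_def by (rule conjunct1)
  ultimately show thesis using that[of k F] *(1,2) by simp
qed

section \<open>Differentials of local generators and the dimension of the tangent space\<close>

lemma frechet_derivative_mult: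
  assumes "real_polynomial_function p" "real_polynomial_function q"
  shows "frechet_derivative (\<lambda>z. p z * q z) (at x) w =
    p x * frechet_derivative q (at x) w + frechet_derivative p (at x) w * q x"
proof -
  have "((\<lambda>z. p z * q z) has_derivative
      (\<lambda>w. p x * frechet_derivative q (at x) w + frechet_derivative p (at x) w * q x)) (at x)"
    by (intro has_derivative_mult has_derivative_real_polynomial_function assms)
  from frechet_derivative_at[OF this] show ?thesis by metis
qed

lemma frechet_derivative_sum_real:
  assumes "\<And>i. i \<in> I \<Longrightarrow> real_polynomial_function (q i)"
  shows "frechet_derivative (\<lambda>z. \<Sum>i\<in>I. q i z) (at x) w = (\<Sum>i\<in>I. frechet_derivative (q i) (at x) w)"
proof -
  have "((\<lambda>z. \<Sum>i\<in>I. q i z) has_derivative (\<lambda>w. \<Sum>i\<in>I. frechet_derivative (q i) (at x) w)) (at x)"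
    by (intro has_derivative_sum has_derivative_real_polynomial_function assms)
  from frechet_derivative_at[OF this] show ?thesis by metis
qed

text \<open>Leibniz' rule at a common zero of q and the F i: all terms containing a differential of
  a coefficient vanish.\<close>

lemma frechet_derivative_repr:
  assumes "finite I" "real_polynomial_function h" "real_polynomial_function q" "q x = 0"
    and "\<And>i. i \<in> I \<Longrightarrow> real_polynomial_function (a i)" "\<And>i. i \<in> I \<Longrightarrow> real_polynomial_function (F i)"
    and "\<And>i. i \<in> I \<Longrightarrow> F i x = 0" and "\<And>z. h z * q z = (\<Sum>i\<in>I. a i z * F i z)"
  shows "h x * frechet_derivative q (at x) w = (\<Sum>i\<in>I. a i x * frechet_derivative (F i) (at x) w)"
proof -
  have "h x * frechet_derivative q (at x) w = frechet_derivative (\<lambda>z. h z * q z) (at x) w"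
    using assms(2,3,4) by (simp add: frechet_derivative_mult)
  also have "\<dots> = (\<Sum>i\<in>I. frechet_derivative (\<lambda>z. a i z * F i z) (at x) w)"
    unfolding assms(8) using assms(5,6) real_polynomial_function_mult
    by (intro frechet_derivative_sum_real) auto
  also have "\<dots> = (\<Sum>i\<in>I. a i x * frechet_derivative (F i) (at x) w)"
    using assms(5-7) by (intro sum.cong) (auto simp: frechet_derivative_mult)
  finally show ?thesis .
qed

text \<open>Each functional is the inner product with a vector \<open>g i\<close>. Independence
  makes these vectors distinct and linearly independent, and the common kernel is the orthogonal
  complement of their span.\<close>

lemma dim_kernel_independent_functionals:
  fixes l :: "'i \<Rightarrow> 'a::euclidean_space \<Rightarrow> real"
  assumes K: "finite K" and lin: "\<And>i. i \<in> K \<Longrightarrow> linear (l i)"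
    and indep: "\<And>c. (\<And>v. (\<Sum>i\<in>K. c i * l i v) = 0) \<Longrightarrow> \<forall>i\<in>K. c i = 0"
  shows "dim {w. \<forall>i\<in>K. l i w = 0} + card K = DIM('a)"
proof -
  define g where "g = (\<lambda>i. \<Sum>b\<in>Basis. l i b *\<^sub>R b)"
  have g: "g i \<bullet> w = l i w" if "i \<in> K" for i w
  proof -
    have "l i w = l i (\<Sum>b\<in>Basis. (w \<bullet> b) *\<^sub>R b)" by (simp add: euclidean_representation)
    also have "\<dots> = (\<Sum>b\<in>Basis. (w \<bullet> b) * l i b)"
      using lin[OF that] by (simp add: linear_sum linear_scale)
    also have "\<dots> = g i \<bullet> w"
      unfolding g_def inner_sum_left by (intro sum.cong) (simp_all add: inner_commute)
    finally show ?thesis by simp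
  qed
  have inj: "inj_on g K"
  proof (rule inj_onI, rule ccontr)
    fix i j assume ij: "i \<in> K" "j \<in> K" "g i = g j" "i \<noteq> j"
    have "(\<Sum>m\<in>K. (if m = i then 1 else if m = j then -1 else 0) * l m v) = 0" for v
    proof -
      have "(\<Sum>m\<in>K. (if m = i then 1 else if m = j then -1 else 0) * l m v) =
          (\<Sum>m\<in>{i, j}. (if m = i then 1 else if m = j then -1 else 0) * l m v)"
        using K ij by (intro sum.mono_neutral_right) auto
      also have "\<dots> = l i v - l j v" using ij(4) by simp
      finally show ?thesis using g[OF ij(1), of v] g[OF ij(2), of v] ij(3) by simp
    qed
    from indep[OF this] show False using ij(1) by fastforce
  qed
  have "independent (g ` K)"
  proof
    assume "dependent (g ` K)"
    then obtain c where c: "\<exists>v\<in>g ` K. c v \<noteq> 0" "(\<Sum>v\<in>g ` K. c v *\<^sub>R v) = 0"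
      using dependent_finite[of "g ` K"] K by blast
    have sum0: "(\<Sum>i\<in>K. c (g i) *\<^sub>R g i) = 0" using c(2) by (simp add: sum.reindex[OF inj])
    have "(\<Sum>i\<in>K. c (g i) * l i v) = (\<Sum>i\<in>K. c (g i) *\<^sub>R g i) \<bullet> v" for v
      using g by (simp add: inner_sum_left)
    then have "\<forall>i\<in>K. c (g i) = 0" using indep[of "\<lambda>i. c (g i)"] sum0 by simp
    then show False using c(1) by blast
  qed
  then have 1: "dim (span (g ` K)) = card K"
    using inj by (simp add: dim_eq_card_independent card_image)
  have "{w. \<forall>i\<in>K. l i w = 0} = {w \<in> UNIV. \<forall>x\<in>span (g ` K). orthogonal x w}"
  proof (intro equalityI subsetI; clarsimp)
    fix w x assume w: "\<forall>i\<in>K. l i w = 0" and x: "x \<in> span (g ` K)"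
    show "orthogonal x w"
      by (rule orthogonal_commute[THEN iffD1], rule orthogonal_to_span[OF x])
        (use w g in \<open>auto simp: orthogonal_def inner_commute\<close>)
  next
    fix w i assume "\<forall>x\<in>span (g ` K). orthogonal x w" "i \<in> K"
    then show "l i w = 0" using g span_base[of "g i" "g ` K"] by (auto simp: orthogonal_def)
  qed
  then show ?thesis
    using dim_subspace_orthogonal_to_vectors[of "span (g ` K)" UNIV] 1 by simp
qed

lemma dim_kernel_differentials:
  fixes F :: "'i \<Rightarrow> 'a::euclidean_space \<Rightarrow> real"
  assumes "finite I" "\<And>i. i \<in> I \<Longrightarrow> real_polynomial_function (F i)" "independent_differentials x I F"
  shows "dim {w. \<forall>i\<in>I. frechet_derivative (F i) (at x) w = 0} + card I = DIM('a)"
proof (rule dim_kernel_independent_functionals[OF assms(1)])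
  show "linear (frechet_derivative (F i) (at x))" if "i \<in> I" for i
    by (rule linear_frechet_derivative_polynomial[OF assms(2)[OF that]])
qed (use assms(3) in \<open>auto simp: independent_differentials_def\<close>)

text \<open>Up to a factor that is nonzero at y, every element of the ideal is a combination of the
  local generators. Hence their differentials alone cut out the tangent space, and they are
  independent.\<close>

lemma dim_tangent_space_smooth:
  assumes "smooth_at Y d (y :: 'a::euclidean_space)" shows "dim (tangent_space Y y) = d"
proof -
  obtain k :: nat and F where F: "y \<in> Y" "k + d = DIM('a)" "\<And>i. i < k \<Longrightarrow> F i \<in> vanishing_ideal Y"
    "vanishing_ideal Y \<subseteq> local_ideal y (F ` {..<k})" "independent_differentials y {..<k} F"
    by (rule smooth_atE[OF assms], rule that)
  have "tangent_space Y y = {w. \<forall>i\<in>{..<k}. frechet_derivative (F i) (at y) w = 0}"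
  proof (intro equalityI subsetI)
    fix w assume "w \<in> tangent_space Y y"
    then show "w \<in> {w. \<forall>i\<in>{..<k}. frechet_derivative (F i) (at y) w = 0}"
      using F(3) by (auto dest: tangent_spaceD)
  next
    fix w assume w: "w \<in> {w. \<forall>i\<in>{..<k}. frechet_derivative (F i) (at y) w = 0}"
    show "w \<in> tangent_space Y y"
      unfolding tangent_space_def
    proof (intro CollectI ballI)
      fix q assume q: "q \<in> vanishing_ideal Y"
      obtain h a where h: "real_polynomial_function h" "h y \<noteq> 0"
        "\<And>i. i \<in> {..<k} \<Longrightarrow> real_polynomial_function (a i)" "\<And>z. h z * q z = (\<Sum>i\<in>{..<k}. a i z * F i z)"
        by (rule local_ideal_repr[OF subsetD[OF F(4) q] finite_lessThan], rule that)
      have "h y * frechet_derivative q (at y) w = (\<Sum>i\<in>{..<k}. a i y * frechet_derivative (F i) (at y) w)"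
        by (rule frechet_derivative_repr)
          (use h q F(1,3) in \<open>auto simp: vanishing_ideal_def\<close>)
      then show "frechet_derivative q (at y) w = 0" using w h(2) by simp
    qed
  qed
  moreover have "dim {w. \<forall>i\<in>{..<k}. frechet_derivative (F i) (at y) w = 0} + card {..<k} = DIM('a)"
  proof (rule dim_kernel_differentials[OF finite_lessThan _ F(5)])
    fix i assume "i \<in> {..<k}"
    then show "real_polynomial_function (F i)" using vanishing_idealD(1)[OF F(3)] by simp
  qed
  ultimately show ?thesis using F(2) by simp
qed

lemma real_polynomial_function_frechet_derivative:
  "real_polynomial_function p \<Longrightarrow> real_polynomial_function (\<lambda>x. frechet_derivative p (at x) w)"
proof (induction rule: real_polynomial_function.induct)
  case (linear f)
  have "frechet_derivative f (at x) = f" for x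
    using frechet_derivative_at[OF bounded_linear_imp_has_derivative[OF linear]] by metis
  then show ?case by (simp add: real_polynomial_function.intros(2))
next
  case (const c)
  then show ?case by (simp add: real_polynomial_function.intros(2))
next
  case (add f g)
  have "frechet_derivative (\<lambda>x. f x + g x) (at x) w = frechet_derivative f (at x) w + frechet_derivative g (at x) w" for x
  proof -
    have "((\<lambda>z. f z + g z) has_derivative
        (\<lambda>w. frechet_derivative f (at x) w + frechet_derivative g (at x) w)) (at x)"
      by (intro has_derivative_add has_derivative_real_polynomial_function add.hyps)
    from frechet_derivative_at[OF this] show ?thesis by metis
  qed
  then show ?case using add.IH by (simp add: real_polynomial_function_add)
next
  case (mult f g)
  then show ?case
    by (simp add: frechet_derivative_mult real_polynomial_function_add real_polynomial_function_mult)
qed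

text \<open>Linear independence is stable under small perturbations, by diagonal dominance in a dual basis.\<close>

lemma eventually_independent_differentials:
  fixes F :: "'i \<Rightarrow> 'a::euclidean_space \<Rightarrow> real"
  assumes I: "finite I" and F: "\<And>i. i \<in> I \<Longrightarrow> real_polynomial_function (F i)"
    and indep: "independent_differentials x I F"
  shows "\<forall>\<^sub>F z in nhds x. independent_differentials z I F"
proof -
  let ?D = "\<lambda>i z. frechet_derivative (F i) (at z)"
  \<comment> \<open>Omitting the j-th functional raises the dimension of the common kernel by one. A
    vector gained in this way, rescaled, is the j-th dual vector.\<close>
  have "\<exists>w. ?D j x w = 1 \<and> (\<forall>i\<in>I - {j}. ?D i x w = 0)" if j: "j \<in> I" for j
  proof -
    have "independent_differentials x (I - {j}) F"
      unfolding independent_differentials_def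
    proof (intro allI impI)
      fix c assume c: "\<forall>v. (\<Sum>i\<in>I - {j}. c i * ?D i x v) = 0"
      have "(\<Sum>i\<in>I. (if i = j then 0 else c i) * ?D i x v) = 0" for v
      proof -
        have "(\<Sum>i\<in>I. (if i = j then 0 else c i) * ?D i x v) = (\<Sum>i\<in>I - {j}. (if i = j then 0 else c i) * ?D i x v)"
          using I by (intro sum.mono_neutral_right) auto
        also have "\<dots> = 0" using c by simp
        finally show ?thesis .
      qed
      then have "\<forall>i\<in>I. (if i = j then 0 else c i) = 0"
        using spec[OF indep[unfolded independent_differentials_def], of "\<lambda>i. if i = j then 0 else c i"] by simp
      then show "\<forall>i\<in>I - {j}. c i = 0" by (metis DiffD1 DiffD2 singletonI)
    qed
    then have 1: "dim {w. \<forall>i\<in>I - {j}. ?D i x w = 0} + card (I - {j}) = DIM('a)"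
      using I F by (intro dim_kernel_differentials) auto
    have 2: "dim {w. \<forall>i\<in>I. ?D i x w = 0} + card I = DIM('a)"
      using I F indep by (intro dim_kernel_differentials) auto
    have 3: "card I = Suc (card (I - {j}))" by (rule card.remove[OF I j])
    have "\<not> {w. \<forall>i\<in>I - {j}. ?D i x w = 0} \<subseteq> {w. \<forall>i\<in>I. ?D i x w = 0}"
    proof
      assume "{w. \<forall>i\<in>I - {j}. ?D i x w = 0} \<subseteq> {w. \<forall>i\<in>I. ?D i x w = 0}"
      from dim_subset[OF this] show False using 1 2 3 by linarith
    qed
    then obtain w where "w \<in> {w. \<forall>i\<in>I - {j}. ?D i x w = 0}" "w \<notin> {w. \<forall>i\<in>I. ?D i x w = 0}"
      by (meson subsetI)
    then have w: "\<forall>i\<in>I - {j}. ?D i x w = 0" "?D j x w \<noteq> 0"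
      by (simp_all only: mem_Collect_eq) (metis DiffI singletonD)
    have "?D i x ((1 / ?D j x w) *\<^sub>R w) = (1 / ?D j x w) * ?D i x w" if "i \<in> I" for i
      using linear_scale[OF linear_frechet_derivative_polynomial[OF F[OF that]]] by simp
    then show ?thesis using w j by (intro exI[of _ "(1 / ?D j x w) *\<^sub>R w"]) auto
  qed
  then obtain w where w: "\<And>j. j \<in> I \<Longrightarrow> ?D j x (w j) = 1" "\<And>i j. j \<in> I \<Longrightarrow> i \<in> I - {j} \<Longrightarrow> ?D i x (w j) = 0"
    by metis
  \<comment> \<open>Below, every coefficient of a relation is bounded by S \<epsilon>, where S is
    the sum of their absolute values. Summing over I gives S \<le> S card I / (card I + 1), hence S
    = 0.\<close>
  define \<epsilon> where "\<epsilon> = 1 / (real (card I) + 1)"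
  have \<epsilon>: "\<epsilon> > 0" unfolding \<epsilon>_def by (simp add: add_pos_nonneg)
  have "\<forall>\<^sub>F z in nhds x. \<bar>?D i z (w j) - ?D i x (w j)\<bar> < \<epsilon>" if "i \<in> I" for i j
  proof -
    have "isCont (\<lambda>z. ?D i z (w j)) x"
      using continuous_real_polymonial_function[OF real_polynomial_function_frechet_derivative[OF F[OF that]]] .
    then have "((\<lambda>z. ?D i z (w j)) \<longlongrightarrow> ?D i x (w j)) (nhds x)"
      by (simp add: continuous_at tendsto_nhds_iff)
    from tendstoD[OF this \<epsilon>] show ?thesis by (simp add: dist_real_def)
  qed
  then have "\<forall>\<^sub>F z in nhds x. \<forall>i\<in>I. \<forall>j\<in>I. \<bar>?D i z (w j) - ?D i x (w j)\<bar> < \<epsilon>"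
    using I by (intro eventually_ball_finite ballI) auto
  then show ?thesis
  proof eventually_elim
    case (elim z)
    show ?case
      unfolding independent_differentials_def
    proof (intro allI impI)
      fix c assume c: "\<forall>v. (\<Sum>i\<in>I. c i * ?D i z v) = 0"
      define S where "S = (\<Sum>i\<in>I. \<bar>c i\<bar>)"
      have S0: "S \<ge> 0" unfolding S_def by (simp add: sum_nonneg)
      have cj: "\<bar>c j\<bar> \<le> S * \<epsilon>" if j: "j \<in> I" for j
      proof -
        have "(\<Sum>i\<in>I. c i * ?D i x (w j)) = (\<Sum>i\<in>I. if i = j then c j else 0)"
          using w j by (intro sum.cong) auto
        also have "\<dots> = c j" using I j by simp
        finally have "c j = (\<Sum>i\<in>I. c i * ?D i x (w j)) - (\<Sum>i\<in>I. c i * ?D i z (w j))"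
          using c by simp
        also have "\<dots> = (\<Sum>i\<in>I. c i * (?D i x (w j) - ?D i z (w j)))"
          by (simp add: sum_subtractf algebra_simps)
        finally have "\<bar>c j\<bar> \<le> (\<Sum>i\<in>I. \<bar>c i * (?D i x (w j) - ?D i z (w j))\<bar>)"
          by (simp add: sum_abs)
        also have "\<dots> \<le> (\<Sum>i\<in>I. \<bar>c i\<bar> * \<epsilon>)"
        proof (rule sum_mono)
          fix i assume "i \<in> I"
          then have "\<bar>?D i x (w j) - ?D i z (w j)\<bar> \<le> \<epsilon>"
            using elim j by (simp add: abs_minus_commute less_imp_le)
          then show "\<bar>c i * (?D i x (w j) - ?D i z (w j))\<bar> \<le> \<bar>c i\<bar> * \<epsilon>"
            unfolding abs_mult by (rule mult_left_mono) simp
        qed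
        finally show ?thesis by (simp add: S_def sum_distrib_right)
      qed
      have "S \<le> (\<Sum>i\<in>I. S * \<epsilon>)" unfolding S_def[symmetric] using cj by (subst S_def) (intro sum_mono)
      then have "S \<le> real (card I) * (S * \<epsilon>)" by simp
      then have "S * (real (card I) + 1) \<le> real (card I) * S"
        unfolding \<epsilon>_def by (simp add: field_simps)
      then have "S = 0" using S0 by (simp add: algebra_simps)
      then show "\<forall>i\<in>I. c i = 0" unfolding S_def using I by (simp add: sum_nonneg_eq_0_iff)
    qed
  qed
qed

section \<open>Smooth points of the suspension\<close>

lemma frechet_derivative_fst_comp:
  assumes "real_polynomial_function q"
  shows "frechet_derivative (\<lambda>x. q (fst x)) (at x) w = frechet_derivative q (at (fst x)) (fst w)"
proof -
  have "((\<lambda>x. q (fst x)) has_derivative (\<lambda>w. frechet_derivative q (at (fst x)) (fst w))) (at x)"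
    by (rule has_derivative_compose[OF bounded_linear_imp_has_derivative[OF bounded_linear_fst]
        has_derivative_real_polynomial_function[OF assms]])
  from frechet_derivative_at[OF this] show ?thesis by metis
qed

lemma frechet_derivative_real_comp:
  fixes P :: "'a::euclidean_space \<Rightarrow> 'b::euclidean_space"
  assumes "polynomial_function P" "real_polynomial_function q"
  shows "frechet_derivative (\<lambda>x. q (P x)) (at x) w =
    frechet_derivative q (at (P x)) (frechet_derivative P (at x) w)"
  by (rule frechet_derivative_polynomial_comp[OF assms(1) real_polynomial_function_imp[OF assms(2)]])

lemma real_polynomial_fst: "real_polynomial_function q \<Longrightarrow> real_polynomial_function (\<lambda>x. q (fst x))"
  by (rule real_polynomial_function_comp) (auto intro!: polyfun)

text \<open>On X one may replace u v by \<open>p y\<close>. A high enough power of u thus removes v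
  altogether and leaves a polynomial in u with coefficients on the base, at the price of a multiple
  of the equation.\<close>

lemma suspension_decomp:
  fixes q :: "'a::euclidean_space \<times> real \<times> real \<Rightarrow> real"
  assumes p: "real_polynomial_function p" and "real_polynomial_function q"
  obtains N c b where "poly_family c" "real_polynomial_function b"
    "\<And>y u v. u ^ N * q (y, u, v) = poly (c y) u + b (y, u, v) * suspension_equation p (y, u, v)"
proof -
  have u: "real_polynomial_function (\<lambda>x :: 'a \<times> real \<times> real. fst (snd x))"
    by (intro polynomial_function_imp_real polyfun)
  have G: "real_polynomial_function (suspension_equation p)" by (rule suspension_equation_polynomial[OF p])
  have cfst: "real_polynomial_function (\<lambda>x :: 'a \<times> real \<times> real. poly (c (fst x)) (fst (snd x)))"
    if "poly_family c" for c :: "'a \<Rightarrow> real poly"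
  proof -
    have "polynomial_function (\<lambda>x :: 'a \<times> real \<times> real. (\<lambda>(t, x). poly (c x) t) (fst (snd x), fst x))"
      by (rule polynomial_function_comp[OF poly_family_polynomial_function[OF that]]) (intro polyfun)
    then show ?thesis by (simp add: real_polynomial_function_eq)
  qed
  have "\<exists>N c b. poly_family c \<and> real_polynomial_function b \<and>
    (\<forall>x. fst (snd x) ^ N * q x = poly (c (fst x)) (fst (snd x)) + b x * suspension_equation p x)"
    using assms(2)
  proof (induction rule: real_polynomial_function.induct)
    case (linear h)
    have bl: "bounded_linear (\<lambda>y. h (y, 0, 0))"
      by (rule bounded_linear_compose[OF linear bounded_linear_Pair[OF bounded_linear_ident bounded_linear_zero], unfolded zero_prod_def])
    have h_eq: "h (y, u, v) = h (y, 0, 0) + u * h (0, 1, 0) + v * h (0, 0, 1)" for y u v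
    proof -
      have "(y, u, v) = (y, 0, 0) + u *\<^sub>R (0, 1, 0) + v *\<^sub>R (0, 0, 1)" by simp
      then have "h (y, u, v) = h ((y, 0, 0) + u *\<^sub>R (0, 1, 0) + v *\<^sub>R (0, 0, 1))" by metis
      also have "\<dots> = h (y, 0, 0) + u *\<^sub>R h (0, 1, 0) + v *\<^sub>R h (0, 0, 1)"
        unfolding linear_add[OF bounded_linear.linear[OF linear]] linear_scale[OF bounded_linear.linear[OF linear]] ..
      finally show ?thesis by simp
    qed
    \<comment> \<open>This is u h(y, u, v) = u h(y, 0, 0) + u^2 h(0, 1, 0) + u v h(0, 0, 1) with u v
      replaced by \<open>p y\<close>.\<close>
    let ?c = "\<lambda>y. [:0, 1:] * [:h (y, 0, 0):] + [:0, 0, h (0, 1, 0):] + [:h (0, 0, 1):] * [:p y:]"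
    have "poly_family ?c"
      by (intro poly_family_add poly_family_mult poly_family_const poly_family_coeff p
          real_polynomial_function.intros(1)[OF bl])
    moreover have "fst (snd x) ^ 1 * h x = poly (?c (fst x)) (fst (snd x)) + h (0, 0, 1) * suspension_equation p x"
      for x
    proof (cases x)
      case (fields y u v)
      show ?thesis unfolding fields by (subst h_eq) (simp add: algebra_simps)
    qed
    ultimately show ?case
      by (intro exI[of _ 1] exI[of _ ?c] exI[of _ "\<lambda>x. h (0, 0, 1)"])
        (auto simp: real_polynomial_function.intros(2))
  next
    case (const k)
    show ?case
      by (intro exI[of _ 0] exI[of _ "\<lambda>y. [:k:]"] exI[of _ "\<lambda>x. 0"])
        (simp add: poly_family_const real_polynomial_function.intros(2))
  next
    case (add f g)
    obtain N c b where f: "poly_family c" "real_polynomial_function b"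
      "\<forall>x. fst (snd x) ^ N * f x = poly (c (fst x)) (fst (snd x)) + b x * suspension_equation p x"
      using add.IH(1) by (elim exE conjE)
    obtain N' c' b' where g: "poly_family c'" "real_polynomial_function b'"
      "\<forall>x. fst (snd x) ^ N' * g x = poly (c' (fst x)) (fst (snd x)) + b' x * suspension_equation p x"
      using add.IH(2) by (elim exE conjE)
    let ?c = "\<lambda>y. monom 1 N' * c y + monom 1 N * c' y"
    let ?b = "\<lambda>x. fst (snd x) ^ N' * b x + fst (snd x) ^ N * b' x"
    have "fst (snd x) ^ (N + N') * (f x + g x) =
        poly (?c (fst x)) (fst (snd x)) + ?b x * suspension_equation p x" for x
    proof -
      have "fst (snd x) ^ (N + N') * (f x + g x) =
          fst (snd x) ^ N' * (fst (snd x) ^ N * f x) + fst (snd x) ^ N * (fst (snd x) ^ N' * g x)"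
        by (simp add: power_add algebra_simps)
      then show ?thesis unfolding f(3)[rule_format] g(3)[rule_format]
        by (simp add: poly_monom algebra_simps)
    qed
    moreover have "poly_family ?c"
      by (intro poly_family_add poly_family_mult poly_family_const f g)
    moreover have "real_polynomial_function ?b"
      by (intro real_polynomial_function_add real_polynomial_function_mult real_polynomial_function_power u f g)
    ultimately show ?case by blast
  next
    case (mult f g)
    obtain N c b where f: "poly_family c" "real_polynomial_function b"
      "\<forall>x. fst (snd x) ^ N * f x = poly (c (fst x)) (fst (snd x)) + b x * suspension_equation p x"
      using mult.IH(1) by (elim exE conjE)
    obtain N' c' b' where g: "poly_family c'" "real_polynomial_function b'"
      "\<forall>x. fst (snd x) ^ N' * g x = poly (c' (fst x)) (fst (snd x)) + b' x * suspension_equation p x"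
      using mult.IH(2) by (elim exE conjE)
    let ?c = "\<lambda>y. c y * c' y"
    let ?b = "\<lambda>x. poly (c (fst x)) (fst (snd x)) * b' x + b x * (fst (snd x) ^ N' * g x)"
    have "fst (snd x) ^ (N + N') * (f x * g x) =
        poly (?c (fst x)) (fst (snd x)) + ?b x * suspension_equation p x" for x
    proof -
      have "fst (snd x) ^ (N + N') * (f x * g x) = (fst (snd x) ^ N * f x) * (fst (snd x) ^ N' * g x)"
        by (simp add: power_add algebra_simps)
      then show ?thesis unfolding f(3)[rule_format] g(3)[rule_format]
        by (simp add: algebra_simps)
    qed
    moreover have "poly_family ?c"
      by (intro poly_family_add poly_family_mult poly_family_const f g)
    moreover have "real_polynomial_function ?b"
      by (intro real_polynomial_function_add real_polynomial_function_mult real_polynomial_function_power u f g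
          cfst mult.hyps)
    ultimately show ?case by blast
  qed
  then obtain N c b where "poly_family c" "real_polynomial_function b"
    "\<forall>x. fst (snd x) ^ N * q x = poly (c (fst x)) (fst (snd x)) + b x * suspension_equation p x"
    by (elim exE conjE)
  then show thesis using that[of c b N] by fastforce
qed

lemma infinite_nonzero_real: "infinite {u :: real. u \<noteq> 0}"
proof
  assume "finite {u :: real. u \<noteq> 0}"
  then have "finite (insert 0 {u :: real. u \<noteq> 0})" by simp
  moreover have "insert 0 {u :: real. u \<noteq> 0} = UNIV" by auto
  ultimately show False using infinite_UNIV_char_0 by metis
qed

text \<open>The fibre over y contains a point for every nonzero u, so the polynomial
  \<open>c y\<close> has infinitely many zeros.\<close>

lemma suspension_decomp_coeff:
  assumes "q \<in> vanishing_ideal (suspension Y p)" and "y \<in> Y"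
    and "\<And>u v. u * v = p y \<Longrightarrow> u ^ N * q (y, u, v) = poly (c y) u"
  shows "c y = 0"
proof (rule poly_eqI_infinite[OF infinite_nonzero_real])
  fix u :: real assume "u \<in> {u. u \<noteq> 0}"
  then have "(y, u, p y / u) \<in> suspension Y p" using assms(2) by (simp add: mem_suspension)
  then have "q (y, u, p y / u) = 0" using assms(1) vanishing_idealD(2) by blast
  then show "poly (c y) u = poly 0 u" using assms(3)[of u "p y / u"] \<open>u \<in> _\<close> by simp
qed

text \<open>The coefficients of the reduced form of q vanish on Y and so belong to the local ideal
  generated by \<open>A\<close>. They give u^N q, and u^N can be divided out because u is nonzero at
  the point.\<close>

lemma vanishing_ideal_suspension_subset:
  fixes Y :: "'a::euclidean_space set"
  assumes p: "real_polynomial_function p" and u: "u \<noteq> 0"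
    and gen: "vanishing_ideal Y \<subseteq> local_ideal y A"
  shows "vanishing_ideal (suspension Y p) \<subseteq>
    local_ideal (y, u, v) (insert (suspension_equation p) ((\<lambda>q x. q (fst x)) ` A))"
proof
  let ?A = "insert (suspension_equation p) ((\<lambda>q x. q (fst x)) ` A)"
  fix q :: "'a \<times> real \<times> real \<Rightarrow> real" assume q: "q \<in> vanishing_ideal (suspension Y p)"
  obtain N c b where c: "poly_family c" "real_polynomial_function b"
    "\<And>y u v. u ^ N * q (y, u, v) = poly (c y) u + b (y, u, v) * suspension_equation p (y, u, v)"
    by (rule suspension_decomp[OF p vanishing_idealD(1)[OF q]], rule that)
  obtain m where m: "\<And>y. degree (c y) \<le> m" using c(1) unfolding poly_family_def by blast
  have u_poly: "real_polynomial_function (\<lambda>x :: 'a \<times> real \<times> real. fst (snd x) ^ j)" for j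
    by (intro real_polynomial_function_power polynomial_function_imp_real polyfun)
  have coeff: "(\<lambda>x. coeff (c (fst x)) j) \<in> local_ideal (y, u, v) ?A" for j
  proof -
    have "(\<lambda>y. coeff (c y) j) \<in> vanishing_ideal Y"
      unfolding vanishing_ideal_def
      using poly_family_coeff_polynomial[OF c(1)] suspension_decomp_coeff[OF q, of _ N c] c(3) by auto
    then have "(\<lambda>y. coeff (c y) j) \<in> local_ideal (fst (y, u, v)) A" using gen by auto
    moreover have "polynomial_function (fst :: 'a \<times> real \<times> real \<Rightarrow> 'a)"
      by (rule polynomial_function_bounded_linear[OF bounded_linear_fst])
    ultimately have "(\<lambda>x. coeff (c (fst x)) j) \<in> local_ideal (y, u, v) ((\<lambda>q x. q (fst x)) ` A)"
      by (rule local_ideal_pullback)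
    then show ?thesis by (rule local_ideal_trans) (auto intro: local_ideal_base)
  qed
  have "(\<lambda>x. (\<Sum>j\<le>m. fst (snd x) ^ j * coeff (c (fst x)) j) + b x * suspension_equation p x)
      \<in> local_ideal (y, u, v) ?A"
    by (rule local_ideal_add[OF local_ideal_sum[OF finite_atMost local_ideal_mult[OF u_poly coeff]]
        local_ideal_mult[OF c(2) local_ideal_base]]) simp
  moreover have "(\<Sum>j\<le>m. fst (snd x) ^ j * coeff (c (fst x)) j) + b x * suspension_equation p x =
      fst (snd x) ^ N * q x" for x
    using c(3)[of "fst (snd x)" "fst x" "snd (snd x)"] poly_eq_sum_atMost[OF m[of "fst x"]]
    by (simp add: mult.commute)
  ultimately have "(\<lambda>x. fst (snd x) ^ N * q x) \<in> local_ideal (y, u, v) ?A" by simp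
  then show "q \<in> local_ideal (y, u, v) ?A"
    using u by (intro local_ideal_div[OF u_poly[of N] _ vanishing_idealD(1)[OF q]]) simp
qed

text \<open>One equation is added in two new dimensions. It is independent of the generators of Y
  because its derivative in the direction of v is u, which is nonzero, whereas functions from the
  base do not depend on v.\<close>

lemma smooth_suspension_nonzero_u:
  fixes Y :: "'a::euclidean_space set"
  assumes p: "real_polynomial_function p" and sm: "smooth_at Y d y"
    and x: "(y, u, v) \<in> suspension Y p" and u: "u \<noteq> 0"
  shows "smooth_at (suspension Y p) (Suc d) (y, u, v)"
proof -
  obtain k :: nat and F where F: "y \<in> Y" "k + d = DIM('a)" "\<And>i. i < k \<Longrightarrow> F i \<in> vanishing_ideal Y"
    "vanishing_ideal Y \<subseteq> local_ideal y (F ` {..<k})" "independent_differentials y {..<k} F"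
    by (rule smooth_atE[OF sm], rule that)
  define F' where "F' = (\<lambda>i. if i < k then (\<lambda>x. F i (fst x)) else suspension_equation p)"
  have F'_less: "F' i = (\<lambda>x. F i (fst x))" if "i < k" for i using that by (simp add: F'_def)
  have F'_k: "F' k = suspension_equation p" by (simp add: F'_def)
  have Yfst: "fst x \<in> Y" if "x \<in> suspension Y p" for x using that by (cases x) (auto simp: mem_suspension)
  show ?thesis
  proof (rule smooth_atI[where I = "{..k}" and F = F'])
    show "card {..k} + Suc d = DIM('a \<times> real \<times> real)" using F(2) by simp
    show "F' i \<in> vanishing_ideal (suspension Y p)" if "i \<in> {..k}" for i
    proof (cases "i < k")
      case True
      then show ?thesis
        using F(3)[OF True] Yfst real_polynomial_fst unfolding vanishing_ideal_def F'_less[OF True] by auto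
    next
      case False
      then have "i = k" using that by simp
      then show ?thesis using suspension_equation_vanishing[OF p] F'_k by simp
    qed
    have "(\<lambda>q x. q (fst x)) ` F ` {..<k} = F' ` {..<k}"
      unfolding image_image by (rule image_cong) (simp_all add: F'_less)
    moreover have "{..k} = insert k {..<k}" by auto
    ultimately have "insert (suspension_equation p) ((\<lambda>q x. q (fst x)) ` F ` {..<k}) = F' ` {..k}"
      using F'_k by simp
    then show "vanishing_ideal (suspension Y p) \<subseteq> local_ideal (y, u, v) (F' ` {..k})"
      using vanishing_ideal_suspension_subset[OF p u F(4)] by metis
    show "independent_differentials (y, u, v) {..k} F'"
      unfolding independent_differentials_def
    proof (intro allI impI)
      fix c assume c: "\<forall>w. (\<Sum>i\<le>k. c i * frechet_derivative (F' i) (at (y, u, v)) w) = 0"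
      have Fi: "frechet_derivative (F' i) (at (y, u, v)) (w, a, b) = frechet_derivative (F i) (at y) w"
        if "i < k" for i w a b
        unfolding F'_less[OF that]
        using frechet_derivative_fst_comp[OF vanishing_idealD(1)[OF F(3)[OF that]], of "(y, u, v)"] by simp
      have eq: "(\<Sum>i<k. c i * frechet_derivative (F i) (at y) w) +
          c k * (u * b + a * v - frechet_derivative p (at y) w) = 0" for w a b
      proof -
        have "(\<Sum>i\<le>k. c i * frechet_derivative (F' i) (at (y, u, v)) (w, a, b)) =
          (\<Sum>i<k. c i * frechet_derivative (F' i) (at (y, u, v)) (w, a, b)) +
            c k * frechet_derivative (F' k) (at (y, u, v)) (w, a, b)"
          by (simp add: lessThan_Suc_atMost[symmetric])
        also have "\<dots> = (\<Sum>i<k. c i * frechet_derivative (F i) (at y) w) +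
          c k * (u * b + a * v - frechet_derivative p (at y) w)"
          by (simp add: Fi F'_k frechet_derivative_suspension_equation[OF p])
        finally show ?thesis using c by simp
      qed
      have d0: "frechet_derivative q (at y) 0 = 0" if "real_polynomial_function q" for q :: "'a \<Rightarrow> real"
        using linear_0[OF linear_frechet_derivative_polynomial[OF that]] .
      have "(\<Sum>i<k. c i * frechet_derivative (F i) (at y) 0) = 0"
        using d0[OF vanishing_idealD(1)[OF F(3)]] by simp
      then have ck: "c k = 0" using eq[of 0 1 0] u d0[OF p] by simp
      then have "\<forall>i<k. c i = 0"
        using eq F(5) unfolding independent_differentials_def by simp
      then show "\<forall>i\<in>{..k}. c i = 0" using ck by (auto simp: le_less)
    qed
  qed (use x in simp_all)
qed

lemma frechet_derivative_swap_uv: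
  "frechet_derivative swap_uv (at x) = (swap_uv :: 'a::euclidean_space \<times> real \<times> real \<Rightarrow> _)"
proof -
  have "bounded_linear (\<lambda>x :: 'a \<times> real \<times> real. (fst x, snd (snd x), fst (snd x)))"
    by (intro bounded_linear_Pair bounded_linear_fst bounded_linear_compose[OF bounded_linear_fst]
        bounded_linear_compose[OF bounded_linear_snd] bounded_linear_snd)
  then have "bounded_linear (swap_uv :: 'a \<times> real \<times> real \<Rightarrow> _)"
    by (simp add: swap_uv_def case_prod_beta')
  from frechet_derivative_at[OF bounded_linear_imp_has_derivative[OF this]] show ?thesis by metis
qed

lemma vanishing_ideal_swap:
  fixes p :: "'a::euclidean_space \<Rightarrow> real"
  assumes "q \<in> vanishing_ideal (suspension Y p)"
  shows "(\<lambda>x. q (swap_uv x)) \<in> vanishing_ideal (suspension Y p)"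
  using vanishing_idealD[OF assms] real_polynomial_function_comp[OF _ polynomial_function_swap_uv]
  unfolding vanishing_ideal_def by auto

lemma smooth_at_swap:
  assumes "smooth_at (suspension Y p) d (y, u, v)"
  shows "smooth_at (suspension Y p) d (y, v, u)"
proof -
  let ?X = "suspension Y p"
  obtain k :: nat and F where F: "(y, u, v) \<in> ?X" "k + d = DIM('a \<times> real \<times> real)"
    "\<And>i. i < k \<Longrightarrow> F i \<in> vanishing_ideal ?X"
    "vanishing_ideal ?X \<subseteq> local_ideal (y, u, v) (F ` {..<k})" "independent_differentials (y, u, v) {..<k} F"
    by (rule smooth_atE[OF assms], rule that)
  show ?thesis
  proof (rule smooth_atI[where I = "{..<k}" and F = "\<lambda>i x. F i (swap_uv x)"])
    show "(y, v, u) \<in> ?X" using F(1) by (simp add: mem_suspension mult.commute)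
    show "(\<lambda>x. F i (swap_uv x)) \<in> vanishing_ideal ?X" if "i \<in> {..<k}" for i
      using vanishing_ideal_swap[OF F(3)] that by blast
    show "vanishing_ideal ?X \<subseteq> local_ideal (y, v, u) ((\<lambda>i x. F i (swap_uv x)) ` {..<k})"
    proof
      fix q assume "q \<in> vanishing_ideal ?X"
      then have "(\<lambda>x. q (swap_uv x)) \<in> local_ideal (swap_uv (y, v, u)) (F ` {..<k})"
        using F(4) vanishing_ideal_swap by fastforce
      from local_ideal_pullback[OF this polynomial_function_swap_uv]
      show "q \<in> local_ideal (y, v, u) ((\<lambda>i x. F i (swap_uv x)) ` {..<k})"
        by (simp add: image_image)
    qed
    show "independent_differentials (y, v, u) {..<k} (\<lambda>i x. F i (swap_uv x))"
      unfolding independent_differentials_def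
    proof (intro allI impI)
      fix c assume c: "\<forall>w. (\<Sum>i<k. c i * frechet_derivative (\<lambda>x. F i (swap_uv x)) (at (y, v, u)) w) = 0"
      have "frechet_derivative (\<lambda>x. F i (swap_uv x)) (at (y, v, u)) (swap_uv w) =
          frechet_derivative (F i) (at (y, u, v)) w" if "i < k" for i w
        using frechet_derivative_real_comp[OF polynomial_function_swap_uv vanishing_idealD(1)[OF F(3)[OF that]]]
        by (simp add: frechet_derivative_swap_uv)
      then have "(\<Sum>i<k. c i * frechet_derivative (F i) (at (y, u, v)) w) =
          (\<Sum>i<k. c i * frechet_derivative (\<lambda>x. F i (swap_uv x)) (at (y, v, u)) (swap_uv w))" for w
        by simp
      then show "\<forall>i\<in>{..<k}. c i = 0" using c F(5) unfolding independent_differentials_def by simp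
    qed
  qed (use F(2) in simp_all)
qed

lemma smooth_suspension:
  assumes p: "real_polynomial_function p" and sm: "smooth_at Y d y"
    and x: "(y, u, v) \<in> suspension Y p" and uv: "u \<noteq> 0 \<or> v \<noteq> 0"
  shows "smooth_at (suspension Y p) (Suc d) (y, u, v)"
proof (cases "u = 0")
  case True
  have "(y, v, u) \<in> suspension Y p" using x by (simp add: mem_suspension mult.commute)
  then show ?thesis
    using smooth_suspension_nonzero_u[OF p sm] smooth_at_swap uv True by blast
qed (use smooth_suspension_nonzero_u[OF p sm x] in blast)

text \<open>
  For the converse, one of the local generators at \<open>(y, u, v)\<close> is exchanged for the equation
  \<open>u v - p\<close>, which vanishes on the section \<open>z \<mapsto> (z, u, p z / u)\<close>; the others restrict to
  generators of the ideal of \<open>Y\<close>.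
\<close>

lemma smooth_of_suspension_nonzero_u:
  fixes Y :: "'a::euclidean_space set"
  assumes p: "real_polynomial_function p" and sm: "smooth_at (suspension Y p) d (y, u, v)" and u: "u \<noteq> 0"
  shows "y \<in> smooth_locus Y"
proof -
  let ?X = "suspension Y p" and ?x = "(y, u, v)"
  let ?D = "\<lambda>q. frechet_derivative q (at (y, u, v))"
  let ?G = "suspension_equation p"
  obtain k :: nat and F where F: "?x \<in> ?X" "k + d = DIM('a \<times> real \<times> real)"
    "\<And>i. i < k \<Longrightarrow> F i \<in> vanishing_ideal ?X"
    "vanishing_ideal ?X \<subseteq> local_ideal ?x (F ` {..<k})" "independent_differentials ?x {..<k} F"
    by (rule smooth_atE[OF sm], rule that)
  have y: "y \<in> Y" and uv: "u * v = p y" using F(1) by (simp_all add: mem_suspension)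
  have Fpoly: "real_polynomial_function (F i)" if "i < k" for i using vanishing_idealD(1)[OF F(3)[OF that]] .
  obtain h c where h: "real_polynomial_function h" "h ?x \<noteq> 0" "\<And>i. i \<in> {..<k} \<Longrightarrow> real_polynomial_function (c i)"
    "\<And>z. h z * ?G z = (\<Sum>i\<in>{..<k}. c i z * F i z)"
    by (rule local_ideal_repr[OF subsetD[OF F(4) suspension_equation_vanishing[OF p]] finite_lessThan], rule that)
  have dG: "h ?x * ?D ?G w = (\<Sum>i\<in>{..<k}. c i ?x * ?D (F i) w)" for w
    by (rule frechet_derivative_repr)
      (use h F(1,3) suspension_equation_polynomial[OF p] uv in \<open>auto simp: vanishing_ideal_def\<close>)
  have dG': "?D ?G (w, a, b) = u * b + a * v - frechet_derivative p (at y) w" for w a b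
    by (rule frechet_derivative_suspension_equation[OF p])
  have dp0: "frechet_derivative p (at y) 0 = 0"
    by (rule linear_0[OF linear_frechet_derivative_polynomial[OF p]])
  \<comment> \<open>The v derivative of the equation is nonzero, so the equation is, locally, a
    combination of the generators with some coefficient invertible at the point. The generator
    belonging to it is the one to be exchanged.\<close>
  obtain i0 where i0: "i0 < k" "c i0 ?x \<noteq> 0"
  proof -
    have "(\<Sum>i\<in>{..<k}. c i ?x * ?D (F i) (0, 0, 1)) \<noteq> 0"
      unfolding dG[symmetric] dG' using h(2) u dp0 by simp
    then obtain i where "i \<in> {..<k}" "c i ?x * ?D (F i) (0, 0, 1) \<noteq> 0"
      by (meson sum.neutral)
    then show thesis using that by simp
  qed
  define K where "K = {..<k} - {i0}"
  define \<sigma> where "\<sigma> = (\<lambda>z. (z, u, p z / u))"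
  have \<sigma>_poly: "polynomial_function \<sigma>"
    unfolding \<sigma>_def
    using real_polynomial_function_imp[OF real_polynomial_function_divide[OF p]] by (intro polyfun)
  have \<sigma>y: "\<sigma> y = ?x" unfolding \<sigma>_def using u uv by (simp add: field_simps)
  have \<sigma>X: "\<sigma> z \<in> ?X" if "z \<in> Y" for z unfolding \<sigma>_def mem_suspension using u that by simp
  have G\<sigma>: "?G (\<sigma> z) = 0" for z unfolding \<sigma>_def using u by simp
  define F' where "F' = (\<lambda>i z. F i (\<sigma> z))"
  have F'_van: "F' i \<in> vanishing_ideal Y" if "i < k" for i
    using vanishing_idealD[OF F(3)[OF that]] \<sigma>X real_polynomial_function_comp[OF _ \<sigma>_poly]
    unfolding F'_def vanishing_ideal_def by auto
  have Keq: "{..<k} = insert i0 K" "i0 \<notin> K" "finite K" unfolding K_def using i0(1) by auto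
  \<comment> \<open>Pulled back to the section, the combination representing the equation becomes
    zero, and can be solved for the exchanged generator.\<close>
  have i0_gen: "F' i0 \<in> local_ideal y (F' ` K)"
  proof (rule local_ideal_div[where h = "\<lambda>z. c i0 (\<sigma> z)"])
    show "real_polynomial_function (\<lambda>z. c i0 (\<sigma> z))"
      using real_polynomial_function_comp[OF h(3) \<sigma>_poly] i0(1) by simp
    show "c i0 (\<sigma> y) \<noteq> 0" using i0(2) \<sigma>y by simp
    show "real_polynomial_function (F' i0)" using vanishing_idealD(1)[OF F'_van[OF i0(1)]] .
    have "(\<Sum>i\<in>K. c i (\<sigma> z) * F' i z) + c i0 (\<sigma> z) * F' i0 z = 0" for z
      using h(4)[of "\<sigma> z"] G\<sigma>[of z] Keq unfolding F'_def by simp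
    then have "(\<lambda>z. c i0 (\<sigma> z) * F' i0 z) = (\<lambda>z. \<Sum>i\<in>K. - c i (\<sigma> z) * F' i z)"
      by (intro ext) (simp add: sum_negf eq_neg_iff_add_eq_0 add.commute)
    moreover have "(\<lambda>z. \<Sum>i\<in>K. - c i (\<sigma> z) * F' i z) \<in> local_ideal y (F' ` K)"
    proof (rule local_ideal_sum[OF Keq(3)])
      fix i assume i: "i \<in> K"
      have "real_polynomial_function (\<lambda>z. - c i (\<sigma> z))"
        by (intro real_polynomial_function_minus real_polynomial_function_comp[OF h(3) \<sigma>_poly])
          (use i Keq(1) in blast)
      then show "(\<lambda>z. - c i (\<sigma> z) * F' i z) \<in> local_ideal y (F' ` K)"
        by (rule local_ideal_mult[OF _ local_ideal_base]) (use i in blast)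
    qed
    ultimately show "(\<lambda>z. c i0 (\<sigma> z) * F' i0 z) \<in> local_ideal y (F' ` K)" by simp
  qed
  have gen: "vanishing_ideal Y \<subseteq> local_ideal y (F' ` K)"
  proof
    fix q assume q: "q \<in> vanishing_ideal Y"
    have "(\<lambda>x. q (fst x)) \<in> vanishing_ideal ?X"
      using vanishing_idealD[OF q] real_polynomial_fst unfolding vanishing_ideal_def
      by (auto simp: mem_suspension)
    then have "(\<lambda>x. q (fst x)) \<in> local_ideal (\<sigma> y) (F ` {..<k})" unfolding \<sigma>y using F(4) by blast
    from local_ideal_pullback[OF this \<sigma>_poly]
    have "q \<in> local_ideal y (F' ` {..<k})"
      by (simp add: \<sigma>_def F'_def image_image)
    then show "q \<in> local_ideal y (F' ` K)"
      by (rule local_ideal_trans) (use i0_gen in \<open>auto simp: Keq(1) intro: local_ideal_base\<close>)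
  qed
  have d\<sigma>: "frechet_derivative \<sigma> (at y) w = (w, 0, frechet_derivative p (at y) w / u)" for w
  proof -
    have "(\<sigma> has_derivative (\<lambda>w. (w, 0, frechet_derivative p (at y) w / u))) (at y)"
      unfolding \<sigma>_def using u
      by (auto intro!: derivative_eq_intros has_derivative_real_polynomial_function[OF p])
    from frechet_derivative_at[OF this] show ?thesis by metis
  qed
  \<comment> \<open>The velocity of the hyperbola u v = \<open>p y\<close> in the fibre over
    y.\<close>
  have \<tau>: "(0, 1, - v / u) \<in> tangent_space ?X ?x"
  proof -
    have "((\<lambda>t. (y, u + t, p y / (u + t))) has_vector_derivative (0, 1, - v / u)) (at 0)"
      using u uv[symmetric]
      by (auto intro!: derivative_eq_intros has_vector_derivative_Pair simp: has_real_derivative_iff_has_vector_derivative[symmetric])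
    moreover have "\<forall>\<^sub>F t in nhds 0. u + t \<noteq> 0"
    proof -
      have "((\<lambda>t. u + t) \<longlongrightarrow> u + 0) (nhds 0)" by (intro tendsto_intros filterlim_ident)
      then show ?thesis using u tendsto_imp_eventually_ne by fastforce
    qed
    then have "\<forall>\<^sub>F t in nhds 0. (y, u + t, p y / (u + t)) \<in> ?X"
      by eventually_elim (use y in \<open>simp add: mem_suspension\<close>)
    ultimately have "(0, 1, - v / u) \<in> tangent_space ?X (y, u + 0, p y / (u + 0))"
      by (rule tangent_curve)
    moreover have "(y, u + 0, p y / (u + 0)) = ?x" using u uv[symmetric] by simp
    ultimately show ?thesis by metis
  qed
  have indep: "independent_differentials y K F'"
    unfolding independent_differentials_def
  proof (intro allI impI)
    fix e assume e: "\<forall>w. (\<Sum>i\<in>K. e i * frechet_derivative (F' i) (at y) w) = 0"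
    define l where "l = (\<lambda>W. \<Sum>i\<in>K. e i * ?D (F i) W)"
    have lin: "linear l"
    proof (rule linearI)
      have D_lin: "linear (?D (F i))" if "i \<in> K" for i
        using linear_frechet_derivative_polynomial[OF Fpoly] that Keq(1) by blast
      show "l (W + W') = l W + l W'" for W W'
        unfolding l_def sum.distrib[symmetric]
        by (intro sum.cong refl) (simp add: linear_add[OF D_lin] algebra_simps)
      show "l (t *\<^sub>R W) = t *\<^sub>R l W" for t W
        unfolding l_def scaleR_sum_right
        by (intro sum.cong refl) (simp add: linear_scale[OF D_lin])
    qed
    have l\<sigma>: "l (w, 0, frechet_derivative p (at y) w / u) = 0" for w
    proof -
      have "frechet_derivative (F' i) (at y) w = ?D (F i) (w, 0, frechet_derivative p (at y) w / u)"
        if "i \<in> K" for i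
      proof -
        have "i < k" using that Keq(1) by blast
        from frechet_derivative_real_comp[OF \<sigma>_poly Fpoly[OF this], of y w]
        show ?thesis unfolding F'_def d\<sigma> \<sigma>y .
      qed
      then have "l (w, 0, frechet_derivative p (at y) w / u) =
          (\<Sum>i\<in>K. e i * frechet_derivative (F' i) (at y) w)"
        unfolding l_def by (intro sum.cong refl) metis
      then show ?thesis using e by simp
    qed
    have l\<tau>: "l (0, 1, - v / u) = 0"
      unfolding l_def using tangent_spaceD[OF \<tau> F(3)] Keq(1) by (intro sum.neutral) auto
    define \<mu> where "\<mu> = l (0, 0, 1) / u"
    \<comment> \<open>The ambient space is spanned by the tangent vectors of the section, the fibre
      direction and (0, 0, 1). On the first two kinds both functionals vanish, so \<mu> is found by
      comparing them at (0, 0, 1).\<close>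
    have l_eq: "l W = \<mu> * ?D ?G W" for W
    proof (cases W)
      case (fields w a b)
      define b' where "b' = b - frechet_derivative p (at y) w / u + a * v / u"
      have "W = (w, 0, frechet_derivative p (at y) w / u) + a *\<^sub>R (0, 1, - v / u) + b' *\<^sub>R (0, 0, 1)"
        unfolding fields b'_def by simp
      then have "l W = b' * l (0, 0, 1)"
        by (simp only: linear_add[OF lin] linear_scale[OF lin] l\<sigma> l\<tau>) simp
      moreover have "u * b' = ?D ?G W"
        unfolding fields dG' b'_def using u by (simp add: field_simps)
      ultimately show ?thesis unfolding \<mu>_def using u by (simp add: field_simps)
    qed
    \<comment> \<open>These are the coefficients of h (l - \<mu> dG) = 0, with G the equation, in
      terms of the differentials of all generators. The entry at \<open>i0\<close> is -\<mu> times a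
      nonzero number, which forces \<mu> = 0.\<close>
    define e' where "e' = (\<lambda>i. (if i = i0 then 0 else h ?x * e i) - \<mu> * c i ?x)"
    have "(\<Sum>i\<in>{..<k}. e' i * ?D (F i) W) = 0" for W
    proof -
      have "(\<Sum>i\<in>{..<k}. e' i * ?D (F i) W) =
          (\<Sum>i\<in>{..<k}. (if i = i0 then 0 else h ?x * e i) * ?D (F i) W) - \<mu> * (\<Sum>i\<in>{..<k}. c i ?x * ?D (F i) W)"
        unfolding e'_def by (simp add: sum_subtractf sum_distrib_left algebra_simps)
      also have "(\<Sum>i\<in>{..<k}. (if i = i0 then 0 else h ?x * e i) * ?D (F i) W) =
          (\<Sum>i\<in>K. h ?x * e i * ?D (F i) W)"
        unfolding Keq(1) using Keq(2,3) by (auto intro!: sum.cong)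
      also have "\<dots> = h ?x * l W" unfolding l_def by (simp add: sum_distrib_left mult.assoc)
      finally show ?thesis unfolding dG[symmetric] l_eq by simp
    qed
    then have e': "\<forall>i\<in>{..<k}. e' i = 0"
      using F(5) unfolding independent_differentials_def by blast
    have "\<mu> = 0" using bspec[OF e', of i0] i0 unfolding e'_def by simp
    show "\<forall>i\<in>K. e i = 0"
    proof
      fix i assume i: "i \<in> K"
      then have "e' i = 0" "i \<noteq> i0" using e' Keq(1,2) by auto
      then show "e i = 0" using \<open>\<mu> = 0\<close> h(2) unfolding e'_def by simp
    qed
  qed
  have F'_poly: "real_polynomial_function (F' i)" if "i \<in> K" for i
    using vanishing_idealD(1)[OF F'_van] that Keq(1) by blast
  have "card K \<le> DIM('a)" using dim_kernel_differentials[OF Keq(3) F'_poly indep] by linarith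
  then have "smooth_at Y (DIM('a) - card K) y"
    by (intro smooth_atI[where I = K and F = F'] y Keq(3) gen indep) (use F'_van Keq(1) in auto)
  then show ?thesis unfolding smooth_locus_def by blast
qed

text \<open>Generators for Y are the coefficients of the reduced forms of the generators for X. For
  q in the ideal of Y, a representation h q = \<Sum> a i F i is multiplied by powers of u until it
  becomes an identity of polynomials in u. One coefficient of the reduced form of h is nonzero at y;
  comparing that coefficient solves for q in the local ring at y.\<close>

lemma local_ideal_at_origin_finitely_generated:
  fixes Y :: "'a::euclidean_space set"
  assumes p: "real_polynomial_function p" and py: "p y = 0"
    and F: "\<And>i. i < (k :: nat) \<Longrightarrow> F i \<in> vanishing_ideal (suspension Y p)"
    and gen: "vanishing_ideal (suspension Y p) \<subseteq> local_ideal (y, 0, 0) (F ` {..<k})"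
  obtains Q where "finite Q" "Q \<subseteq> vanishing_ideal Y" "vanishing_ideal Y \<subseteq> local_ideal y Q"
proof -
  have decomp: "\<exists>N c. poly_family c \<and> (\<forall>y u v. u * v = p y \<longrightarrow> u ^ N * q (y, u, v) = poly (c y) u)"
    if q: "real_polynomial_function q" for q
  proof -
    obtain N c b where "poly_family c" "real_polynomial_function b"
      "\<And>y u v. u ^ N * q (y, u, v) = poly (c y) u + b (y, u, v) * suspension_equation p (y, u, v)"
      by (rule suspension_decomp[OF p q], rule that)
    then show ?thesis by (intro exI[of _ N] exI[of _ c]) simp
  qed
  have "\<forall>i. \<exists>N c. i < k \<longrightarrow> poly_family c \<and> (\<forall>y u v. u * v = p y \<longrightarrow> u ^ N * F i (y, u, v) = poly (c y) u)"
    using decomp[OF vanishing_idealD(1)[OF F]] by blast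
  then obtain N c where Nc: "\<And>i. i < k \<Longrightarrow> poly_family (c i)"
    "\<And>i y u v. i < k \<Longrightarrow> u * v = p y \<Longrightarrow> u ^ N i * F i (y, u, v) = poly (c i y) u"
    by metis
  have "\<forall>i. \<exists>m. i < k \<longrightarrow> (\<forall>y. degree (c i y) \<le> m)" using Nc(1) unfolding poly_family_def by blast
  then obtain m where m: "\<And>i y. i < k \<Longrightarrow> degree (c i y) \<le> m i" by metis
  define Q where "Q = (\<lambda>(i, l) y. coeff (c i y) l) ` (SIGMA i:{..<k}. {..m i})"
  have "finite Q" unfolding Q_def by (intro finite_imageI finite_SigmaI) auto
  moreover have "Q \<subseteq> vanishing_ideal Y"
  proof
    fix q assume "q \<in> Q"
    then obtain i l where q: "i < k" "q = (\<lambda>y. coeff (c i y) l)" unfolding Q_def by auto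
    have "c i z = 0" if "z \<in> Y" for z
      using suspension_decomp_coeff[OF F[OF q(1)] that, of "N i" "c i"] Nc(2)[OF q(1)] by blast
    then show "q \<in> vanishing_ideal Y"
      unfolding vanishing_ideal_def q(2) using poly_family_coeff_polynomial[OF Nc(1)[OF q(1)]] by auto
  qed
  moreover have "vanishing_ideal Y \<subseteq> local_ideal y Q"
  proof
    fix q assume q: "q \<in> vanishing_ideal Y"
    have coeff_mem: "(\<lambda>z. coeff (c i z) l) \<in> local_ideal y Q" if i: "i < k" for i l
    proof (cases "l \<le> m i")
      case True
      then show ?thesis using i unfolding Q_def by (intro local_ideal_base) force
    next
      case False
      then have "(\<lambda>z. coeff (c i z) l) = (\<lambda>z. 0)"
        using m[OF i] by (intro ext coeff_eq_0) (meson le_less_trans not_le)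
      then show ?thesis using local_ideal_zero by simp
    qed
    have "(\<lambda>x. q (fst x)) \<in> vanishing_ideal (suspension Y p)"
      using vanishing_idealD[OF q] real_polynomial_fst unfolding vanishing_ideal_def
      by (auto simp: mem_suspension)
    then have q_mem: "(\<lambda>x. q (fst x)) \<in> local_ideal (y, 0, 0) (F ` {..<k})" using gen by blast
    obtain h a where h: "real_polynomial_function h" "h (y, 0, 0) \<noteq> 0"
      "\<And>i. i \<in> {..<k} \<Longrightarrow> real_polynomial_function (a i)"
      "\<And>z. h z * q (fst z) = (\<Sum>i\<in>{..<k}. a i z * F i z)"
      by (rule local_ideal_repr[OF q_mem finite_lessThan], rule that)
    obtain N' \<eta> where \<eta>: "poly_family \<eta>" "\<And>y u v. u * v = p y \<Longrightarrow> u ^ N' * h (y, u, v) = poly (\<eta> y) u"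
      using decomp[OF h(1)] by blast
    have "\<forall>i. \<exists>M \<alpha>. i < k \<longrightarrow> poly_family \<alpha> \<and> (\<forall>y u v. u * v = p y \<longrightarrow> u ^ M * a i (y, u, v) = poly (\<alpha> y) u)"
      using decomp[OF h(3)] by blast
    then obtain M \<alpha> where M: "\<And>i. i < k \<Longrightarrow> poly_family (\<alpha> i)"
      "\<And>i y u v. i < k \<Longrightarrow> u * v = p y \<Longrightarrow> u ^ M i * a i (y, u, v) = poly (\<alpha> i y) u"
      by metis
    \<comment> \<open>\<open>S\<close> and \<open>T i\<close> fill up the exponents so that every
      term carries the same factor u^(N' + S).\<close>
    define S where "S = (\<Sum>i<k. N i + M i)"
    define T where "T = (\<lambda>i. N' + (S - (N i + M i)))"
    have T: "T i + (M i + N i) = N' + S" if "i < k" for i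
    proof -
      have "N i + M i \<le> S" unfolding S_def using that by (intro member_le_sum) auto
      then show ?thesis unfolding T_def by simp
    qed
    \<comment> \<open>This holds for every z of the ambient space, since (z, u, p z / u) satisfies
      the equation also off Y. Membership in a local ideal needs such a global identity.\<close>
    have eq: "monom 1 S * smult (q z) (\<eta> z) = (\<Sum>i<k. monom 1 (T i) * (\<alpha> i z * c i z))" for z
    proof (rule poly_eqI_infinite[OF infinite_nonzero_real])
      fix u :: real assume "u \<in> {u. u \<noteq> 0}"
      then have uv: "u * (p z / u) = p z" by simp
      let ?x = "(z, u, p z / u)"
      have "poly (monom 1 S * smult (q z) (\<eta> z)) u = u ^ (N' + S) * (h ?x * q (fst ?x))"
        using \<eta>(2)[OF uv] by (simp add: poly_monom power_add)
      also have "\<dots> = (\<Sum>i<k. u ^ (N' + S) * (a i ?x * F i ?x))"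
        unfolding h(4) by (simp add: sum_distrib_left)
      also have "\<dots> = (\<Sum>i<k. u ^ T i * ((u ^ M i * a i ?x) * (u ^ N i * F i ?x)))"
        by (intro sum.cong refl) (simp add: T[symmetric] power_add)
      also have "\<dots> = poly (\<Sum>i<k. monom 1 (T i) * (\<alpha> i z * c i z)) u"
        unfolding poly_sum using M(2)[OF _ uv] Nc(2)[OF _ uv]
        by (intro sum.cong refl) (simp add: poly_monom)
      finally show "poly (monom 1 S * smult (q z) (\<eta> z)) u = poly (\<Sum>i<k. monom 1 (T i) * (\<alpha> i z * c i z)) u" .
    qed
    obtain r where r: "\<And>u. h (y, u, 0) = poly r u"
    proof -
      have "polynomial_function (\<lambda>z :: real \<times> 'a. (snd z, fst z, 0 :: real))" by (intro polyfun)
      from real_polynomial_function_comp[OF h(1) this]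
      obtain c' where "\<And>t z. h (z, t, 0) = poly (c' z) t"
        using that by (auto elim: polynomial_function_poly_family)
      then show thesis using that by blast
    qed
    \<comment> \<open>As \<open>p y\<close> = 0, the u-axis over y satisfies the equation. There
      \<open>h\<close> restricts to \<open>r\<close>, and r(0) = h (y, 0, 0) is nonzero; hence the
      reduced form \<eta> is nonzero at y.\<close>
    have "monom 1 N' * r = \<eta> y"
    proof (rule poly_eqI_infinite[OF infinite_nonzero_real])
      show "poly (monom 1 N' * r) u = poly (\<eta> y) u" for u
        using \<eta>(2)[of u 0 y] py r by (simp add: poly_monom)
    qed
    moreover have "r \<noteq> 0" using r[of 0] h(2) by auto
    ultimately have "\<eta> y \<noteq> 0" by (metis monom_eq_0_iff mult_eq_0_iff zero_neq_one)
    then obtain n where n: "coeff (\<eta> y) n \<noteq> 0" by (metis leading_coeff_0_iff)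
    have "coeff (\<eta> z) n * q z = (\<Sum>i<k. if T i \<le> S + n then
        \<Sum>j\<le>S + n - T i. coeff (\<alpha> i z) j * coeff (c i z) (S + n - T i - j) else 0)" for z
    proof -
      have "coeff (\<eta> z) n * q z = coeff (monom 1 S * smult (q z) (\<eta> z)) (S + n)"
        by (simp add: coeff_monom_mult)
      also have "\<dots> = (\<Sum>i<k. if T i \<le> S + n then
        \<Sum>j\<le>S + n - T i. coeff (\<alpha> i z) j * coeff (c i z) (S + n - T i - j) else 0)"
        unfolding eq coeff_sum unfolding coeff_monom_mult unfolding coeff_mult
        by (intro sum.cong refl) (simp add: not_le)
      finally show ?thesis .
    qed
    moreover have "(\<lambda>z. \<Sum>i<k. if T i \<le> S + n then
        \<Sum>j\<le>S + n - T i. coeff (\<alpha> i z) j * coeff (c i z) (S + n - T i - j) else 0) \<in> local_ideal y Q"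
    proof (rule local_ideal_sum[OF finite_lessThan])
      fix i assume "i \<in> {..<k}"
      then have i: "i < k" by simp
      have "(\<lambda>z. \<Sum>j\<le>S + n - T i. coeff (\<alpha> i z) j * coeff (c i z) (S + n - T i - j)) \<in> local_ideal y Q"
        by (rule local_ideal_sum[OF finite_atMost local_ideal_mult[OF
              poly_family_coeff_polynomial[OF M(1)[OF i]] coeff_mem[OF i]]])
      then show "(\<lambda>z. if T i \<le> S + n then
        \<Sum>j\<le>S + n - T i. coeff (\<alpha> i z) j * coeff (c i z) (S + n - T i - j) else 0) \<in> local_ideal y Q"
        using local_ideal_zero by (cases "T i \<le> S + n") simp_all
    qed
    ultimately have "(\<lambda>z. coeff (\<eta> z) n * q z) \<in> local_ideal y Q" by simp
    then show "q \<in> local_ideal y Q"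
      by (rule local_ideal_div[OF poly_family_coeff_polynomial[OF \<eta>(1)] n vanishing_idealD(1)[OF q]])
  qed
  ultimately show thesis by (rule that)
qed

text \<open>The same generators are shown to work nearby on the u-axis. Independence of their
  differentials is an open condition. For generation it suffices to reach the finite set
  \<open>E\<close>, which generates wherever u is nonzero; its elements are combinations of the
  \<open>F i\<close> with denominators \<open>h e\<close> that do not vanish near (y, 0, 0).
  Finiteness of \<open>E\<close> gives one neighbourhood for all denominators.\<close>

lemma smooth_suspension_near_origin:
  fixes Y :: "'a::euclidean_space set"
  assumes p: "real_polynomial_function p" and sm: "smooth_at (suspension Y p) d (y, 0, 0)"
  obtains u where "u \<noteq> 0" "smooth_at (suspension Y p) d (y, u, 0)"
proof -
  let ?X = "suspension Y p"
  obtain k :: nat and F where F: "(y, 0, 0) \<in> ?X" "k + d = DIM('a \<times> real \<times> real)"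
    "\<And>i. i < k \<Longrightarrow> F i \<in> vanishing_ideal ?X"
    "vanishing_ideal ?X \<subseteq> local_ideal (y, 0, 0) (F ` {..<k})" "independent_differentials (y, 0, 0) {..<k} F"
    by (rule smooth_atE[OF sm], rule that)
  have y: "y \<in> Y" and py: "p y = 0" using F(1) by (auto simp: mem_suspension)
  obtain Q where Q: "finite Q" "Q \<subseteq> vanishing_ideal Y" "vanishing_ideal Y \<subseteq> local_ideal y Q"
    by (rule local_ideal_at_origin_finitely_generated[OF p py F(3,4)], assumption, rule that)
  define E where "E = insert (suspension_equation p) ((\<lambda>q x. q (fst x)) ` Q)"
  have E_fin: "finite E" unfolding E_def using Q(1) by simp
  have E_van: "e \<in> vanishing_ideal ?X" if "e \<in> E" for e
  proof (cases "e = suspension_equation p")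
    case False
    then have "e \<in> (\<lambda>q x. q (fst x)) ` Q" using that unfolding E_def by blast
    then obtain q where q: "q \<in> vanishing_ideal Y" "e = (\<lambda>x. q (fst x))"
      using Q(2) by blast
    show ?thesis
      unfolding vanishing_ideal_def q(2)
      using real_polynomial_fst[OF vanishing_idealD(1)[OF q(1)]] vanishing_idealD(2)[OF q(1)]
      by (auto simp: mem_suspension)
  qed (simp add: suspension_equation_vanishing[OF p])
  have "\<exists>h. real_polynomial_function h \<and> h (y, 0, 0) \<noteq> 0 \<and>
      (\<forall>x. (\<lambda>z. h z * e z) \<in> local_ideal x (F ` {..<k}))" if e: "e \<in> E" for e
  proof -
    obtain h a where h: "real_polynomial_function h" "h (y, 0, 0) \<noteq> 0"
      "\<And>i. i \<in> {..<k} \<Longrightarrow> real_polynomial_function (a i)" "\<And>z. h z * e z = (\<Sum>i\<in>{..<k}. a i z * F i z)"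
      by (rule local_ideal_repr[OF subsetD[OF F(4) E_van[OF e]] finite_lessThan], rule that)
    have "(\<lambda>z. \<Sum>i\<in>{..<k}. a i z * F i z) \<in> local_ideal x (F ` {..<k})" for x
      by (rule local_ideal_sum[OF finite_lessThan local_ideal_mult[OF h(3) local_ideal_base]]) auto
    then show ?thesis using h(1,2) unfolding h(4)[symmetric] by blast
  qed
  then obtain h where h: "\<And>e. e \<in> E \<Longrightarrow> real_polynomial_function (h e)" "\<And>e. e \<in> E \<Longrightarrow> h e (y, 0, 0) \<noteq> 0"
    "\<And>e x. e \<in> E \<Longrightarrow> (\<lambda>z. h e z * e z) \<in> local_ideal x (F ` {..<k})"
    by metis
  have "\<forall>\<^sub>F x in nhds (y, 0, 0). h e x \<noteq> 0" if "e \<in> E" for e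
  proof -
    have "isCont (h e) (y, 0, 0)" using continuous_real_polymonial_function[OF h(1)[OF that]] .
    then have "(h e \<longlongrightarrow> h e (y, 0, 0)) (nhds (y, 0, 0))" by (simp add: continuous_at tendsto_nhds_iff)
    then show ?thesis using h(2)[OF that] tendsto_imp_eventually_ne by blast
  qed
  then have "\<forall>\<^sub>F x in nhds (y, 0, 0). (\<forall>e\<in>E. h e x \<noteq> 0) \<and> independent_differentials x {..<k} F"
    using eventually_independent_differentials[OF finite_lessThan _ F(5)] vanishing_idealD(1)[OF F(3)] E_fin
    by (intro eventually_conj eventually_ball_finite) auto
  moreover have "filterlim (\<lambda>t :: real. (y, t, 0 :: real)) (nhds (y, 0, 0)) (at 0)"
    by (intro tendsto_Pair tendsto_const tendsto_ident_at)
  ultimately have "\<forall>\<^sub>F t :: real in at 0. (\<forall>e\<in>E. h e (y, t, 0) \<noteq> 0) \<and>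
      independent_differentials (y, t, 0) {..<k} F"
    unfolding filterlim_iff by blast
  moreover have "\<forall>\<^sub>F t :: real in at 0. t \<noteq> 0" by (simp add: eventually_at_filter)
  ultimately have "\<forall>\<^sub>F t :: real in at 0. t \<noteq> 0 \<and> (\<forall>e\<in>E. h e (y, t, 0) \<noteq> 0) \<and>
      independent_differentials (y, t, 0) {..<k} F"
    by eventually_elim simp
  then obtain u :: real where u: "u \<noteq> 0" "\<forall>e\<in>E. h e (y, u, 0) \<noteq> 0"
      "independent_differentials (y, u, 0) {..<k} F"
    using eventually_happens[of _ "at (0::real)"] trivial_limit_at by blast
  have E_gen: "E \<subseteq> local_ideal (y, u, 0) (F ` {..<k})"
  proof
    fix e assume e: "e \<in> E"
    show "e \<in> local_ideal (y, u, 0) (F ` {..<k})"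
      using u(2) e by (intro local_ideal_div[OF h(1)[OF e] _ vanishing_idealD(1)[OF E_van[OF e]] h(3)[OF e]]) simp
  qed
  have gen: "vanishing_ideal ?X \<subseteq> local_ideal (y, u, 0) (F ` {..<k})"
  proof
    fix q assume "q \<in> vanishing_ideal ?X"
    then have "q \<in> local_ideal (y, u, 0) E"
      using vanishing_ideal_suspension_subset[OF p u(1) Q(3)] unfolding E_def by blast
    then show "q \<in> local_ideal (y, u, 0) (F ` {..<k})" by (rule local_ideal_trans[OF _ E_gen])
  qed
  have "smooth_at ?X d (y, u, 0)"
    by (rule smooth_atI[where I = "{..<k}" and F = F])
      (use y py F(2,3) gen u(3) in \<open>simp_all add: mem_suspension\<close>)
  then show thesis using that u(1) by blast
qed

lemma smooth_of_suspension:
  assumes p: "real_polynomial_function p" and "(y, u, v) \<in> smooth_locus (suspension Y p)"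
  shows "y \<in> smooth_locus Y"
proof -
  obtain d where d: "smooth_at (suspension Y p) d (y, u, v)"
    using assms(2) unfolding smooth_locus_def by blast
  consider "u \<noteq> 0" | "v \<noteq> 0" | "u = 0" "v = 0" by blast
  then show ?thesis
  proof cases
    case 1
    then show ?thesis using smooth_of_suspension_nonzero_u[OF p d] by blast
  next
    case 2
    then show ?thesis using smooth_of_suspension_nonzero_u[OF p smooth_at_swap[OF d]] by blast
  next
    case 3
    obtain u' where "u' \<noteq> 0" "smooth_at (suspension Y p) d (y, u', 0)"
      by (rule smooth_suspension_near_origin[OF p d[unfolded 3]], rule that)
    then show ?thesis using smooth_of_suspension_nonzero_u[OF p] by blast
  qed
qed

lemma flow_has_real_derivative:
  assumes M: "poly_flow Y M" and p: "real_polynomial_function p" and y: "y \<in> Y"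
  shows "((\<lambda>s. p (M (s, y))) has_real_derivative
    frechet_derivative p (at y) (vector_derivative (\<lambda>t. M (t, y)) (at 0))) (at 0)"
  using has_vector_derivative_polynomial_comp[OF poly_curve_has_vector_derivative[OF flow_curve[OF M]]
      real_polynomial_function_imp[OF p], of y 0] poly_flowD(3)[OF M y]
  by (simp add: has_real_derivative_iff_has_vector_derivative)

lemma poly_curve_second_order:
  fixes q :: "real \<Rightarrow> real"
  assumes "real_polynomial_function q" "q 0 = 0" "(q has_real_derivative 0) (at 0)"
  obtains r :: "real poly" where "\<And>s. q s = s * (s * poly r s)"
proof -
  obtain a n where "q = (\<lambda>x. \<Sum>i\<le>n. a i * x ^ i)"
    using assms(1) real_polynomial_function_iff_sum by blast
  then have "q = poly (\<Sum>i\<le>n. monom (a i) i)" by (simp add: poly_sum poly_monom fun_eq_iff)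
  then obtain r0 where q: "q = poly r0" by blast
  have "poly (pderiv r0) 0 = 0"
    using assms(3) poly_DERIV[of r0 0] DERIV_unique unfolding q by blast
  then have 1: "coeff r0 1 = 0" by (simp add: poly_0_coeff_0 coeff_pderiv)
  have 0: "coeff r0 0 = 0" using assms(2) unfolding q by (simp add: poly_0_coeff_0)
  have "q s = s * (s * poly (poly_shift 1 (poly_shift 1 r0)) s)" for s
    unfolding q using poly_eq_poly_shift[of r0 s] poly_eq_poly_shift[of "poly_shift 1 r0" s] 0 1
    by (simp add: coeff_poly_shift)
  then show thesis using that by blast
qed

text \<open>
  If \<open>p\<close> were critical at \<open>y\<close>, the tangent space at the origin \<open>(y, 0, 0)\<close> of the fibre would contain
  the sum of \<open>T\<^sub>y Y\<close> and the plane of the directions \<open>u\<close> and \<open>v\<close>, and so would be larger than at the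
  smooth points \<open>(y, u, 0)\<close>. The curve \<open>(M (s, y), s, s r(s))\<close> with \<open>p (M (s, y)) = s^2 r(s)\<close> shows
  the inclusion.
\<close>

lemma noncritical_at_smooth_origin:
  fixes Y :: "'a::euclidean_space set"
  assumes p: "real_polynomial_function p" and x: "(y, 0, 0) \<in> smooth_locus (suspension Y p)"
    and flex: "tangent_space Y y \<subseteq> span (velocities Y y)"
  obtains M k where "poly_flow Y M" "((\<lambda>s. p (M (s, y))) has_real_derivative k) (at 0)" "k \<noteq> 0"
proof (rule ccontr)
  assume neg: "\<not> thesis"
  note elim = that
  let ?X = "suspension Y p"
  obtain d where d: "smooth_at ?X d (y, 0, 0)" using x unfolding smooth_locus_def by blast
  obtain u where u: "u \<noteq> 0" "smooth_at ?X d (y, u, 0)"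
    by (rule smooth_suspension_near_origin[OF p d], rule that)
  have y: "y \<in> Y" and py: "p y = 0" using d unfolding smooth_at_def by (auto simp: mem_suspension)
  have crit: "frechet_derivative p (at y) (vector_derivative (\<lambda>t. M (t, y)) (at 0)) = 0"
    if M: "poly_flow Y M" for M
    using neg elim[OF M flow_has_real_derivative[OF M p y]] by blast
  let ?T0 = "tangent_space ?X (y, 0, 0)" and ?T1 = "tangent_space ?X (y, u, 0)"
  have sub0: "subspace ?T0" by (rule subspace_tangent_space)
  have eu: "(0, 1, 0) \<in> ?T0"
  proof -
    have "((\<lambda>t. (y, t, 0 :: real)) has_vector_derivative (0, 1, 0)) (at 0)"
      by (auto intro!: derivative_eq_intros has_vector_derivative_Pair)
    then show ?thesis using tangent_curve[of "\<lambda>t. (y, t, 0)" "(0, 1, 0)" 0 ?X] y py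
      by (simp add: mem_suspension)
  qed
  have ev: "(0, 0, 1) \<in> ?T0"
  proof -
    have "((\<lambda>t. (y, 0 :: real, t)) has_vector_derivative (0, 0, 1)) (at 0)"
      by (auto intro!: derivative_eq_intros has_vector_derivative_Pair)
    then show ?thesis using tangent_curve[of "\<lambda>t. (y, 0, t)" "(0, 0, 1)" 0 ?X] y py
      by (simp add: mem_suspension)
  qed
  have "(w, 0, 0) \<in> ?T0" if "w \<in> velocities Y y" for w
  proof -
    obtain M where M: "poly_flow Y M" "w = vector_derivative (\<lambda>t. M (t, y)) (at 0)"
      using \<open>w \<in> _\<close> unfolding velocities_def by blast
    have "real_polynomial_function (\<lambda>s. p (M (s, y)))"
      by (rule real_polynomial_function_comp[OF p flow_curve[OF M(1)]])
    moreover have "p (M (0, y)) = 0" using poly_flowD(3)[OF M(1) y] py by simp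
    moreover have "((\<lambda>s. p (M (s, y))) has_real_derivative 0) (at 0)"
      using flow_has_real_derivative[OF M(1) p y] crit[OF M(1)] by simp
    ultimately obtain r :: "real poly" where r: "\<And>s. p (M (s, y)) = s * (s * poly r s)"
      by (rule poly_curve_second_order) (rule that)
    define \<gamma> where "\<gamma> = (\<lambda>s. (M (s, y), s, s * poly r s))"
    have "((\<lambda>s. s * poly r s) has_real_derivative 1 * poly r 0 + poly (pderiv r) 0 * 0) (at 0)"
      by (rule DERIV_mult[OF DERIV_ident poly_DERIV])
    then have "((\<lambda>s. s * poly r s) has_vector_derivative poly r 0) (at 0)"
      by (simp add: has_real_derivative_iff_has_vector_derivative)
    then have "(\<gamma> has_vector_derivative (w, 1, poly r 0)) (at 0)"
      unfolding \<gamma>_def M(2)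
      by (intro has_vector_derivative_Pair poly_curve_has_vector_derivative[OF flow_curve[OF M(1)]])
        (auto intro!: derivative_eq_intros)
    moreover have "\<gamma> s \<in> ?X" for s
      unfolding \<gamma>_def mem_suspension using poly_flowD(2)[OF M(1) y] r by simp
    moreover have "\<gamma> 0 = (y, 0, 0)" unfolding \<gamma>_def using poly_flowD(3)[OF M(1) y] by simp
    ultimately have "(w, 1, poly r 0) \<in> ?T0" using tangent_curve[of \<gamma> "(w, 1, poly r 0)" 0 ?X] by simp
    then have "(w, 1, poly r 0) - ((0, 1, 0) + poly r 0 *\<^sub>R (0, 0, 1)) \<in> ?T0"
      using eu ev sub0 by (intro subspace_diff subspace_add subspace_scale)
    moreover have "(w, 1, poly r 0) - ((0, 1, 0) + poly r 0 *\<^sub>R (0, 0, 1)) = (w, 0, 0)"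
      by (simp add: prod_eq_iff)
    ultimately show ?thesis by metis
  qed
  then have "velocities Y y \<subseteq> {w. (w, 0, 0) \<in> ?T0}" by blast
  moreover have "subspace {w. (w, 0 :: real, 0 :: real) \<in> ?T0}"
  proof (rule subspaceI)
    show "0 \<in> {w. (w, 0 :: real, 0 :: real) \<in> ?T0}"
      using subspace_0[OF sub0] by (simp add: zero_prod_def)
    show "w + w' \<in> {w. (w, 0, 0) \<in> ?T0}" if "w \<in> {w. (w, 0, 0) \<in> ?T0}" "w' \<in> {w. (w, 0, 0) \<in> ?T0}" for w w'
      using that subspace_add[OF sub0, of "(w, 0, 0)" "(w', 0, 0)"] by simp
    show "c *\<^sub>R w \<in> {w. (w, 0, 0) \<in> ?T0}" if "w \<in> {w. (w, 0, 0) \<in> ?T0}" for w c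
      using that subspace_scale[OF sub0, of "(w, 0, 0)" c] by simp
  qed
  ultimately have T0: "(w, 0, 0) \<in> ?T0" if "w \<in> tangent_space Y y" for w
    using that flex span_minimal by blast
  \<comment> \<open>At (y, u, 0) the linearised equation says that u times the v component is dp(w).
    Flexibility spreads the vanishing of dp from velocities to all tangent vectors of Y, so the v
    component is 0.\<close>
  have T1: "?T1 \<subseteq> {W. snd (snd W) = 0 \<and> fst W \<in> tangent_space Y y}"
  proof
    fix W assume W: "W \<in> ?T1"
    obtain w a b where W_eq: "W = (w, a, b)" by (cases W)
    have w: "w \<in> tangent_space Y y" and eq: "a * 0 + u * b = frechet_derivative p (at y) w"
      using tangent_space_suspensionD[OF p W[unfolded W_eq]] .
    have lin: "linear (frechet_derivative p (at y))" by (rule linear_frechet_derivative_polynomial[OF p])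
    have "subspace {w. frechet_derivative p (at y) w = 0}"
      using lin by (intro subspaceI) (simp_all add: linear_0 linear_add linear_scale)
    moreover have "velocities Y y \<subseteq> {w. frechet_derivative p (at y) w = 0}"
      using crit unfolding velocities_def by blast
    ultimately have "frechet_derivative p (at y) w = 0" using w flex span_minimal by blast
    then show "W \<in> {W. snd (snd W) = 0 \<and> fst W \<in> tangent_space Y y}" using eq u(1) w W_eq by simp
  qed
  have "?T1 \<subseteq> ?T0"
  proof
    fix W assume "W \<in> ?T1"
    then have "snd (snd W) = 0" "fst W \<in> tangent_space Y y" using T1 by auto
    then have "W = (fst W, 0, 0) + fst (snd W) *\<^sub>R (0, 1, 0)" "(fst W, 0, 0) \<in> ?T0"
      using T0 by (auto simp: prod_eq_iff)
    then show "W \<in> ?T0" using eu sub0 by (metis subspace_add subspace_scale)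
  qed
  \<comment> \<open>Both points are smooth of the same dimension d, so the inclusion is an equality;
    but the direction of v belongs only to the larger space.\<close>
  from subspace_dim_equal[OF subspace_tangent_space subspace_tangent_space this]
  have "?T1 = ?T0" using dim_tangent_space_smooth[OF d] dim_tangent_space_smooth[OF u(2)] by simp
  then show False using ev T1 by auto
qed

section \<open>Flexibility of the suspension\<close>

lemma smooth_locus_subset: "smooth_locus Y \<subseteq> Y"
  unfolding smooth_locus_def smooth_at_def by blast

text \<open>The regular function is represented by a polynomial on the ambient space, which can be
  differentiated in all directions. Flexibility is kept as the inclusion that is not
  automatic.\<close>

locale flexible_base =
  fixes Y :: "'a::euclidean_space set" and p :: "'a \<Rightarrow> real"
  assumes p: "real_polynomial_function p"
    and nonconstant: "\<And>C. C \<in> components (smooth_locus Y) \<Longrightarrow> \<not> p constant_on C"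
    and flexible: "\<And>y. y \<in> smooth_locus Y \<Longrightarrow> tangent_space Y y \<subseteq> span (velocities Y y)"
    and transitive: "infinitely_transitive_on_components (SAut Y) (smooth_locus Y)"
begin

abbreviation "X \<equiv> suspension Y p"

text \<open>Exactly the smooth locus of X without the points with u = v = 0. Motions are built
  inside this set, and other smooth points are moved into it beforehand.\<close>

definition Z :: "('a \<times> real \<times> real) set" where
  "Z = {(y, u, v). (y, u, v) \<in> X \<and> y \<in> smooth_locus Y \<and> (u \<noteq> 0 \<or> v \<noteq> 0)}"

lemma mem_Z: "(y, u, v) \<in> Z \<longleftrightarrow> (y, u, v) \<in> X \<and> y \<in> smooth_locus Y \<and> (u \<noteq> 0 \<or> v \<noteq> 0)"
  unfolding Z_def by simp

lemma Z_subset_X: "Z \<subseteq> X"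
  unfolding Z_def by blast

lemma Z_subset_smooth_locus: "Z \<subseteq> smooth_locus X"
  unfolding Z_def using smooth_suspension[OF p] unfolding smooth_locus_def by blast

lemma swap_uv_mem_Z [simp]: "swap_uv x \<in> Z \<longleftrightarrow> x \<in> Z"
  by (cases x) (auto simp: mem_Z mem_suspension mult.commute)

text \<open>Infinite transitivity is applied to two tuples that list the points of \<open>A\<close>
  in the same order and differ in a single extra entry, y in one and y' in the other, in their
  common component.\<close>

lemma fixing_transitive:
  assumes A: "finite A" "A \<subseteq> smooth_locus Y" "y \<notin> A" "y' \<notin> A"
    and y: "connected_component (smooth_locus Y) y y'"
  obtains \<gamma> where "\<gamma> \<in> flow_group Y" "\<gamma> y = y'" "\<And>a. a \<in> A \<Longrightarrow> \<gamma> a = a"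
proof -
  let ?R = "smooth_locus Y"
  let ?comp = "connected_component_set ?R"
  define C0 where "C0 = ?comp y"
  have yR: "y \<in> ?R" "y' \<in> ?R" using y connected_component_in by blast+
  have C0: "C0 \<in> components ?R" "y \<in> C0" "y' \<in> C0"
    unfolding C0_def using yR y by (auto simp: componentsI connected_component_refl)
  define n where "n = (\<lambda>C. card (A \<inter> C))"
  have "\<exists>e. bij_betw e {..<n C} (A \<inter> C)" for C
    using ex_bij_betw_nat_finite[of "A \<inter> C"] A(1) unfolding n_def atLeast0LessThan by blast
  then obtain e where e: "\<And>C. bij_betw (e C) {..<n C} (A \<inter> C)" by metis
  \<comment> \<open>The extra entry has index \<open>n C0\<close>, right after the points of
    \<open>A\<close> in that component.\<close>
  define m where "m = (\<lambda>C. n C + (if C = C0 then 1 else 0))"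
  define P where "P = (\<lambda>z C j. if j < n C then e C j else z)"
  have e_mem: "e C j \<in> A \<inter> C" if "j < n C" for C j using e that by (auto simp: bij_betw_def)
  have tuple: "component_tuple ?R m (P z)" if z: "z \<in> C0" "z \<notin> A" for z
    unfolding component_tuple_def
  proof (intro ballI conjI allI impI)
    fix C j assume "j < m C"
    then show "P z C j \<in> C" using e_mem z unfolding P_def m_def by (auto split: if_splits)
  next
    fix C
    show "inj_on (P z C) {..<m C}"
    proof (rule inj_onI)
      fix i j assume ij: "i \<in> {..<m C}" "j \<in> {..<m C}" "P z C i = P z C j"
      have inj: "inj_on (e C) {..<n C}" using e by (auto simp: bij_betw_def)
      have "i < n C \<and> j < n C \<or> \<not> i < n C \<and> \<not> j < n C"
        using ij(3) e_mem z(2) unfolding P_def by (metis IntD1)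
      then show "i = j"
        using ij inj_onD[OF inj, of i j] unfolding P_def m_def by (auto split: if_splits)
    qed
  qed
  have "{C \<in> components ?R. m C \<noteq> 0} \<subseteq> insert C0 (?comp ` A)"
  proof
    fix C assume C: "C \<in> {C \<in> components ?R. m C \<noteq> 0}"
    show "C \<in> insert C0 (?comp ` A)"
    proof (cases "C = C0")
      case False
      then have "A \<inter> C \<noteq> {}" using C unfolding m_def n_def by auto
      then obtain a where "a \<in> A" "a \<in> C" by blast
      then have "C = ?comp a" using C by (metis (no_types, lifting) components_iff connected_component_eq mem_Collect_eq)
      then show ?thesis using \<open>a \<in> A\<close> by blast
    qed simp
  qed
  then have "finite {C \<in> components ?R. m C \<noteq> 0}" using A(1) finite_subset by blast
  then obtain g where g: "g \<in> SAut Y" "\<forall>C\<in>components ?R. \<forall>j<m C. g (P y C j) = P y' C j"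
    using transitive tuple[OF C0(2) A(3)] tuple[OF C0(3) A(4)]
    unfolding infinitely_transitive_on_components_def by blast
  obtain \<gamma> where \<gamma>: "\<gamma> \<in> flow_group Y" "g = restrict \<gamma> Y"
    by (rule SAut_restrict_flow_group[OF g(1)], rule that)
  have gY: "g z = \<gamma> z" if "z \<in> ?R" for z using that \<gamma>(2) smooth_locus_subset by auto
  have "g (P y C0 (n C0)) = P y' C0 (n C0)" using g(2) C0(1) by (simp add: m_def)
  then have "\<gamma> y = y'" using gY[OF yR(1)] by (simp add: P_def)
  moreover have "\<gamma> a = a" if a: "a \<in> A" for a
  proof -
    have aR: "a \<in> ?R" using a A(2) by blast
    define C where "C = ?comp a"
    have C: "C \<in> components ?R" "a \<in> A \<inter> C"
      unfolding C_def using a aR by (auto simp: componentsI connected_component_refl)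
    then have "a \<in> e C ` {..<n C}" using e[of C] unfolding bij_betw_def by blast
    then obtain j where j: "j < n C" "e C j = a" by blast
    then have "g (P y C j) = P y' C j" using g(2) C(1) by (simp add: m_def)
    then have "g a = a" using j by (simp add: P_def)
    then show ?thesis using gY[OF aR] by simp
  qed
  ultimately show thesis using that \<gamma>(1) by blast
qed

text \<open>A word of flows takes y to a point with another value of \<open>p\<close>. Some letter
  of the word must change the value, so \<open>p\<close> has nonzero derivative at some time along
  the flow of that letter; \<gamma> leads to the point reached then.\<close>

lemma noncritical_on_orbit:
  assumes "y \<in> smooth_locus Y"
  obtains \<gamma> M k where "\<gamma> \<in> flow_group Y" "poly_flow Y M"
    "((\<lambda>s. p (M (s, \<gamma> y))) has_real_derivative k) (at 0)" "k \<noteq> 0"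
proof -
  let ?C = "connected_component_set (smooth_locus Y) y"
  have yY: "y \<in> Y" using assms smooth_locus_subset by blast
  have "\<not> p constant_on ?C" using nonconstant componentsI[OF assms] by blast
  then obtain y' where y': "connected_component (smooth_locus Y) y y'" "p y' \<noteq> p y"
    unfolding constant_on_def by blast
  obtain g where g: "g \<in> flow_group Y" "g y = y'"
    by (rule fixing_transitive[of "{}" y y']) (use y'(1) in auto)
  have "p (g y) \<noteq> p y \<Longrightarrow> \<exists>\<gamma> M k. \<gamma> \<in> flow_group Y \<and> poly_flow Y M \<and>
      ((\<lambda>s. p (M (s, \<gamma> y))) has_real_derivative k) (at 0) \<and> k \<noteq> 0"
    using g(1)
  proof (induction rule: flow_group.induct)
    case flow_group_id
    then show ?case by simp
  next
    case (flow_group_flow M g t)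
    note M = flow_group_flow.hyps(1)
    show ?case
    proof (cases "p (g y) = p y")
      case False
      then show ?thesis using flow_group_flow.IH by blast
    next
      case True
      define z where "z = g y"
      have z: "z \<in> Y" unfolding z_def by (rule flow_group_mem[OF flow_group_flow.hyps(2) yY])
      have "real_polynomial_function (\<lambda>s. p (M (s, z)))"
        by (rule real_polynomial_function_comp[OF p flow_curve[OF M]])
      then obtain q' where q': "\<And>s. ((\<lambda>s. p (M (s, z))) has_real_derivative q' s) (at s)"
        using has_real_derivative_polynomial_function by blast
      have "\<exists>s. q' s \<noteq> 0"
      proof (rule ccontr)
        assume "\<nexists>s. q' s \<noteq> 0"
        then have "p (M (t, z)) = p (M (0, z))" using q' DERIV_isconst_all[of "\<lambda>s. p (M (s, z))" t 0] by simp
        then show False using flow_group_flow.prems True poly_flowD(3)[OF M z] by (simp add: z_def)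
      qed
      then obtain s where s: "q' s \<noteq> 0" by blast
      have "((\<lambda>r. p (M (r + s, z))) has_real_derivative q' s) (at 0)"
        using q'[of s] DERIV_shift[of "\<lambda>s. p (M (s, z))" "q' s" 0 s] by simp
      then have "((\<lambda>r. p (M (r, M (s, g y)))) has_real_derivative q' s) (at 0)"
        using poly_flowD(4)[OF M z] by (simp add: z_def)
      then show ?thesis
        using flow_group.flow_group_flow[OF M flow_group_flow.hyps(2), of s] M s by blast
    qed
  qed
  then show thesis using that g(2) y'(2) by blast
qed

lemma flexible_Z:
  assumes "x \<in> Z" shows "tangent_space X x \<subseteq> span (velocities X x)"
proof -
  have *: "tangent_space X (y, u, v) \<subseteq> span (velocities X (y, u, v))"
    if "(y, u, v) \<in> Z" "u \<noteq> 0" for y u v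
  proof -
    have y: "y \<in> smooth_locus Y" "(y, u, v) \<in> X" using that by (auto simp: mem_Z)
    obtain \<gamma> M k where "\<gamma> \<in> flow_group Y" "poly_flow Y M"
      "((\<lambda>s. p (M (s, \<gamma> y))) has_real_derivative k) (at 0)" "k \<noteq> 0"
      by (rule noncritical_on_orbit[OF y(1)], rule that)
    then show ?thesis
      by (rule flexible_point_suspension[OF p y(2) that(2) flexible[OF y(1)]])
  qed
  obtain y u v where x: "x = (y, u, v)" by (cases x)
  show ?thesis
  proof (cases "u = 0")
    case False
    then show ?thesis using * assms x by blast
  next
    case True
    then have "v \<noteq> 0" using assms unfolding x by (simp add: mem_Z)
    moreover have "swap_uv x \<in> Z" using assms by simp
    ultimately have "tangent_space X (swap_uv x) \<subseteq> span (velocities X (swap_uv x))"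
      using *[of y v u] unfolding x by simp
    then show ?thesis
      by (rule flexible_point_transfer[OF polynomial_function_swap_uv polynomial_function_swap_uv, rotated -1])
        (use assms Z_subset_X in auto)
  qed
qed

lemma base_smooth: "(y, u, v) \<in> smooth_locus X \<Longrightarrow> y \<in> smooth_locus Y"
  by (rule smooth_of_suspension[OF p])

lemma smooth_cases: "x \<in> smooth_locus X \<Longrightarrow> x \<in> Z \<or> (\<exists>y\<in>smooth_locus Y. x = (y, 0, 0) \<and> p y = 0)"
  using base_smooth smooth_locus_subset[of X] by (cases x) (auto simp: mem_Z mem_suspension subset_eq)

lemma noncritical_at_origin:
  assumes "(y, 0, 0) \<in> smooth_locus X"
  obtains M k where "poly_flow Y M" "((\<lambda>s. p (M (s, y))) has_real_derivative k) (at 0)" "k \<noteq> 0"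
  by (rule noncritical_at_smooth_origin[OF p assms flexible[OF base_smooth[OF assms]]], rule that)

text \<open>The time factor has r(0) = 1 and vanishes on the levels in \<open>A\<close>. On the
  level u = 0 the rescaled time is 0, so y stays, while v is translated with the speed of
  \<open>p\<close> along \<open>M\<close>.\<close>

lemma origin_flow:
  assumes M: "poly_flow Y M" and A: "finite A" "0 \<notin> A"
  obtains N where "poly_flow X N"
    "\<And>t y v k. y \<in> Y \<Longrightarrow> ((\<lambda>s. p (M (s, y))) has_real_derivative k) (at 0) \<Longrightarrow>
      N (t, y, 0, v) = (y, 0, v + t * k)"
    "\<And>t y u v. y \<in> Y \<Longrightarrow> u \<in> A \<Longrightarrow> N (t, y, u, v) = (y, u, v)"
proof -
  obtain r :: "real poly" where r: "poly r 0 = 1" "\<And>a. a \<in> A \<Longrightarrow> poly r a = 0"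
    by (rule interpolating_poly[OF A, of 1], rule that)
  obtain N e where N: "poly_flow X N" "\<And>t y u v. N (t, y, u, v) =
      (M (t * u * poly r u, y), u, v + t * poly r u * e (t * u * poly r u) y)"
    "\<And>y. y \<in> Y \<Longrightarrow> ((\<lambda>s. p (M (s, y))) has_real_derivative e 0 y) (at 0)"
    by (rule suspension_flow[OF M p, of r], rule that)
  show thesis
  proof (rule that[OF N(1)])
    fix t y v k
    assume y: "y \<in> Y" and k: "((\<lambda>s. p (M (s, y))) has_real_derivative k) (at 0)"
    have "e 0 y = k" using N(3)[OF y] k DERIV_unique by blast
    then show "N (t, y, 0, v) = (y, 0, v + t * k)"
      unfolding N(2) using r(1) poly_flowD(3)[OF M y] by simp
  next
    fix t y u v assume "y \<in> Y" "u \<in> A"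
    then show "N (t, y, u, v) = (y, u, v)" unfolding N(2) using r(2) poly_flowD(3)[OF M] by simp
  qed
qed

theorem flexible_suspension: "flexible X"
  unfolding flexible_def
proof
  fix x assume x: "x \<in> smooth_locus X"
  then have xX: "x \<in> X" using smooth_locus_subset by blast
  have "tangent_space X x \<subseteq> span (velocities X x)"
  proof (cases "x \<in> Z")
    case True
    then show ?thesis by (rule flexible_Z)
  next
    case False
    then obtain y where y: "y \<in> smooth_locus Y" "x = (y, 0, 0)" "p y = 0"
      using smooth_cases[OF x] by blast
    obtain M k where M: "poly_flow Y M" "((\<lambda>s. p (M (s, y))) has_real_derivative k) (at 0)" "k \<noteq> 0"
      by (rule noncritical_at_origin[OF x[unfolded y(2)]], rule that)
    have no_level: "finite ({} :: real set)" "0 \<notin> ({} :: real set)" by simp_all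
    obtain N where N: "poly_flow X N"
      "\<And>t y v k. y \<in> Y \<Longrightarrow> ((\<lambda>s. p (M (s, y))) has_real_derivative k) (at 0) \<Longrightarrow>
        N (t, y, 0, v) = (y, 0, v + t * k)"
      by (rule origin_flow[OF M(1) no_level], rule that)
    have yY: "y \<in> Y" using y(1) smooth_locus_subset by blast
    \<comment> \<open>As k is nonzero, the flow takes the point with u = v = 0 into
      \<open>Z\<close>, where flexibility is known and from where it is transported back.\<close>
    have "N (1, x) = (y, 0, k)" unfolding y(2) using N(2)[OF yY M(2), of 1 0] by simp
    then have "N (1, x) \<in> Z" using y M(3) yY by (simp add: mem_Z mem_suspension)
    then have *: "tangent_space X (N (1, x)) \<subseteq> span (velocities X (N (1, x)))" by (rule flexible_Z)
    show ?thesis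
      by (rule flexible_point_transfer[OF flow_group_polynomial[OF flow_group_single[OF N(1)]]
            flow_group_polynomial[OF flow_group_single[OF N(1), of "-1"]] _ _ _ _ xX])
        (use * in \<open>simp_all add: poly_flowD[OF N(1)]\<close>)
  qed
  then have "span (velocities X x) = tangent_space X x"
    using span_minimal[OF velocities_subset_tangent_space[OF xX] subspace_tangent_space] by blast
  then show "flexible_point X x" using flexible_point_iff_velocities[OF xX] by blast
qed

end

section \<open>Moving one point while fixing finitely many others\<close>

context flexible_base
begin

text \<open>Fixing \<open>S\<close> pointwise lets such motions be composed: a tuple is moved entry
  by entry, with the remaining entries put into \<open>S\<close>.\<close>

definition linked :: "('a \<times> real \<times> real) set \<Rightarrow> 'a \<times> real \<times> real \<Rightarrow> 'a \<times> real \<times> real \<Rightarrow> bool" where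
  "linked S x x' \<longleftrightarrow> (\<exists>g\<in>flow_group X. g x = x' \<and> (\<forall>s\<in>S. g s = s))"

lemma linkedI: "g \<in> flow_group X \<Longrightarrow> g x = x' \<Longrightarrow> (\<And>s. s \<in> S \<Longrightarrow> g s = s) \<Longrightarrow> linked S x x'"
  unfolding linked_def by blast

lemma linked_trans:
  assumes "linked S x x'" "linked S x' x''" shows "linked S x x''"
proof -
  obtain g where g: "g \<in> flow_group X" "g x = x'" "\<forall>s\<in>S. g s = s"
    using assms(1) unfolding linked_def by blast
  obtain h where h: "h \<in> flow_group X" "h x' = x''" "\<forall>s\<in>S. h s = s"
    using assms(2) unfolding linked_def by blast
  show ?thesis
    by (rule linkedI[OF flow_group_comp[OF h(1) g(1)]]) (use g h in simp_all)
qed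

lemma linked_sym:
  assumes "linked S x x'" "x \<in> X" "S \<subseteq> X" shows "linked S x' x"
proof -
  obtain g where g: "g \<in> flow_group X" "g x = x'" "\<forall>s\<in>S. g s = s" using assms(1) unfolding linked_def by blast
  obtain h where h: "h \<in> flow_group X" "\<And>x. x \<in> X \<Longrightarrow> h (g x) = x" "\<And>x. x \<in> X \<Longrightarrow> g (h x) = x"
    by (rule flow_group_inv[OF g(1)], rule that)
  have "h s = s" if "s \<in> S" for s using h(2)[of s] g(3) that assms(3) by auto
  then show ?thesis unfolding linked_def using h(1,2) g(2) assms(2) by blast
qed

lemma linked_swap:
  assumes "linked (swap_uv ` S) (swap_uv x) (swap_uv x')" shows "linked S x x'"
proof -
  obtain g where g: "g \<in> flow_group X" "g (swap_uv x) = swap_uv x'" "\<forall>s\<in>swap_uv ` S. g s = s"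
    using assms unfolding linked_def by blast
  show ?thesis
    by (rule linkedI[OF flow_group_swap[OF g(1)]]) (use g in simp_all)
qed

text \<open>For nonzero u the level is the graph of p / u over Y, so a point on it is determined by
  its base point. It suffices to move base points while fixing those of the points of
  \<open>S\<close> on the same level. Points of \<open>S\<close> on other levels are held by the
  zeros of the time factor.\<close>

lemma linked_same_u:
  assumes S: "finite S" "S \<subseteq> Z" and u: "u \<noteq> 0"
    and x: "(y, u, v) \<in> X" "(y, u, v) \<notin> S" and x': "(y', u, v') \<in> X" "(y', u, v') \<notin> S"
    and y: "connected_component (smooth_locus Y) y y'"
  shows "linked S (y, u, v) (y', u, v')"
proof -
  have det: "s = s'" if "s \<in> X" "s' \<in> X" "fst s = fst s'" "fst (snd s) = u" "fst (snd s') = u" for s s'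
  proof -
    have s: "s = (fst s, u, snd (snd s))" "s' = (fst s', u, snd (snd s'))" using that(4,5) by (simp_all add: prod_eq_iff)
    then have "u * snd (snd s) = u * snd (snd s')" using that(1-3) mem_suspension by metis
    then show ?thesis using s u that(3-5) by (simp add: prod_eq_iff)
  qed
  define A where "A = fst ` {s \<in> S. fst (snd s) = u}"
  define B where "B = (\<lambda>s. fst (snd s)) ` S - {u}"
  have SX: "s \<in> X" if "s \<in> S" for s using that S(2) Z_subset_X by blast
  have A: "finite A" "A \<subseteq> smooth_locus Y"
    unfolding A_def using S by (auto simp: Z_def)
  have "y \<notin> A"
  proof
    assume "y \<in> A"
    then obtain s where s: "s \<in> S" "fst (snd s) = u" "fst s = y" unfolding A_def by blast
    then have "s = (y, u, v)" using det[OF SX[OF s(1)] x(1)] by simp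
    then show False using s(1) x(2) by simp
  qed
  moreover have "y' \<notin> A"
  proof
    assume "y' \<in> A"
    then obtain s where s: "s \<in> S" "fst (snd s) = u" "fst s = y'" unfolding A_def by blast
    then have "s = (y', u, v')" using det[OF SX[OF s(1)] x'(1)] by simp
    then show False using s(1) x'(2) by simp
  qed
  ultimately obtain \<gamma> where \<gamma>: "\<gamma> \<in> flow_group Y" "\<gamma> y = y'" "\<And>a. a \<in> A \<Longrightarrow> \<gamma> a = a"
    using fixing_transitive[OF A _ _ y] by blast
  have B: "finite B" "u \<notin> B" unfolding B_def using S(1) by auto
  obtain g where g: "g \<in> flow_group X" "\<And>x. x \<in> X \<Longrightarrow> fst (snd (g x)) = fst (snd x)"
    "\<And>x. x \<in> X \<Longrightarrow> fst (snd x) = u \<Longrightarrow> fst (g x) = \<gamma> (fst x)"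
    "\<And>x. x \<in> X \<Longrightarrow> fst (snd x) \<in> insert 0 B \<Longrightarrow> g x = x"
    by (rule level_move[OF \<gamma>(1) p u B], rule that)
  have "g (y, u, v) = (y', u, v')"
    using g(2,3)[OF x(1)] \<gamma>(2) by (intro det flow_group_mem[OF g(1) x(1)] x'(1)) simp_all
  moreover have "g s = s" if s: "s \<in> S" for s
  proof (cases "fst (snd s) = u")
    case True
    then have "fst (g s) = fst s" using g(3)[OF SX[OF s]] \<gamma>(3)[of "fst s"] s unfolding A_def by auto
    then show ?thesis using True g(2)[OF SX[OF s]]
      by (intro det flow_group_mem[OF g(1) SX[OF s]] SX[OF s]) simp_all
  next
    case False
    then show ?thesis using g(4)[OF SX[OF s]] s unfolding B_def by auto
  qed
  ultimately show ?thesis unfolding linked_def using g(1) by blast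
qed

lemma linked_same_v:
  assumes S: "finite S" "S \<subseteq> Z" and v: "v \<noteq> 0"
    and x: "(y, u, v) \<in> X" "(y, u, v) \<notin> S" and x': "(y', u', v) \<in> X" "(y', u', v) \<notin> S"
    and y: "connected_component (smooth_locus Y) y y'"
  shows "linked S (y, u, v) (y', u', v)"
proof (rule linked_swap)
  have swapS: "finite (swap_uv ` S)" "swap_uv ` S \<subseteq> Z"
    by (rule finite_imageI[OF S(1)]) (rule image_subsetI, simp add: subsetD[OF S(2)])
  have notin: "swap_uv s \<notin> swap_uv ` S" if "s \<notin> S" for s using that by (metis imageE swap_uv_simps(2))
  show "linked (swap_uv ` S) (swap_uv (y, u, v)) (swap_uv (y', u', v))"
    using linked_same_u[OF swapS v _ _ _ _ y, of u u'] x x' notin[OF x(2)] notin[OF x'(2)]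
      swap_uv_mem[of "(y, u, v)"] swap_uv_mem[of "(y', u', v)"] by simp
qed

text \<open>The forbidden values: if \<open>p y\<close> avoids this finite set, then no point over y
  belongs to S, whatever u and v are.\<close>

definition base_values :: "('a \<times> real \<times> real) set \<Rightarrow> real set" where
  "base_values S = (\<lambda>s. p (fst s)) ` S"

lemma not_in_base_values: "p y \<notin> base_values S \<Longrightarrow> (y, u, v) \<notin> S"
  unfolding base_values_def by force

lemma finite_base_values: "finite S \<Longrightarrow> finite (base_values S)"
  unfolding base_values_def by simp

lemma connected_image_component: "connected (p ` connected_component_set (smooth_locus Y) y)"
  by (intro connected_continuous_image connected_connected_component continuous_at_imp_continuous_on ballI
      continuous_real_polymonial_function p)

lemma interval_in_values:
  assumes "a \<in> p ` connected_component_set (smooth_locus Y) y" "b \<in> p ` connected_component_set (smooth_locus Y) y"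
  shows "{a..b} \<subseteq> p ` connected_component_set (smooth_locus Y) y"
  using connected_contains_Icc[OF connected_image_component assms] .

lemma component_values:
  assumes "y \<in> smooth_locus Y"
  obtains a b where "a < b" "{a..b} \<subseteq> p ` connected_component_set (smooth_locus Y) y" "0 \<notin> {a..b}"
proof -
  let ?C = "connected_component_set (smooth_locus Y) y"
  have "\<not> p constant_on ?C" using nonconstant componentsI[OF assms] by blast
  moreover have "y \<in> ?C" using assms by (simp add: connected_component_refl)
  ultimately obtain y' where "y' \<in> ?C" "p y' \<noteq> p y" unfolding constant_on_def by blast
  then obtain a b where ab: "a \<in> p ` ?C" "b \<in> p ` ?C" "a < b"
    using \<open>y \<in> ?C\<close> by (metis imageI linorder_neqE_linordered_idom)
  note sub = interval_in_values[OF ab(1,2)]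
  \<comment> \<open>The interval is shortened to lie on one side of 0.\<close>
  show thesis
  proof (cases "b > 0")
    case True
    define a' where "a' = max a (b / 2)"
    have "a' < b" "a \<le> a'" "0 < a'" unfolding a'_def using ab(3) True by auto
    then show thesis using sub by (intro that[of a' b]) auto
  next
    case False
    define b' where "b' = (a + b) / 2"
    have "a < b'" "b' \<le> b" "b' < 0" unfolding b'_def using ab(3) False by auto
    then show thesis using sub by (intro that[of a b']) auto
  qed
qed

lemma infinite_component_values:
  assumes "y \<in> smooth_locus Y"
  shows "infinite (p ` connected_component_set (smooth_locus Y) y - {0})"
proof -
  obtain a b where ab: "a < b" "{a..b} \<subseteq> p ` connected_component_set (smooth_locus Y) y" "0 \<notin> {a..b}"
    by (rule component_values[OF assms], rule that)
  then have "{a..b} \<subseteq> p ` connected_component_set (smooth_locus Y) y - {0}" by blast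
  then show ?thesis using infinite_Icc[OF ab(1)] finite_subset by blast
qed

lemma component_value_avoiding:
  assumes "y \<in> smooth_locus Y" "finite V"
  obtains y' where "connected_component (smooth_locus Y) y y'" "p y' \<noteq> 0" "p y' \<notin> V"
proof -
  have "infinite (p ` connected_component_set (smooth_locus Y) y - {0} - V)"
    using Diff_infinite_finite[OF assms(2) infinite_component_values[OF assms(1)]] .
  then obtain w where "w \<in> p ` connected_component_set (smooth_locus Y) y - {0} - V"
    using infinite_imp_nonempty by blast
  then show thesis using that by blast
qed

lemma component_trans:
  "connected_component R y z \<Longrightarrow> connected_component R y z' \<Longrightarrow> connected_component R z z'"
  by (meson connected_component_sym connected_component_trans)

text \<open>
  Two neighbouring levels \<open>u = a\<close> and \<open>u = b\<close> are joined along a common level of \<open>v\<close>, which exists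
  because \<open>p\<close> takes an interval of values on the component.
\<close>

lemma linked_same_sign_u:
  assumes S: "finite S" "S \<subseteq> Z"
    and x: "(y, u, v) \<in> X" "(y, u, v) \<notin> S" and x': "(y', u', v') \<in> X" "(y', u', v') \<notin> S"
    and y: "connected_component (smooth_locus Y) y y'" and uu': "u * u' > 0"
  shows "linked S (y, u, v) (y', u', v')"
proof -
  let ?cc = "connected_component (smooth_locus Y) y"
  have yR: "y \<in> smooth_locus Y" using y connected_component_in by blast
  have SX: "S \<subseteq> X" using S(2) Z_subset_X by blast
  \<comment> \<open>Levels, not points, are related. It remains to show that all levels of one sign
    are related.\<close>
  define R where "R = (\<lambda>a b. \<forall>z w z' w'. ?cc z \<longrightarrow> ?cc z' \<longrightarrow> (z, a, w) \<in> X - S \<longrightarrow> (z', b, w') \<in> X - S \<longrightarrow>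
    linked S (z, a, w) (z', b, w'))"
  define U where "U = {t. t * u > 0}"
  have U0: "a \<noteq> 0" if "a \<in> U" for a using that unfolding U_def by auto
  have YR: "?cc z \<Longrightarrow> z \<in> Y" for z using connected_component_in smooth_locus_subset by blast
  have u0: "u \<noteq> 0" using uu' by auto
  have "R u u'"
  \<comment> \<open>On the half-line of levels of the sign of u the relation is symmetric,
    transitive and holds near each level, so connectedness makes it total.\<close>
  proof (rule connected_equivalence_relation[of U])
    have "U = {0<..} \<or> U = {..<0}"
      unfolding U_def using u0 by (cases "u > 0") (auto simp: zero_less_mult_iff)
    then show "connected U" by auto
    show "u \<in> U" "u' \<in> U" unfolding U_def using uu' u0 by (auto simp: mult.commute zero_less_mult_iff)
    show "R b a" if "R a b" for a b
      unfolding R_def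
    proof (intro allI impI)
      fix z w z' w'
      assume "?cc z" "?cc z'" "(z, b, w) \<in> X - S" "(z', a, w') \<in> X - S"
      then have "linked S (z', a, w') (z, b, w)" using that unfolding R_def by blast
      then show "linked S (z, b, w) (z', a, w')"
        using linked_sym SX \<open>(z', a, w') \<in> X - S\<close> by blast
    qed
    show "R a c" if "R a b" "R b c" "b \<in> U" for a b c
      unfolding R_def
    proof (intro allI impI)
      fix z w z' w'
      assume z: "?cc z" "?cc z'" "(z, a, w) \<in> X - S" "(z', c, w') \<in> X - S"
      \<comment> \<open>Transitivity needs an actual point outside \<open>S\<close> on the middle
        level.\<close>
      obtain t where t: "?cc t" "p t \<notin> base_values S"
        by (rule component_value_avoiding[OF yR finite_base_values[OF S(1)]], rule that)
      have "(t, b, p t / b) \<in> X - S"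
        using not_in_base_values[OF t(2)] YR[OF t(1)] U0[OF that(3)] by (simp add: mem_suspension)
      then have "linked S (z, a, w) (t, b, p t / b)" "linked S (t, b, p t / b) (z', c, w')"
        using that(1,2) z t(1) unfolding R_def by blast+
      then show "linked S (z, a, w) (z', c, w')" by (rule linked_trans)
    qed
    fix a assume a: "a \<in> U"
    obtain \<alpha> \<beta> where \<alpha>\<beta>: "\<alpha> < \<beta>" "{\<alpha>..\<beta>} \<subseteq> p ` Collect ?cc" "0 \<notin> {\<alpha>..\<beta>}"
      by (rule component_values[OF yR], rule that)
    \<comment> \<open>Points on the levels a and b with common v = w / a lie over values w and w b /
      a of \<open>p\<close>. Starting from the midpoint, both values stay inside the interval when b
      is close to a.\<close>
    define w0 where "w0 = (\<alpha> + \<beta>) / 2"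
    have w0: "\<alpha> < w0" "w0 < \<beta>" unfolding w0_def using \<alpha>\<beta>(1) by auto
    define T where "T = U \<inter> (\<lambda>t. w0 * t / a) -` {\<alpha><..<\<beta>}"
    show "\<exists>T. openin (top_of_set U) T \<and> a \<in> T \<and> (\<forall>b\<in>T. R a b)"
    proof (intro exI[of _ T] conjI ballI)
      show "openin (top_of_set U) T"
        unfolding T_def by (intro continuous_openin_preimage_gen continuous_intros) (use U0[OF a] in auto)
      show "a \<in> T" unfolding T_def using a U0[OF a] w0 by simp
      fix b assume "b \<in> T"
      then have b: "b \<in> U" "\<alpha> < w0 * b / a" "w0 * b / a < \<beta>" unfolding T_def by auto
      \<comment> \<open>An open nonempty set is infinite, so some w in it makes both w and w b / a
        avoid the values taken under \<open>S\<close>.\<close>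
      define W where "W = {\<alpha><..<\<beta>} \<inter> (\<lambda>w. w * b / a) -` {\<alpha><..<\<beta>}"
      have "open W"
        unfolding W_def by (intro open_Int open_vimage continuous_intros open_greaterThanLessThan) (use U0[OF a] in auto)
      moreover have "w0 \<in> W" unfolding W_def using w0 b by auto
      ultimately have "infinite W" using finite_imp_not_open by blast
      moreover have "finite ((\<lambda>w. w * a / b) ` base_values S \<union> base_values S)"
        using finite_base_values[OF S(1)] by simp
      ultimately obtain w where w: "w \<in> W" "w \<notin> (\<lambda>w. w * a / b) ` base_values S" "w \<notin> base_values S"
        using Diff_infinite_finite infinite_imp_nonempty by (metis (no_types, lifting) DiffE UnCI ex_in_conv)
      have "w * b / a \<notin> base_values S"
      proof
        assume "w * b / a \<in> base_values S"
        moreover have "w = (w * b / a) * a / b" using U0[OF a] U0[OF b(1)] by simp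
        ultimately show False using w(2) by blast
      qed
      moreover obtain z1 where z1: "?cc z1" "p z1 = w"
        using subsetD[OF \<alpha>\<beta>(2), of w] w(1) unfolding W_def by auto
      moreover obtain z2 where z2: "?cc z2" "p z2 = w * b / a"
        using subsetD[OF \<alpha>\<beta>(2), of "w * b / a"] w(1) unfolding W_def by auto
      ultimately have q: "(z1, a, w / a) \<in> X - S" "(z2, b, w / a) \<in> X - S"
        using not_in_base_values[of z1 S] not_in_base_values[of z2 S] w(3) YR U0[OF a] by (simp_all add: mem_suspension)
      have "w \<noteq> 0" using w(1) \<alpha>\<beta>(3) unfolding W_def by auto
      then have mid: "linked S (z1, a, w / a) (z2, b, w / a)"
        using q U0[OF a] component_trans[OF z1(1) z2(1)] by (intro linked_same_v S) auto
      show "R a b"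
        unfolding R_def
      proof (intro allI impI)
        fix z c z' c'
        assume z: "?cc z" "?cc z'" "(z, a, c) \<in> X - S" "(z', b, c') \<in> X - S"
        have "linked S (z, a, c) (z1, a, w / a)"
          using z q U0[OF a] component_trans[OF z(1) z1(1)] by (intro linked_same_u S) auto
        moreover have "linked S (z2, b, w / a) (z', b, c')"
          using z q U0[OF b(1)] component_trans[OF z2(1) z(2)] by (intro linked_same_u S) auto
        ultimately show "linked S (z, a, c) (z', b, c')" using mid linked_trans by blast
      qed
    qed
  qed
  then show ?thesis using x x' y connected_component_refl[OF yR] unfolding R_def by blast
qed

lemma linked_same_sign_v:
  assumes S: "finite S" "S \<subseteq> Z"
    and x: "(y, u, v) \<in> X" "(y, u, v) \<notin> S" and x': "(y', u', v') \<in> X" "(y', u', v') \<notin> S"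
    and y: "connected_component (smooth_locus Y) y y'" and vv': "v * v' > 0"
  shows "linked S (y, u, v) (y', u', v')"
proof (rule linked_swap)
  have swapS: "finite (swap_uv ` S)" "swap_uv ` S \<subseteq> Z"
    by (rule finite_imageI[OF S(1)]) (rule image_subsetI, simp add: subsetD[OF S(2)])
  have notin: "swap_uv s \<notin> swap_uv ` S" if "s \<notin> S" for s using that by (metis imageE swap_uv_simps(2))
  show "linked (swap_uv ` S) (swap_uv (y, u, v)) (swap_uv (y', u', v'))"
    using linked_same_sign_u[OF swapS _ _ _ _ y vv', of u u'] x x' notin[OF x(2)] notin[OF x'(2)]
      swap_uv_mem[of "(y, u, v)"] swap_uv_mem[of "(y', u', v')"] by simp
qed

text \<open>A point of \<open>Z\<close> with u = 0 has nonzero v, so it can travel on its level of v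
  to a base point where \<open>p\<close>, and hence u = p / v, is nonzero. It then passes from
  \<open>S0\<close> to \<open>S1\<close>, the points already off the level. The points of
  \<open>T\<close> never move.\<close>

lemma move_off_zero_level:
  assumes "finite S0"
  shows "finite S1 \<Longrightarrow> finite T \<Longrightarrow> S0 \<subseteq> {s \<in> Z. fst (snd s) = 0} \<Longrightarrow> S1 \<subseteq> {s \<in> Z. fst (snd s) \<noteq> 0} \<Longrightarrow>
    T \<subseteq> Z \<Longrightarrow> T \<inter> (S0 \<union> S1) = {} \<Longrightarrow>
    \<exists>g\<in>flow_group X. (\<forall>t\<in>T. g t = t) \<and> (\<forall>s\<in>S0 \<union> S1. g s \<in> Z \<and> fst (snd (g s)) \<noteq> 0)"
  using assms
proof (induction S0 arbitrary: S1 rule: finite_induct)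
  case empty
  then show ?case using flow_group_id[of X] by (intro bexI[of _ "\<lambda>x. x"]) auto
next
  case (insert s S0)
  obtain y v where s: "s = (y, 0, v)" "s \<in> Z" using insert.prems(3) by (cases s) auto
  have y: "y \<in> smooth_locus Y" "v \<noteq> 0" "s \<in> X" using s by (auto simp: mem_Z)
  define S where "S = S0 \<union> S1 \<union> T"
  have S: "finite S" "S \<subseteq> Z" unfolding S_def using insert.prems insert.hyps(1) by auto
  obtain y' where y': "connected_component (smooth_locus Y) y y'" "p y' \<noteq> 0" "p y' \<notin> base_values S"
    by (rule component_value_avoiding[OF y(1) finite_base_values[OF S(1)]], rule that)
  define s' where "s' = (y', p y' / v, v)"
  have y'R: "y' \<in> smooth_locus Y" using y'(1) connected_component_in by blast
  have s'X: "s' \<in> X" and s'Z: "s' \<in> Z" "fst (snd s') \<noteq> 0" "s' \<notin> S"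
    unfolding s'_def using y(2) y'(2) y'R smooth_locus_subset not_in_base_values[OF y'(3)]
    by (auto simp: mem_Z mem_suspension)
  have "s \<notin> S" unfolding S_def using insert.hyps(2) insert.prems s(1) by auto
  then have "linked S s s'"
    using s'X s'Z y y'(1) unfolding s(1) s'_def by (intro linked_same_v S) auto
  then obtain g1 where g1: "g1 \<in> flow_group X" "g1 s = s'" "\<forall>t\<in>S. g1 t = t" unfolding linked_def by blast
  have "\<exists>g\<in>flow_group X. (\<forall>t\<in>T. g t = t) \<and> (\<forall>s\<in>S0 \<union> insert s' S1. g s \<in> Z \<and> fst (snd (g s)) \<noteq> 0)"
    using insert.prems s'Z unfolding S_def by (intro insert.IH) auto
  then obtain g2 where g2: "g2 \<in> flow_group X" "\<forall>t\<in>T. g2 t = t"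
    "\<forall>s\<in>S0 \<union> insert s' S1. g2 s \<in> Z \<and> fst (snd (g2 s)) \<noteq> 0" by blast
  show ?case
  proof (intro bexI[of _ "\<lambda>x. g2 (g1 x)"] conjI ballI)
    show "(\<lambda>x. g2 (g1 x)) \<in> flow_group X" by (rule flow_group_comp[OF g2(1) g1(1)])
    show "g2 (g1 t) = t" if "t \<in> T" for t using g1(3) g2(2) that unfolding S_def by simp
    fix t assume t: "t \<in> insert s S0 \<union> S1"
    have "g1 t \<in> S0 \<union> insert s' S1"
    proof (cases "t = s")
      case False
      then have "t \<in> S0 \<union> S1" using t by blast
      then show ?thesis using g1(3) unfolding S_def by auto
    qed (simp add: g1(2))
    then show "g2 (g1 t) \<in> Z" "fst (snd (g2 (g1 t))) \<noteq> 0" using g2(3) by auto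
  qed
qed

text \<open>The flow crossing u = v = 0 would displace points of \<open>S\<close> on the level u =
  0. They are therefore moved off this level by \<open>g\<close>, which fixes both (y, 0, c) and (y,
  0, -c), and the crossing is conjugated by \<open>g\<close>. Choosing c different from all values
  of |v| on \<open>S\<close> keeps the two end points outside \<open>S\<close>.\<close>

lemma linked_through_origin:
  assumes S: "finite S" "S \<subseteq> Z" and y: "(y, 0, 0) \<in> smooth_locus X"
  obtains c where "c > 0" "(y, 0, c) \<in> Z - S" "(y, 0, -c) \<in> Z - S" "linked S (y, 0, c) (y, 0, -c)"
proof -
  have yR: "y \<in> smooth_locus Y" using base_smooth[OF y] .
  have yX: "(y, 0, 0) \<in> X" using y smooth_locus_subset by blast
  then have yY: "y \<in> Y" and py: "p y = 0" by (auto simp: mem_suspension)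
  obtain M k where M: "poly_flow Y M" "((\<lambda>s. p (M (s, y))) has_real_derivative k) (at 0)" "k \<noteq> 0"
    by (rule noncritical_at_origin[OF y], rule that)
  have "finite ((\<lambda>s. \<bar>snd (snd s)\<bar>) ` S)" using S(1) by simp
  then have "infinite ({0<..} - (\<lambda>s. \<bar>snd (snd s)\<bar>) ` S)"
    using Diff_infinite_finite infinite_Ioi by blast
  then obtain c where c: "c > 0" "c \<notin> (\<lambda>s. \<bar>snd (snd s)\<bar>) ` S"
    using infinite_imp_nonempty by (metis DiffE ex_in_conv greaterThan_iff)
  have cZ: "(y, 0, c) \<in> Z - S" "(y, 0, -c) \<in> Z - S"
    using c yR yY py by (auto simp: mem_Z mem_suspension image_iff)
  let ?T = "{(y, 0, c), (y, 0, -c)}"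
  let ?S0 = "{s \<in> S. fst (snd s) = 0}" and ?S1 = "{s \<in> S. fst (snd s) \<noteq> 0}"
  have "\<exists>g\<in>flow_group X. (\<forall>t\<in>?T. g t = t) \<and> (\<forall>s\<in>?S0 \<union> ?S1. g s \<in> Z \<and> fst (snd (g s)) \<noteq> 0)"
    by (rule move_off_zero_level) (use S cZ in auto)
  then obtain g where g: "g \<in> flow_group X" "\<forall>t\<in>?T. g t = t" "\<forall>s\<in>?S0 \<union> ?S1. g s \<in> Z \<and> fst (snd (g s)) \<noteq> 0"
    by blast
  have gS: "g s \<in> Z" "fst (snd (g s)) \<noteq> 0" if "s \<in> S" for s using g(3) that by auto
  define A where "A = (\<lambda>s. fst (snd (g s))) ` S"
  have A: "finite A" "0 \<notin> A" unfolding A_def using S(1) gS(2) by force+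
  obtain N where N: "poly_flow X N"
    "\<And>t y v k. y \<in> Y \<Longrightarrow> ((\<lambda>s. p (M (s, y))) has_real_derivative k) (at 0) \<Longrightarrow>
      N (t, y, 0, v) = (y, 0, v + t * k)"
    "\<And>t y u v. y \<in> Y \<Longrightarrow> u \<in> A \<Longrightarrow> N (t, y, u, v) = (y, u, v)"
    by (rule origin_flow[OF M(1) A], rule that)
  obtain h where h: "h \<in> flow_group X" "\<And>x. x \<in> X \<Longrightarrow> h (g x) = x" "\<And>x. x \<in> X \<Longrightarrow> g (h x) = x"
    by (rule flow_group_inv[OF g(1)], rule that)
  \<comment> \<open>Over y the coordinate v moves with speed k, so this time takes c to -c.\<close>
  define \<phi> where "\<phi> = (\<lambda>x. h (N (- 2 * c / k, g x)))"
  have "\<phi> \<in> flow_group X"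
    unfolding \<phi>_def by (rule flow_group_comp[OF h(1) flow_group_flow[OF N(1) g(1)]])
  moreover have "\<phi> (y, 0, c) = (y, 0, -c)"
  proof -
    have "N (- 2 * c / k, g (y, 0, c)) = (y, 0, -c)"
      using g(2) N(2)[OF yY M(2), of "- 2 * c / k" c] M(3) by simp
    also have "\<dots> = g (y, 0, -c)" using g(2) by simp
    finally show ?thesis unfolding \<phi>_def using h(2)[of "(y, 0, -c)"] cZ Z_subset_X by auto
  qed
  moreover have "\<phi> s = s" if s: "s \<in> S" for s
  proof -
    obtain z u v where gs: "g s = (z, u, v)" by (cases "g s")
    have "z \<in> Y" using gS(1)[OF s] unfolding gs by (simp add: mem_Z mem_suspension)
    moreover have "u \<in> A" unfolding A_def using s gs by force
    ultimately have "N (- 2 * c / k, g s) = g s" unfolding gs by (rule N(3))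
    moreover have "s \<in> X" using s S(2) Z_subset_X by blast
    ultimately show ?thesis unfolding \<phi>_def using h(2) by simp
  qed
  ultimately have "linked S (y, 0, c) (y, 0, -c)" by (rule linkedI)
  then show thesis using that c(1) cZ by blast
qed

end

section \<open>Infinite transitivity on the components\<close>

context flexible_base
begin

lemma linked_join:
  assumes "linked S x z" "linked S x' z" "x' \<in> X" "S \<subseteq> X" shows "linked S x x'"
  using linked_trans[OF assms(1) linked_sym[OF assms(2-4)]] .

lemma linked_fork:
  assumes "linked S z x" "linked S z x'" "z \<in> X" "S \<subseteq> X" shows "linked S x x'"
  using linked_trans[OF linked_sym[OF assms(1,3,4)] assms(2)] .

lemma same_base_component:
  assumes "connected_component (smooth_locus X) x x'"
  shows "connected_component (smooth_locus Y) (fst x) (fst x')"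
proof -
  let ?D = "connected_component_set (smooth_locus X) x"
  have "x \<in> smooth_locus X" using assms connected_component_in by blast
  then have "fst x \<in> fst ` ?D" "fst x' \<in> fst ` ?D"
    using assms by (auto simp: connected_component_refl intro!: imageI)
  moreover have "connected (fst ` ?D)"
    by (intro connected_continuous_image connected_connected_component continuous_intros)
  moreover have "fst ` ?D \<subseteq> smooth_locus Y"
  proof (rule image_subsetI)
    fix z assume "z \<in> ?D"
    then have "z \<in> smooth_locus X" using connected_component_in by blast
    then show "fst z \<in> smooth_locus Y" using base_smooth by (cases z) auto
  qed
  ultimately show ?thesis unfolding connected_component_def by blast
qed

text \<open>
  Over a component of the base there are four pieces, given by \<open>u > 0\<close>, \<open>u < 0\<close>, \<open>v > 0\<close> and
  \<open>v < 0\<close>, on each of which all points are linked. A value of \<open>p\<close> of sign \<open>e\<close> joins \<open>u > 0\<close> to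
  \<open>e v > 0\<close> and \<open>u < 0\<close> to \<open>e v < 0\<close>. The two halves obtained are joined by a value of the opposite
  sign or through a smooth point with \<open>u = v = 0\<close>; otherwise they are told apart by the sign of
  \<open>u + e v\<close>, which is constant on components.
\<close>

lemma linked_in_component:
  assumes S: "finite S" "S \<subseteq> Z" and x: "x \<in> Z - S" and x': "x' \<in> Z - S"
    and xx': "connected_component (smooth_locus X) x x'"
  shows "linked S x x'"
proof -
  define y where "y = fst x"
  let ?cc = "connected_component (smooth_locus Y) y"
  have yR: "y \<in> smooth_locus Y" unfolding y_def using x by (auto simp: Z_def)
  have SX: "S \<subseteq> X" using S(2) Z_subset_X by blast
  have YR: "?cc z \<Longrightarrow> z \<in> smooth_locus Y" for z using connected_component_in by blast
  have YY: "?cc z \<Longrightarrow> z \<in> Y" for z using YR smooth_locus_subset by blast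
  obtain y1 where y1: "?cc y1" "p y1 \<noteq> 0" "p y1 \<notin> base_values S"
    by (rule component_value_avoiding[OF yR finite_base_values[OF S(1)]], rule that)
  define w where "w = p y1"
  \<comment> \<open>\<open>x1\<close> and \<open>x2\<close> represent the two halves: u > 0 or w v >
    0, and u < 0 or w v < 0.\<close>
  define x1 where "x1 = (y1, 1 :: real, w)"
  define x2 where "x2 = (y1, -1 :: real, - w)"
  have x12: "x1 \<in> Z - S" "x2 \<in> Z - S"
    unfolding x1_def x2_def w_def using y1 YR[OF y1(1)] YY[OF y1(1)] not_in_base_values[OF y1(3)]
    by (auto simp: mem_Z mem_suspension)
  have x12X: "x1 \<in> X" "x2 \<in> X" using x12 Z_subset_X by auto
  have w0: "w \<noteq> 0" unfolding w_def using y1(2) .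
  have half1: "linked S (z, u, v) x1" if z: "?cc z" "(z, u, v) \<in> Z - S" "u > 0 \<or> w * v > 0" for z u v
  proof -
    have X: "(z, u, v) \<in> X" "(z, u, v) \<notin> S" "x1 \<notin> S" using z(2) x12 Z_subset_X by auto
    show ?thesis
    proof (cases "u > 0")
      case True
      then show ?thesis
        using X x12X(1) component_trans[OF z(1) y1(1)] unfolding x1_def
        by (intro linked_same_sign_u S) auto
    next
      case False
      then show ?thesis
        using X x12X(1) component_trans[OF z(1) y1(1)] z(3) unfolding x1_def
        by (intro linked_same_sign_v S) (auto simp: mult.commute)
    qed
  qed
  have half2: "linked S (z, u, v) x2" if z: "?cc z" "(z, u, v) \<in> Z - S" "u < 0 \<or> w * v < 0" for z u v
  proof -
    have X: "(z, u, v) \<in> X" "(z, u, v) \<notin> S" "x2 \<notin> S" using z(2) x12 Z_subset_X by auto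
    show ?thesis
    proof (cases "u < 0")
      case True
      then show ?thesis
        using X x12X(2) component_trans[OF z(1) y1(1)] unfolding x2_def
        by (intro linked_same_sign_u S) auto
    next
      case False
      then show ?thesis
        using X x12X(2) component_trans[OF z(1) y1(1)] z(3) unfolding x2_def
        by (intro linked_same_sign_v S) (auto simp: mult.commute)
    qed
  qed
  have x'X: "x' \<in> X" using x' Z_subset_X by blast
  obtain u v where xe: "x = (y, u, v)" unfolding y_def by (cases x) auto
  obtain y' u' v' where xe': "x' = (y', u', v')" by (cases x')
  have ccx: "?cc y" "?cc y'"
    using connected_component_refl[OF yR] same_base_component[OF xx'] xe' by (auto simp: y_def)
  have joined: ?thesis if L: "linked S x1 x2"
  proof -
    have to_x1: "linked S (z, a, b) x1" if z: "?cc z" "(z, a, b) \<in> Z - S" for z a b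
    proof (cases "a > 0 \<or> w * b > 0")
      case False
      then have "a < 0 \<or> w * b < 0"
        using z(2) w0 by (auto simp: mem_Z mult_less_0_iff zero_less_mult_iff)
      then have "linked S (z, a, b) x2" by (rule half2[OF z])
      then show ?thesis by (rule linked_trans[OF _ linked_sym[OF L x12X(1) SX]])
    qed (rule half1[OF z])
    have "linked S x x1" "linked S x' x1"
      using to_x1[OF ccx(1), of u v] to_x1[OF ccx(2), of u' v'] x x' xe xe' by auto
    then show ?thesis by (rule linked_join[OF _ _ x'X SX])
  qed
  show ?thesis
  proof (cases "\<exists>z. ?cc z \<and> p z * w < 0")
    case True
    then obtain z where z: "?cc z" "p z * w < 0" by blast
    \<comment> \<open>Infinitely many values of \<open>p\<close> of sign opposite to w, so that one
      of them avoids the values under \<open>S\<close>.\<close>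
    define J where "J = (if w > 0 then {p z<..<0} else {0<..<p z})"
    have zw: "p z \<in> p ` Collect ?cc" "w \<in> p ` Collect ?cc" using z(1) y1(1) unfolding w_def by auto
    have signs: "w > 0 \<Longrightarrow> p z < 0" "\<not> w > 0 \<Longrightarrow> p z > 0" "\<not> w > 0 \<Longrightarrow> w < 0"
      using z(2) w0 by (auto simp: mult_less_0_iff)
    have "J \<subseteq> {p z..w} \<union> {w..p z}" unfolding J_def using signs(3) by auto
    then have J: "J \<subseteq> p ` Collect ?cc"
      using interval_in_values[OF zw] interval_in_values[OF zw(2,1)] by blast
    have J_inf: "infinite J" unfolding J_def using signs by (simp add: infinite_Ioo)
    have J_sign: "c * w < 0" if "c \<in> J" for c
      using that signs(3) unfolding J_def by (auto simp: mult_less_0_iff split: if_splits)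
    have "infinite (J - base_values S)"
      by (rule Diff_infinite_finite[OF finite_base_values[OF S(1)] J_inf])
    then obtain c where c: "c \<in> J" "c \<notin> base_values S" using infinite_imp_nonempty by blast
    then obtain y2 where y2: "?cc y2" "p y2 = c" using J by blast
    \<comment> \<open>Here u > 0 while w v < 0, so this point lies in both halves.\<close>
    have q: "(y2, 1, c) \<in> Z - S"
      using y2 c(2) YR YY not_in_base_values[of y2 S] by (auto simp: mem_Z mem_suspension)
    then have "linked S (y2, 1, c) x1" by (intro half1 y2) auto
    moreover have "linked S (y2, 1, c) x2"
      using J_sign[OF c(1)] by (intro half2 y2 q) (simp add: mult.commute)
    moreover have "(y2, 1, c) \<in> X" using q Z_subset_X by blast
    ultimately have "linked S x1 x2" using linked_fork[OF _ _ _ SX] by blast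
    then show ?thesis by (rule joined)
  next
    case no_sign_change: False
    show ?thesis
    proof (cases "\<exists>z. ?cc z \<and> (z, 0, 0) \<in> smooth_locus X")
      case True
      then obtain z where z: "?cc z" "(z, 0, 0) \<in> smooth_locus X" by blast
      obtain c where c: "c > 0" "(z, 0, c) \<in> Z - S" "(z, 0, -c) \<in> Z - S" "linked S (z, 0, c) (z, 0, -c)"
        by (rule linked_through_origin[OF S z(2)], rule that)
      have cX: "(z, 0, c) \<in> X" "(z, 0, -c) \<in> X" using c(2,3) Z_subset_X by auto
      have bwd: "linked S (z, 0, -c) (z, 0, c)" by (rule linked_sym[OF c(4) cX(1) SX])
      have "linked S x1 x2"
      proof (cases "w > 0")
        case True
        have "linked S (z, 0, c) x1" using True c(1) by (intro half1 z c) simp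
        moreover have "linked S (z, 0, -c) x2" using True c(1) by (intro half2 z c) simp
        then have "linked S (z, 0, c) x2" by (rule linked_trans[OF c(4)])
        ultimately show ?thesis using linked_fork[OF _ _ cX(1) SX] by blast
      next
        case False
        then have "w < 0" using w0 by simp
        have "linked S (z, 0, -c) x1" using \<open>w < 0\<close> c(1) by (intro half1 z c) (simp add: mult_neg_pos)
        moreover have "linked S (z, 0, c) x2" using \<open>w < 0\<close> c(1) by (intro half2 z c) (simp add: mult_neg_pos)
        then have "linked S (z, 0, -c) x2" by (rule linked_trans[OF bwd])
        ultimately show ?thesis using linked_fork[OF _ _ cX(2) SX] by blast
      qed
      then show ?thesis by (rule joined)
    next
      case no_origin: False
      let ?D = "connected_component_set (smooth_locus X) x"
      \<comment> \<open>At a zero of this function, w times the value of \<open>p\<close> is -u^2.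
        Without a change of sign this forces u = v = 0, which is excluded in this case.\<close>
      let ?l = "\<lambda>s :: 'a \<times> real \<times> real. fst (snd s) + w * snd (snd s)"
      have D_nonzero: "?l s \<noteq> 0" if s: "s \<in> ?D" for s
      proof
        assume l0: "?l s = 0"
        obtain z a b where se: "s = (z, a, b)" by (cases s)
        have sR: "s \<in> smooth_locus X" using s connected_component_in by blast
        have z: "?cc z" using same_base_component[of x s] s se by (simp add: y_def)
        have "(z, a, b) \<in> X" using sR smooth_locus_subset se by blast
        then have ab: "a * b = p z" by (simp add: mem_suspension)
        have wb: "w * b = - a" using l0 se by simp
        have "p z * w = a * (w * b)" unfolding ab[symmetric] by simp
        then have "p z * w = - (a * a)" unfolding wb by simp
        moreover have "p z * w \<ge> 0" using no_sign_change z by force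
        ultimately have "a * a \<le> 0" by linarith
        then have "a = 0" by (auto simp: mult_le_0_iff)
        then have "b = 0" using l0 se w0 by simp
        then show False using no_origin z sR se \<open>a = 0\<close> by blast
      qed
      have "connected (?l ` ?D)"
        by (intro connected_continuous_image connected_connected_component continuous_intros)
      moreover have xD: "x \<in> ?D" "x' \<in> ?D"
        using xx' connected_component_in by (auto simp: connected_component_refl_eq)
      ultimately have same: "?l x > 0 \<longleftrightarrow> ?l x' > 0"
      proof -
        assume conn: "connected (?l ` ?D)"
        have no0: "0 \<notin> ?l ` ?D" using D_nonzero by force
        have "\<not> (?l s \<le> 0 \<and> 0 \<le> ?l t)" if "s \<in> ?D" "t \<in> ?D" for s t
          using connected_contains_Icc[OF conn imageI[OF that(1)] imageI[OF that(2)]] no0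
          by (meson atLeastAtMost_iff subset_eq)
        then show ?thesis using xD by (meson linear not_le less_imp_le)
      qed
      show ?thesis
      proof (cases "?l x > 0")
        case True
        then have "?l x' > 0" using same by blast
        then have "u > 0 \<or> w * v > 0" "u' > 0 \<or> w * v' > 0" using True xe xe' by auto
        then have "linked S x x1" "linked S x' x1"
          using half1[OF ccx(1), of u v] half1[OF ccx(2), of u' v'] x x' xe xe' by auto
        then show ?thesis by (rule linked_join[OF _ _ x'X SX])
      next
        case False
        then have "?l x < 0" "?l x' < 0" using same D_nonzero[OF xD(1)] D_nonzero[OF xD(2)] by auto
        then have "u < 0 \<or> w * v < 0" "u' < 0 \<or> w * v' < 0" using xe xe' by auto
        then have "linked S x x2" "linked S x' x2"
          using half2[OF ccx(1), of u v] half2[OF ccx(2), of u' v'] x x' xe xe' by auto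
        then show ?thesis by (rule linked_join[OF _ _ x'X SX])
      qed
    qed
  qed
qed

text \<open>Induction on the number of points outside \<open>Z\<close>. A flow leaving u = v = 0 at
  one of them is run for a short positive time: that point enters \<open>Z\<close>, points with
  nonzero u are held fixed, and points with u = 0 and nonzero v do not reach v = 0.\<close>

lemma move_off_origin:
  assumes "finite P" "P \<subseteq> smooth_locus X"
  shows "\<exists>g\<in>flow_group X. \<forall>x\<in>P. g x \<in> Z \<and> connected_component (smooth_locus X) x (g x)"
  using assms
proof (induction "card (P - Z)" arbitrary: P rule: less_induct)
  case less
  show ?case
  proof (cases "P \<subseteq> Z")
    case True
    then show ?thesis
      using less.prems flow_group_id[of X]
      by (intro bexI[of _ "\<lambda>x. x"]) (auto simp: connected_component_refl_eq)
  next
    case False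
    then obtain x0 where x0: "x0 \<in> P" "x0 \<notin> Z" by blast
    then obtain y0 where y0: "x0 = (y0, 0, 0)" using smooth_cases less.prems(2) by blast
    obtain M k where M: "poly_flow Y M" "((\<lambda>s. p (M (s, y0))) has_real_derivative k) (at 0)" "k \<noteq> 0"
      by (rule noncritical_at_origin[of y0]) (use x0 y0 less.prems(2) in auto)
    define A where "A = (\<lambda>x. fst (snd x)) ` P - {0}"
    have A: "finite A" "0 \<notin> A" unfolding A_def using less.prems(1) by auto
    obtain N where N: "poly_flow X N"
      "\<And>t y v k. y \<in> Y \<Longrightarrow> ((\<lambda>s. p (M (s, y))) has_real_derivative k) (at 0) \<Longrightarrow>
        N (t, y, 0, v) = (y, 0, v + t * k)"
      "\<And>t y u v. y \<in> Y \<Longrightarrow> u \<in> A \<Longrightarrow> N (t, y, u, v) = (y, u, v)"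
      by (rule origin_flow[OF M(1) A], rule that)
    define \<kappa> where "\<kappa> = (\<lambda>y. frechet_derivative p (at y) (vector_derivative (\<lambda>t. M (t, y)) (at 0)))"
    have \<kappa>: "((\<lambda>s. p (M (s, y))) has_real_derivative \<kappa> y) (at 0)" if "y \<in> Y" for y
      unfolding \<kappa>_def by (rule flow_has_real_derivative[OF M(1) p that])
    have PX: "x \<in> X" if "x \<in> P" for x using that less.prems(2) smooth_locus_subset by blast
    have "\<forall>\<^sub>F t in at_right 0. snd (snd x) \<noteq> 0 \<longrightarrow> \<bar>t * \<kappa> (fst x)\<bar> < \<bar>snd (snd x)\<bar>" for x :: "'a \<times> real \<times> real"
    proof (cases "snd (snd x) = 0")
      case False
      have "((\<lambda>t. \<bar>t * \<kappa> (fst x)\<bar>) \<longlongrightarrow> \<bar>0 * \<kappa> (fst x)\<bar>) (at_right 0)" by (intro tendsto_intros)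
      then have "\<forall>\<^sub>F t in at_right 0. \<bar>t * \<kappa> (fst x)\<bar> < \<bar>snd (snd x)\<bar>"
        using False by (intro order_tendstoD(2)) auto
      then show ?thesis by eventually_elim simp
    qed simp
    then have "\<forall>\<^sub>F t in at_right 0. t > 0 \<and> (\<forall>x\<in>P. snd (snd x) \<noteq> 0 \<longrightarrow> \<bar>t * \<kappa> (fst x)\<bar> < \<bar>snd (snd x)\<bar>)"
      using less.prems(1) by (intro eventually_conj eventually_ball_finite eventually_at_right_less) auto
    then obtain t :: real where t: "t > 0" "\<forall>x\<in>P. snd (snd x) \<noteq> 0 \<longrightarrow> \<bar>t * \<kappa> (fst x)\<bar> < \<bar>snd (snd x)\<bar>"
      using eventually_happens[of _ "at_right (0::real)"] trivial_limit_at_right_real by blast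
    define g where "g = (\<lambda>x. N (t, x))"
    have g: "g \<in> flow_group X" unfolding g_def by (rule flow_group_single[OF N(1)])
    have g0: "g (y, 0, v) = (y, 0, v + t * \<kappa> y)" if "(y, 0, v) \<in> X" for y v
      unfolding g_def using N(2)[OF _ \<kappa>] that by (simp add: mem_suspension)
    have g1: "g (y, u, v) = (y, u, v)" if "(y, u, v) \<in> P" "u \<noteq> 0" for y u v
      unfolding g_def using N(3)[of y u] PX[OF that(1)] that
      by (force simp: A_def mem_suspension)
    have in_Z: "g x \<in> Z" if x: "x \<in> P" "x \<in> Z" for x
    proof -
      obtain y u v where xe: "x = (y, u, v)" by (cases x)
      show ?thesis
      proof (cases "u = 0")
        case True
        then have "v \<noteq> 0" "p y = 0" "y \<in> smooth_locus Y" "y \<in> Y"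
          using x(2) unfolding xe by (auto simp: mem_Z mem_suspension)
        moreover have "v + t * \<kappa> y \<noteq> 0" using t(2)[rule_format, OF x(1)] \<open>v \<noteq> 0\<close> xe by auto
        ultimately show ?thesis
          using g0[of y v] PX[OF x(1)] unfolding xe True by (simp add: mem_Z mem_suspension)
      qed (use g1 x xe in auto)
    qed
    have conn: "connected_component (smooth_locus X) x (g x)" if x: "x \<in> P" for x
    proof -
      obtain y u v where xe: "x = (y, u, v)" by (cases x)
      have xR: "x \<in> smooth_locus X" using x less.prems(2) by blast
      have yR: "y \<in> smooth_locus Y" using xR base_smooth xe by blast
      show ?thesis
      proof (cases "u = 0")
        case False
        then show ?thesis using g1 x xR unfolding xe by (simp add: connected_component_refl)
      next
        case True
        have py: "p y = 0" "y \<in> Y" using PX[OF x] unfolding xe True by (auto simp: mem_suspension)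
        \<comment> \<open>The path in the direction of v stays in the smooth locus: it meets v = 0
          only if it starts there, at a point that is smooth by assumption.\<close>
        let ?L = "(\<lambda>s. (y, 0 :: real, s)) ` closed_segment v (v + t * \<kappa> y)"
        have "connected ?L" by (intro connected_continuous_image continuous_intros connected_segment)
        moreover have "?L \<subseteq> smooth_locus X"
        proof (rule image_subsetI)
          fix s assume s: "s \<in> closed_segment v (v + t * \<kappa> y)"
          show "(y, 0, s) \<in> smooth_locus X"
          proof (cases "s = 0")
            case False
            then have "(y, 0, s) \<in> Z" using yR py by (simp add: mem_Z mem_suspension)
            then show ?thesis using Z_subset_smooth_locus by blast
          next
            case True
            have "v = 0"
            proof (rule ccontr)
              assume "v \<noteq> 0"
              then have "\<bar>t * \<kappa> y\<bar> < \<bar>v\<bar>" using t(2)[rule_format, OF x] xe by simp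
              then show False using s True unfolding closed_segment_eq_real_ivl by (auto split: if_splits)
            qed
            then show ?thesis using xR xe True \<open>u = 0\<close> by simp
          qed
        qed
        moreover have "x \<in> ?L" "g x \<in> ?L"
          using g0[of y v] PX[OF x] unfolding xe True by auto
        ultimately show ?thesis unfolding connected_component_def by blast
      qed
    qed
    have "x0 \<notin> g ` P - Z"
    proof
      assume "x0 \<in> g ` P - Z"
      then obtain x where x: "x \<in> P" "g x = x0" "x \<notin> Z" using in_Z by blast
      then obtain y where y: "x = (y, 0, 0)" using smooth_cases less.prems(2) by blast
      have "g (y, 0, 0) = (y, 0, 0 + t * \<kappa> y)" using g0[of y 0] PX[OF x(1)] unfolding y .
      then have "(y, 0, t * \<kappa> y) = (y0, 0, 0)" using x(2) unfolding y y0 by simp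
      moreover have "\<kappa> y0 \<noteq> 0"
        using DERIV_unique[OF M(2) \<kappa>] M(3) PX[OF x0(1)] y0 by (simp add: mem_suspension)
      ultimately show False using t(1) by auto
    qed
    moreover have "g ` P - Z \<subseteq> P - Z"
    proof
      fix z assume "z \<in> g ` P - Z"
      then obtain x where x: "x \<in> P" "z = g x" "g x \<notin> Z" "x \<notin> Z" using in_Z by blast
      then obtain y where y: "x = (y, 0, 0)" "y \<in> smooth_locus Y" "p y = 0"
        using smooth_cases less.prems(2) by blast
      then have gx: "g x = (y, 0, t * \<kappa> y)" using g0[of y 0] PX[OF x(1)] by simp
      then have "t * \<kappa> y = 0" using x(3) y smooth_locus_subset by (auto simp: mem_Z mem_suspension)
      then have "z = x" using gx unfolding x(2) y(1) by simp
      then show "z \<in> P - Z" using x(1,4) by simp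
    qed
    ultimately have "g ` P - Z \<subset> P - Z" using x0 by blast
    then have "card (g ` P - Z) < card (P - Z)" using less.prems(1) by (intro psubset_card_mono) auto
    moreover have "g ` P \<subseteq> smooth_locus X" using conn connected_component_in by blast
    ultimately obtain h where h: "h \<in> flow_group X"
      "\<forall>x\<in>g ` P. h x \<in> Z \<and> connected_component (smooth_locus X) x (h x)"
      using less.hyps[of "g ` P"] less.prems(1) by blast
    show ?thesis
      using flow_group_comp[OF h(1) g] h(2) conn connected_component_trans
      by (intro bexI[of _ "\<lambda>x. h (g x)"]) blast+
  qed
qed

text \<open>Holding a nonzero u, or a nonzero v, gives a section over the whole component of the
  base. Its image is connected and infinite, because \<open>p\<close> takes infinitely many values
  there.\<close>

lemma infinite_component:
  assumes "x \<in> Z"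
  shows "infinite {x' \<in> Z. connected_component (smooth_locus X) x x'}"
proof -
  obtain y u v where xe: "x = (y, u, v)" by (cases x)
  have x: "x \<in> X" "y \<in> smooth_locus Y" "u \<noteq> 0 \<or> v \<noteq> 0" using assms xe by (auto simp: mem_Z)
  let ?C = "connected_component_set (smooth_locus Y) y"
  have C: "?C \<subseteq> smooth_locus Y" by (rule connected_component_subset)
  have pcont: "continuous_on ?C p"
    by (intro continuous_at_imp_continuous_on ballI continuous_real_polymonial_function p)
  have slice: ?thesis
    if \<sigma>: "continuous_on ?C \<sigma>" "\<And>z. z \<in> ?C \<Longrightarrow> \<sigma> z \<in> Z \<and> fst (\<sigma> z) = z" "\<sigma> y = x" for \<sigma>
  proof -
    have "\<sigma> ` ?C \<subseteq> {x' \<in> Z. connected_component (smooth_locus X) x x'}"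
    proof (rule image_subsetI)
      fix z assume z: "z \<in> ?C"
      have "connected (\<sigma> ` ?C)" by (intro connected_continuous_image \<sigma>(1) connected_connected_component)
      moreover have "\<sigma> ` ?C \<subseteq> smooth_locus X" using \<sigma>(2) Z_subset_smooth_locus by blast
      moreover have "x \<in> \<sigma> ` ?C" "\<sigma> z \<in> \<sigma> ` ?C"
        using \<sigma>(3) z x(2) by (auto intro!: image_eqI[of _ \<sigma> y] simp: connected_component_refl)
      ultimately have "connected_component (smooth_locus X) x (\<sigma> z)" unfolding connected_component_def by blast
      then show "\<sigma> z \<in> {x' \<in> Z. connected_component (smooth_locus X) x x'}" using \<sigma>(2)[OF z] by simp
    qed
    moreover have "infinite (\<sigma> ` ?C)"
    proof
      assume "finite (\<sigma> ` ?C)"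
      then have "finite ((\<lambda>s. p (fst s)) ` \<sigma> ` ?C)" by simp
      moreover have "(\<lambda>s. p (fst s)) ` \<sigma> ` ?C = p ` ?C"
        unfolding image_image using \<sigma>(2) by (intro image_cong) auto
      ultimately show False using infinite_component_values[OF x(2)] by simp
    qed
    ultimately show ?thesis using finite_subset by blast
  qed
  show ?thesis
  proof (cases "u = 0")
    case False
    show ?thesis
      by (rule slice[of "\<lambda>z. (z, u, p z / u)"])
        (use False C smooth_locus_subset x(1) xe in
          \<open>auto intro!: continuous_intros pcont simp: mem_Z mem_suspension field_simps\<close>)
  next
    case True
    then have v: "v \<noteq> 0" using x(3) by simp
    show ?thesis
      by (rule slice[of "\<lambda>z. (z, p z / v, v)"])
        (use v C smooth_locus_subset x(1) xe in
          \<open>auto intro!: continuous_intros pcont simp: mem_Z mem_suspension field_simps\<close>)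
  qed
qed

text \<open>Sources and targets are disjoint, so while one entry moves, the waiting sources can be
  held fixed, and afterwards the finished targets.\<close>

lemma move_disjoint_family:
  assumes "finite I"
  shows "inj_on a I \<Longrightarrow> inj_on b I \<Longrightarrow> a ` I \<subseteq> Z \<Longrightarrow> b ` I \<subseteq> Z \<Longrightarrow> a ` I \<inter> b ` I = {} \<Longrightarrow>
    (\<And>i. i \<in> I \<Longrightarrow> connected_component (smooth_locus X) (a i) (b i)) \<Longrightarrow>
    finite S \<Longrightarrow> S \<subseteq> Z \<Longrightarrow> S \<inter> (a ` I \<union> b ` I) = {} \<Longrightarrow>
    \<exists>g\<in>flow_group X. (\<forall>s\<in>S. g s = s) \<and> (\<forall>i\<in>I. g (a i) = b i)"
  using assms
proof (induction I arbitrary: S rule: finite_induct)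
  case empty
  then show ?case using flow_group_id[of X] by (intro bexI[of _ "\<lambda>x. x"]) auto
next
  case (insert i I)
  have "linked (S \<union> a ` I) (a i) (b i)"
    using insert.prems insert.hyps by (intro linked_in_component) auto
  then obtain g where g: "g \<in> flow_group X" "g (a i) = b i" "\<forall>s\<in>S \<union> a ` I. g s = s"
    unfolding linked_def by blast
  have "\<exists>g\<in>flow_group X. (\<forall>s\<in>insert (b i) S. g s = s) \<and> (\<forall>i\<in>I. g (a i) = b i)"
    using insert.prems insert.hyps by (intro insert.IH) auto
  then obtain h where h: "h \<in> flow_group X" "\<forall>s\<in>insert (b i) S. h s = s" "\<forall>i\<in>I. h (a i) = b i" by blast
  show ?case
    using g(2,3) h(2,3) by (intro bexI[of _ "\<lambda>x. h (g x)"] flow_group_comp[OF h(1) g(1)]) auto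
qed

text \<open>Each component meets \<open>Z\<close> in an infinite set as soon as it contains a point
  of \<open>Z\<close>, so new points can be chosen one after another.\<close>

lemma disjoint_representatives:
  assumes "finite I" "finite B" "\<And>i. i \<in> I \<Longrightarrow> a i \<in> Z"
  shows "\<exists>r. inj_on r I \<and> r ` I \<subseteq> Z \<and> r ` I \<inter> B = {} \<and>
    (\<forall>i\<in>I. connected_component (smooth_locus X) (a i) (r i))"
  using assms
proof (induction I rule: finite_induct)
  case empty
  then show ?case by simp
next
  case (insert i I)
  then obtain r where r: "inj_on r I" "r ` I \<subseteq> Z" "r ` I \<inter> B = {}"
    "\<forall>i\<in>I. connected_component (smooth_locus X) (a i) (r i)" by auto
  have "infinite ({x' \<in> Z. connected_component (smooth_locus X) (a i) x'} - (B \<union> r ` I))"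
    using insert.hyps(1) insert.prems by (intro Diff_infinite_finite infinite_component) auto
  then obtain x' where x': "x' \<in> Z" "connected_component (smooth_locus X) (a i) x'" "x' \<notin> B" "x' \<notin> r ` I"
    using infinite_imp_nonempty by blast
  define r' where "r' = r(i := x')"
  have r'_i: "r' i = x'" unfolding r'_def by simp
  have r'_I: "r' j = r j" if "j \<in> I" for j using that insert.hyps(2) unfolding r'_def by auto
  have img: "r' ` insert i I = insert x' (r ` I)"
    unfolding image_insert r'_i using r'_I by (simp cong: image_cong)
  have "inj_on r' I" using r(1) r'_I by (simp cong: inj_on_cong)
  moreover have "r' i \<notin> r' ` I" using x'(4) r'_I unfolding r'_i by (simp cong: image_cong)
  ultimately have "inj_on r' (insert i I)" by (simp add: insert.hyps(2))
  moreover have "\<forall>j\<in>insert i I. connected_component (smooth_locus X) (a j) (r' j)"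
    using r(4) x'(2) r'_i r'_I by simp
  moreover have "r' ` insert i I \<subseteq> Z" "r' ` insert i I \<inter> B = {}"
    unfolding img using r(2,3) x'(1,3) by auto
  ultimately show ?case by (intro exI[of _ r'] conjI)
qed

text \<open>Passing through a third family, disjoint from the first two, avoids collisions.\<close>

lemma move_family:
  assumes I: "finite I" and a: "inj_on a I" "a ` I \<subseteq> smooth_locus X"
    and b: "inj_on b I" "b ` I \<subseteq> smooth_locus X"
    and ab: "\<And>i. i \<in> I \<Longrightarrow> connected_component (smooth_locus X) (a i) (b i)"
  shows "\<exists>g\<in>flow_group X. \<forall>i\<in>I. g (a i) = b i"
proof -
  let ?cc = "connected_component (smooth_locus X)"
  have inj: "inj_on g X" if g: "g \<in> flow_group X" for g
  proof -
    obtain h where "h \<in> flow_group X" "\<And>x. x \<in> X \<Longrightarrow> h (g x) = x"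
      by (rule flow_group_inv[OF g], rule that)
    from this(2) show ?thesis by (rule inj_on_inverseI)
  qed
  have aX: "a ` I \<subseteq> X" and bX: "b ` I \<subseteq> X" using a(2) b(2) smooth_locus_subset by blast+
  obtain g1 where g1: "g1 \<in> flow_group X" "\<forall>x\<in>a ` I. g1 x \<in> Z \<and> ?cc x (g1 x)"
    using move_off_origin[OF finite_imageI[OF I] a(2)] by blast
  obtain g2 where g2: "g2 \<in> flow_group X" "\<forall>x\<in>b ` I. g2 x \<in> Z \<and> ?cc x (g2 x)"
    using move_off_origin[OF finite_imageI[OF I] b(2)] by blast
  define a' where "a' = g1 \<circ> a"
  define b' where "b' = g2 \<circ> b"
  have a': "inj_on a' I" "a' ` I \<subseteq> Z"
    unfolding a'_def using g1 comp_inj_on[OF a(1) inj_on_subset[OF inj[OF g1(1)] aX]] by auto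
  have b': "inj_on b' I" "b' ` I \<subseteq> Z"
    unfolding b'_def using g2 comp_inj_on[OF b(1) inj_on_subset[OF inj[OF g2(1)] bX]] by auto
  have fin: "finite (a' ` I \<union> b' ` I)" using I by simp
  have "\<exists>r. inj_on r I \<and> r ` I \<subseteq> Z \<and> r ` I \<inter> (a' ` I \<union> b' ` I) = {} \<and> (\<forall>i\<in>I. ?cc (a' i) (r i))"
    by (rule disjoint_representatives[OF I fin]) (use a'(2) in blast)
  then obtain r where r: "inj_on r I" "r ` I \<subseteq> Z" "r ` I \<inter> (a' ` I \<union> b' ` I) = {}" "\<forall>i\<in>I. ?cc (a' i) (r i)"
    by (elim exE conjE)
  have "?cc (b' i) (r i)" if i: "i \<in> I" for i
  proof -
    have "?cc (a i) (a' i)" "?cc (b i) (b' i)" using g1(2) g2(2) i unfolding a'_def b'_def by auto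
    then show ?thesis using r(4) ab[OF i] i by (meson connected_component_sym connected_component_trans)
  qed
  then have "\<exists>g\<in>flow_group X. (\<forall>s\<in>{}. g s = s) \<and> (\<forall>i\<in>I. g (b' i) = r i)"
    using b' r by (intro move_disjoint_family I) auto
  then obtain h2 where h2: "h2 \<in> flow_group X" "\<forall>i\<in>I. h2 (b' i) = r i" by blast
  have "\<exists>g\<in>flow_group X. (\<forall>s\<in>{}. g s = s) \<and> (\<forall>i\<in>I. g (a' i) = r i)"
    using a' r by (intro move_disjoint_family I) auto
  then obtain h1 where h1: "h1 \<in> flow_group X" "\<forall>i\<in>I. h1 (a' i) = r i" by blast
  \<comment> \<open>Both families are taken to \<open>r\<close>; \<open>k\<close> leads back from
    \<open>r\<close> to \<open>b\<close>.\<close>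
  obtain k where k: "k \<in> flow_group X" "\<And>x. x \<in> X \<Longrightarrow> k (h2 (g2 x)) = x"
    by (rule flow_group_inv[OF flow_group_comp[OF h2(1) g2(1)]], blast)
  show ?thesis
  proof (rule bexI[of _ "\<lambda>x. k (h1 (g1 x))"])
    show "(\<lambda>x. k (h1 (g1 x))) \<in> flow_group X"
      by (rule flow_group_comp[OF k(1) flow_group_comp[OF h1(1) g1(1)]])
    show "\<forall>i\<in>I. k (h1 (g1 (a i))) = b i"
    proof
      fix i assume i: "i \<in> I"
      have "h1 (g1 (a i)) = h2 (g2 (b i))"
        using h1(2) h2(2) i unfolding a'_def b'_def by simp
      then show "k (h1 (g1 (a i))) = b i" using k(2)[of "b i"] bX i by auto
    qed
  qed
qed

theorem infinitely_transitive_suspension: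
  "infinitely_transitive_on_components (SAut X) (smooth_locus X)"
  unfolding infinitely_transitive_on_components_def
proof (intro allI impI)
  fix m :: "('a \<times> real \<times> real) set \<Rightarrow> nat" and P Q
  let ?R = "smooth_locus X"
  assume fin: "finite {C \<in> components ?R. m C \<noteq> 0}"
    and P: "component_tuple ?R m P" and Q: "component_tuple ?R m Q"
  \<comment> \<open>The tuples of all components are flattened into one finite family. Distinctness
    across components follows from their disjointness.\<close>
  define I where "I = (SIGMA C:{C \<in> components ?R. m C \<noteq> 0}. {..<m C})"
  have I: "finite I" unfolding I_def using fin by (intro finite_SigmaI) auto
  have I_mem: "(C, j) \<in> I \<longleftrightarrow> C \<in> components ?R \<and> j < m C" for C j unfolding I_def by auto
  have family: "inj_on (\<lambda>(C, j). T C j) I" "\<And>C j. (C, j) \<in> I \<Longrightarrow> T C j \<in> C"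
    if T: "component_tuple ?R m T" for T
  proof -
    show mem: "T C j \<in> C" if "(C, j) \<in> I" for C j
      using T that unfolding component_tuple_def I_mem by blast
    show "inj_on (\<lambda>(C, j). T C j) I"
    proof (rule inj_onI, clarify)
      fix C j D l assume *: "(C, j) \<in> I" "(D, l) \<in> I" "T C j = T D l"
      then have "C \<inter> D \<noteq> {}" using mem[OF *(1)] mem[OF *(2)] by auto
      then have "C = D" using components_nonoverlap[of C ?R D] * unfolding I_mem by blast
      moreover have "inj_on (T C) {..<m C}" using T * unfolding component_tuple_def I_mem by blast
      ultimately show "C = D \<and> j = l" using * unfolding I_mem by (auto dest: inj_onD)
    qed
  qed
  have "\<exists>g\<in>flow_group X. \<forall>i\<in>I. g ((\<lambda>(C, j). P C j) i) = (\<lambda>(C, j). Q C j) i"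
  proof (rule move_family[OF I family(1)[OF P] _ family(1)[OF Q]])
    show "(\<lambda>(C, j). P C j) ` I \<subseteq> ?R" "(\<lambda>(C, j). Q C j) ` I \<subseteq> ?R"
      using family(2)[OF P] family(2)[OF Q] in_components_subset I_mem by fastforce+
    fix i assume "i \<in> I"
    moreover obtain C j where i: "i = (C, j)" by (cases i)
    ultimately have "C \<in> components ?R" "P C j \<in> C" "Q C j \<in> C"
      using family(2)[OF P] family(2)[OF Q] I_mem by auto
    then show "connected_component ?R ((\<lambda>(C, j). P C j) i) ((\<lambda>(C, j). Q C j) i)"
      unfolding i connected_component_def
      by (intro exI[of _ C]) (simp add: in_components_connected in_components_subset)
  qed
  then obtain g where g: "g \<in> flow_group X" "\<forall>i\<in>I. g ((\<lambda>(C, j). P C j) i) = (\<lambda>(C, j). Q C j) i" by blast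
  show "\<exists>g\<in>SAut X. \<forall>C\<in>components ?R. \<forall>j<m C. g (P C j) = Q C j"
  proof (rule bexI[OF _ restrict_flow_group_in_SAut[OF g(1)]], intro ballI allI impI)
    fix C j assume C: "C \<in> components ?R" "j < m C"
    then have i: "(C, j) \<in> I" by (simp add: I_mem)
    have "P C j \<in> X" using family(2)[OF P i] C(1) in_components_subset smooth_locus_subset by blast
    then show "restrict g X (P C j) = Q C j" using bspec[OF g(2) i] by simp
  qed
qed

end

theorem theorem1:
  fixes Y :: "'a::euclidean_space set" and f :: "'a \<Rightarrow> real"
  assumes "algebraic_set Y"
    and "f \<in> regular_functions Y"
    and "\<And>C. C \<in> components (smooth_locus Y) \<Longrightarrow> \<exists>d\<ge>2. \<forall>y\<in>C. smooth_at Y d y"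
    and "\<And>C. C \<in> components (smooth_locus Y) \<Longrightarrow> \<not> f constant_on C"
    and "flexible Y"
    and "infinitely_transitive_on_components (SAut Y) (smooth_locus Y)"
  shows "flexible (suspension Y f) \<and>
         infinitely_transitive_on_components (SAut (suspension Y f)) (smooth_locus (suspension Y f))"
proof -
  obtain p where p: "real_polynomial_function p" "f = restrict p Y"
    using assms(2) unfolding regular_functions_def by blast
  have X: "suspension Y f = suspension Y p" unfolding suspension_def p(2) by auto
  interpret flexible_base Y p
  proof
    show "real_polynomial_function p" by (rule p(1))
    show "\<not> p constant_on C" if C: "C \<in> components (smooth_locus Y)" for C
    proof -
      have "f y = p y" if "y \<in> C" for y
        using that in_components_subset[OF C] smooth_locus_subset p(2) by auto
      then show ?thesis using assms(4)[OF C] unfolding constant_on_def by auto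
    qed
    show "tangent_space Y y \<subseteq> span (velocities Y y)" if y: "y \<in> smooth_locus Y" for y
      using assms(5) y flexible_point_iff_velocities[of y Y] smooth_locus_subset
      unfolding flexible_def by blast
    show "infinitely_transitive_on_components (SAut Y) (smooth_locus Y)" by (rule assms(6))
  qed
  show ?thesis unfolding X using flexible_suspension infinitely_transitive_suspension by blast
qed

end
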